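(* For every integer $\ell \geq 0$, the polynomial $\varphi_{12\cdot 2^{\ell}}(X)$ is irreducible over $\mathbb{Q}$.
   Context: For even $k\geq 2$, let $E_k(z) = 1-\frac{2k}{B_k}\sum_{n\geq 1}\sigma_{k-1}(n)e^{2\pi i n z}$ be the normalized Eisenstein series of weight $k$ on $\mathrm{SL}_2(\mathbb{Z})$ ($B_k$ the Bernoulli number, $\sigma_{k-1}(n)=\sum_{d\mid n}d^{k-1}$), let $\Delta = \frac{1}{1728}(E_4^3-E_6^2)$ and $j = E_4^3/\Delta$ the modular $j$-invariant. Define $$\varphi_k(X) = \prod_{\substack{E_k(z)=0\\ j(z)\neq 0,1728}} (X - j(z)),$$ where the product runs over the zeros $z$ of $E_k$ in a fundamental domain for $\mathrm{SL}_2(\mathbb{Z})$ (counted with multiplicity) whose $j$-value is neither $0$ nor $1728$. For example $\varphi_{16}(X)=X-\frac{3456000}{3617}$. *)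

theory Defs
  imports "HOL-Complex_Analysis.Complex_Analysis" "HOL-Computational_Algebra.Polynomial"
begin

function bernoulli :: "nat \<Rightarrow> rat" where
  "bernoulli n = (if n = 0 then 1
     else - (\<Sum>j<n. of_nat ((n + 1) choose j) * bernoulli j) / of_nat (n + 1))"
  by auto
termination by (relation "Wellfounded.measure id") auto

definition divisor_sigma :: "nat \<Rightarrow> nat \<Rightarrow> nat" where
  "divisor_sigma r n = (\<Sum>d\<in>{d. d dvd n}. d ^ r)"

definition eisenstein :: "nat \<Rightarrow> complex \<Rightarrow> complex" where
  "eisenstein k z = 1 - of_rat (2 * of_nat k / bernoulli k) *
     (\<Sum>n. of_nat (divisor_sigma (k - 1) (Suc n)) * exp (2 * pi * \<i> * of_nat (Suc n) * z))"

definition modular_discriminant :: "complex \<Rightarrow> complex" where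
  "modular_discriminant z = (eisenstein 4 z ^ 3 - eisenstein 6 z ^ 2) / 1728"

definition j_invariant :: "complex \<Rightarrow> complex" where
  "j_invariant z = eisenstein 4 z ^ 3 / modular_discriminant z"

(* standard fundamental domain for SL_2(Z), with boundary identifications
   (each SL_2(Z)-orbit in the upper half plane meets it exactly once) *)
definition fund_domain :: "complex set" where
  "fund_domain = {z. 0 < Im z \<and> -1/2 \<le> Re z \<and> Re z < 1/2 \<and>
                     (1 < cmod z \<or> (cmod z = 1 \<and> Re z \<le> 0))}"

definition phi_poly :: "nat \<Rightarrow> complex poly" where
  "phi_poly k = (\<Prod>z\<in>{z\<in>fund_domain. eisenstein k z = 0 \<and>
                         j_invariant z \<noteq> 0 \<and> j_invariant z \<noteq> 1728}.
                   [:- j_invariant z, 1:] ^ nat (zorder (eisenstein k) z))"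

end

theory Submission
  imports Defs "HOL-Computational_Algebra.Fundamental_Theorem_Algebra"
begin

text \<open>
  The function \<open>Y(z) = \<Sum> (\<pi> / sin \<pi>(z + m\<tau>))\<^sup>2\<close>, summed over all integers \<open>m\<close>, is elliptic for the
  lattice \<open>\<int> + \<int>\<tau>\<close>, and its Laurent coefficients at 0 are multiples of the values \<open>E\<^sub>k(\<tau>)\<close>. By Liouville's
  theorem these coefficients satisfy the Weierstrass recurrence and are homogeneous in the lattice, and the
  lattice can be recovered from them as the set of poles. This gives the modularity of \<open>E\<^sub>4\<close> and \<open>E\<^sub>6\<close>, the
  nonvanishing of the discriminant (otherwise \<open>Y\<close> would degenerate and have collinear poles) and the
  injectivity of \<open>j\<close> on lattices up to homothety; the maximum principle gives its surjectivity and
  \<open>2 E\<^sub>4 E\<^sub>6' - 3 E\<^sub>4' E\<^sub>6 = const \<cdot> \<Delta>\<close>, so that \<open>j\<close> is unramified off \<open>j = 0, 1728\<close>.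

  After scaling, the \<open>m\<close>-th coefficient \<open>H\<^sub>m\<close> (of weight \<open>2m\<close>) is a polynomial in \<open>E\<^sub>4\<close> and \<open>F = 2 E\<^sub>6\<close>. The first
  order equation of \<open>Y\<close> expresses \<open>(2m + 1) H\<^sub>m\<close> integrally through lower coefficients, so \<open>H\<^sub>m\<close> is 2-integral;
  the second order equation gives \<open>H\<^sub>2\<^sub>m \<equiv> H\<^sub>m\<^sup>2\<close> modulo 2, hence \<open>H\<^sub>m \<equiv> F\<close> to the power \<open>2\<^sup>i\<close> for \<open>m = 3 \<cdot> 2\<^sup>i\<close>. With
  \<open>D = 256 \<Delta>\<close> one has \<open>F\<^sup>2 = 4 E\<^sub>4\<^sup>3 - 27 D\<close>, and \<open>H\<^sub>m = D\<^sup>n Q(j / 256)\<close> for \<open>m = 6 n\<close>, \<open>n = 2\<^sup>l\<close>. Modulo 2 the polynomial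
  \<open>Q\<close> is the constant 1, while its leading coefficient is 2 modulo 4, so \<open>Q\<close> is a reversed Eisenstein polynomial.
\<close>

section \<open>Rational numbers integral at 2\<close>

text \<open>Why 2, and why these weights: \<open>H_3\<close> is a unit at 2 times
  \<open>2 E_6\<close>, so with \<open>F = 2 E_6\<close> as variable \<open>H_3\<close> is congruent
  to \<open>F\<close>, and the squaring rule reaches exactly the indices \<open>3 * 2^i\<close>. The
  factor 256 in \<open>D\<close> is forced by \<open>4 * 1728 = 27 * 256\<close>: it leaves
  \<open>D\<close> with an odd coefficient in \<open>F^2 = 4 E_4^3 - 27 D\<close>, so that modulo 2
  a power of \<open>F^2\<close> turns into a power of \<open>D\<close> and \<open>Q\<close> into a
  constant. The leading coefficient of \<open>Q\<close> is the value of \<open>H_6n\<close> at the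
  cusp, \<open>4^m (1 - 2m) B_2m / (2m)!\<close> with \<open>m = 6n\<close>. Its 2-adic valuation
  could be read off from von Staudt-Clausen and Legendre's formula; here it is extracted from the
  recurrence, which at the same time shows that \<open>B_12n\<close>, a denominator in
  \<open>E_12n\<close>, does not vanish. The Eisenstein series are given as q-series, so modularity
  has to be proved. Summing \<open>csq\<close> over \<open>m\<close> alone converges absolutely and
  produces these q-series at once as Laurent coefficients, which avoids conditionally convergent
  lattice sums.\<close>

definition loc2 :: "rat set" where
  "loc2 = {x. \<exists>a b::int. odd b \<and> x = of_int a / of_int b}"

lemma loc2I: "odd b \<Longrightarrow> x = of_int a / of_int b \<Longrightarrow> x \<in> loc2"
  unfolding loc2_def by blast

lemma loc2E:
  assumes "x \<in> loc2"
  obtains a b where "odd b" "b \<noteq> 0" "x = of_int a / of_int b"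
  using assms unfolding loc2_def by fastforce

lemma loc2_of_int [simp]: "of_int a \<in> loc2"
  by (rule loc2I[of 1 _ a]) auto

lemma loc2_0 [simp]: "0 \<in> loc2" and loc2_1 [simp]: "1 \<in> loc2" 
  and loc2_numeral [simp]: "numeral n \<in> loc2" and loc2_of_nat [simp]: "of_nat k \<in> loc2"
  using loc2_of_int[of 0] loc2_of_int[of 1] loc2_of_int[of "numeral n"] loc2_of_int[of "int k"]
  by (simp_all del: loc2_of_int)

lemma loc2_add [intro]:
  assumes "x \<in> loc2" "y \<in> loc2" shows "x + y \<in> loc2"
proof -
  obtain a b where 1: "odd b" "b \<noteq> 0" "x = of_int a / of_int b" using assms(1) by (rule loc2E)
  obtain c d where 2: "odd d" "d \<noteq> 0" "y = of_int c / of_int d" using assms(2) by (rule loc2E)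
  show ?thesis by (rule loc2I[of "b*d" _ "a*d+c*b"]) (use 1 2 in \<open>auto simp: field_simps\<close>)
qed

lemma loc2_mult [intro]:
  assumes "x \<in> loc2" "y \<in> loc2" shows "x * y \<in> loc2"
proof -
  obtain a b where 1: "odd b" "b \<noteq> 0" "x = of_int a / of_int b" using assms(1) by (rule loc2E)
  obtain c d where 2: "odd d" "d \<noteq> 0" "y = of_int c / of_int d" using assms(2) by (rule loc2E)
  show ?thesis by (rule loc2I[of "b*d" _ "a*c"]) (use 1 2 in \<open>auto simp: field_simps\<close>)
qed

lemma loc2_minus [intro]: "x \<in> loc2 \<Longrightarrow> - x \<in> loc2"
  using loc2_mult[of "of_int (-1)" x] by (metis loc2_of_int mult_minus1 of_int_1 of_int_minus)

lemma loc2_diff [intro]: "x \<in> loc2 \<Longrightarrow> y \<in> loc2 \<Longrightarrow> x - y \<in> loc2"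
  using loc2_add[of x "-y"] by auto

lemma loc2_power [intro]: "x \<in> loc2 \<Longrightarrow> x ^ n \<in> loc2"
  by (induction n) auto

lemma loc2_sum [intro]: "(\<And>i. i \<in> S \<Longrightarrow> f i \<in> loc2) \<Longrightarrow> sum f S \<in> loc2"
  by (induction S rule: infinite_finite_induct) auto

lemma loc2_div_odd:
  assumes "x \<in> loc2" "odd b" shows "x / of_int b \<in> loc2"
  using loc2_mult[OF assms(1), of "1 / of_int b"] loc2I[of b "1 / of_int b" 1] assms(2) by simp

lemma loc2_odd_mult_cancel:
  assumes "of_int b * x \<in> loc2" "odd b" shows "x \<in> loc2"
proof -
  have "b \<noteq> 0" using assms(2) by auto
  then show ?thesis using loc2_div_odd[OF assms] by auto
qed

text \<open>Membership in the maximal ideal of \<open>loc2\<close>; divisibility by 4 is then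
  expressed by \<open>even2 (x / 2)\<close>.\<close>

definition even2 :: "rat \<Rightarrow> bool" where "even2 x \<longleftrightarrow> x / 2 \<in> loc2"

lemma even2_0 [simp]: "even2 0" by (auto simp: even2_def)

lemma even2_twice: "x \<in> loc2 \<Longrightarrow> even2 (2 * x)" by (auto simp: even2_def)

lemma even2_add: "even2 x \<Longrightarrow> even2 y \<Longrightarrow> even2 (x + y)"
  by (auto simp: even2_def add_divide_distrib)

lemma even2_diff: "even2 x \<Longrightarrow> even2 y \<Longrightarrow> even2 (x - y)"
  by (auto simp: even2_def diff_divide_distrib)

lemma even2_mult: "x \<in> loc2 \<Longrightarrow> even2 y \<Longrightarrow> even2 (x * y)"
  using loc2_mult[of x "y/2"] by (auto simp: even2_def)

lemma even2_sum: "(\<And>i. i \<in> S \<Longrightarrow> even2 (f i)) \<Longrightarrow> even2 (sum f S)"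
  by (induction S rule: infinite_finite_induct) (auto intro: even2_add)

lemma even2_of_int_iff: "even2 (of_int a) \<longleftrightarrow> even a"
proof
  assume "even a" then obtain c where "a = 2 * c" by blast
  then show "even2 (of_int a)" by (auto simp: even2_def)
next
  assume "even2 (of_int a)"
  then obtain c d :: int where cd: "odd d" "of_int a / 2 = (of_int c / of_int d :: rat)"
    unfolding even2_def loc2_def by blast
  have "d \<noteq> 0" using cd(1) by auto
  then have "(of_int (a * d) :: rat) = of_int (2 * c)" using cd(2) by (simp add: field_simps)
  then have "a * d = 2 * c" by (simp only: of_int_eq_iff)
  then show "even a" using cd(1) by (metis dvd_triv_left even_mult_iff)
qed

lemma even2_frac_iff: "odd b \<Longrightarrow> even2 (of_int a / of_int b) \<longleftrightarrow> even a"
proof -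
  assume b: "odd b"
  have "b \<noteq> 0" using b by auto
  then have e: "(of_int a :: rat) = of_int b * (of_int a / of_int b)" by simp
  have "even2 (of_int a / of_int b) \<longleftrightarrow> even2 (of_int a)"
  proof
    assume "even2 (of_int a / of_int b)"
    then show "even2 (of_int a)" using even2_mult[of "of_int b" "of_int a / of_int b"] e by simp
  next
    assume "even2 (of_int a)"
    then have "of_int a / 2 / of_int b \<in> loc2" using b loc2_div_odd unfolding even2_def by blast
    then show "even2 (of_int a / of_int b)" unfolding even2_def by (simp add: field_simps)
  qed
  then show ?thesis by (simp add: even2_of_int_iff)
qed

lemma odd2_mult:
  assumes "x \<in> loc2" "y \<in> loc2" "\<not> even2 x" "\<not> even2 y" shows "\<not> even2 (x * y)"
proof -
  obtain a b c d where "odd b" "odd d" "x = of_int a / of_int b" "y = of_int c / of_int d"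
    using assms unfolding loc2_def by blast
  moreover from this have "odd (b*d)" "x * y = of_int (a*c) / of_int (b*d)" by auto
  ultimately show ?thesis using assms even2_frac_iff by (metis even_mult_iff)
qed

lemma odd2_power: "x \<in> loc2 \<Longrightarrow> \<not> even2 x \<Longrightarrow> \<not> even2 (x ^ n)"
proof (induction n)
  case 0 then show ?case using even2_of_int_iff[of 1] by simp
next
  case (Suc n) then show ?case using odd2_mult[of x "x^n"] by auto
qed

lemma odd2_add_even: "even2 y \<Longrightarrow> even2 (x + y) \<longleftrightarrow> even2 x"
  using even2_add[of x y] even2_diff[of "x+y" y] by auto

section \<open>The recurrence of the Weierstrass Laurent coefficients\<close>

lemma sum_symmetric_even:
  fixes x :: "nat \<Rightarrow> 'a::comm_ring_1"
  assumes "a \<le> m"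
  shows "(\<Sum>i=a..2*m-a. x i * x (2*m-i)) = x m ^ 2 + 2 * (\<Sum>i=a..<m. x i * x (2*m-i))"
proof -
  have s: "{a..2*m-a} = {a..<m} \<union> {m} \<union> {m<..2*m-a}" using assms by auto
  have r: "(\<Sum>i\<in>{m<..2*m-a}. x i * x (2*m-i)) = (\<Sum>i=a..<m. x i * x (2*m-i))"
    by (rule sum.reindex_bij_witness[of _ "\<lambda>i. 2*m-i" "\<lambda>i. 2*m-i"]) (use assms in \<open>auto simp: mult.commute\<close>)
  show ?thesis unfolding s
    by (subst sum.union_disjoint, simp, simp, force, subst sum.union_disjoint, simp, simp, force)
      (simp add: r power2_eq_square)
qed

lemma sum_symmetric_odd:
  fixes x :: "nat \<Rightarrow> 'a::comm_ring_1"
  assumes "a \<le> m"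
  shows "(\<Sum>i=a..2*m+1-a. x i * x (2*m+1-i)) = 2 * (\<Sum>i=a..m. x i * x (2*m+1-i))"
proof -
  have s: "{a..2*m+1-a} = {a..m} \<union> {m<..2*m+1-a}" using assms by auto
  have r: "(\<Sum>i\<in>{m<..2*m+1-a}. x i * x (2*m+1-i)) = (\<Sum>i=a..m. x i * x (2*m+1-i))"
    by (rule sum.reindex_bij_witness[of _ "\<lambda>i. 2*m+1-i" "\<lambda>i. 2*m+1-i"]) (use assms in \<open>auto simp: mult.commute\<close>)
  show ?thesis unfolding s
    by (subst sum.union_disjoint, simp, simp, force) (use r in simp)
qed

text \<open>Comparing coefficients in \<wp>'' = 6 \<wp>^2 - const, with \<open>h m\<close> the
  coefficient of \<open>z^(2m-2)\<close>, gives this classical recurrence. It is written without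
  division so that it also makes sense for polynomials.\<close>

definition wp_rec :: "(nat \<Rightarrow> 'a::comm_ring_1) \<Rightarrow> bool" where
  "wp_rec h \<longleftrightarrow> (\<forall>m\<ge>4. of_int ((2 * int m + 1) * (int m - 3)) * h m = 3 * (\<Sum>i=2..m-2. h i * h (m - i)))"

definition euler_op :: "'a::comm_ring_1 fps \<Rightarrow> 'a fps" where
  "euler_op f = fps_X * fps_deriv f"

lemma euler_op_nth [simp]: "fps_nth (euler_op f) n = of_nat n * fps_nth f n"
  by (cases n) (auto simp: euler_op_def)

lemma euler_op_simps:
  "euler_op (f + g) = euler_op f + euler_op g"
  "euler_op (f - g) = euler_op f - euler_op g"
  "euler_op (f * g) = euler_op f * g + f * euler_op g"
  "euler_op 1 = 0" "euler_op (fps_const c) = 0"  "euler_op fps_X = fps_X"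
  by (auto simp: euler_op_def algebra_simps)

text \<open>
  Let \<open>\<phi> = 1 + \<Sum> h\<^sub>m s\<^sup>m\<close>, i.e. \<open>\<phi>(z\<^sup>2) = z\<^sup>2 \<wp>(z)\<close>, and \<open>\<theta> = s d/ds\<close>. Below, \<open>V = 0\<close> is the second order
  equation and \<open>W = 0\<close> the first order equation of \<open>\<wp>\<close>. Since \<open>\<theta>W - 3W = (\<theta>\<phi> - \<phi>) V\<close>, the recurrence forces
  \<open>W\<close> to be a multiple of \<open>s\<^sup>3\<close>. In the resulting formula the factor of \<open>h m\<close> is odd.
\<close>
lemma wp_rec_first_order:
  fixes h :: "nat \<Rightarrow> 'a::{idom,ring_char_0}"
  assumes rec: "wp_rec h" and m: "m \<ge> 4"
  defines "\<psi> \<equiv> Abs_fps (\<lambda>n. if n < 2 then 0 else h n)"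
  defines "\<eta> \<equiv> Abs_fps (\<lambda>n. if n < 2 then 0 else of_int (int n - 1) * h n)"
  shows "of_nat (2 * m + 1) * h m = fps_nth (\<eta> * \<eta> - 3 * (\<psi> * \<psi>) - \<psi> * (\<psi> * \<psi>)) m + 5 * h 2 * fps_nth \<psi> (m - 2)"
proof -
  define \<phi> where "\<phi> = 1 + \<psi>"
  \<comment> \<open>\<open>A\<close> and \<open>B\<close> are \<open>-g2/4\<close> and
    \<open>-g3/4\<close> for the Weierstrass invariants \<open>g2 = 20 h 2\<close> and
    \<open>g3 = 28 h 3\<close>; the series \<open>T\<close> below satisfies z^3 \<wp>'(z) = 2
    T(z^2).\<close>
  define A where "A = fps_const (- 5 * h 2)"
  define B where "B = fps_const (- 7 * h 3)"
  define T where "T = euler_op \<phi> - \<phi>"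
  have T: "T = \<eta> - 1"
    by (rule fps_ext) (auto simp: T_def \<phi>_def \<psi>_def \<eta>_def algebra_simps)
  define V where "V = 2 * euler_op (euler_op \<phi>) - 5 * euler_op \<phi> + 3 * \<phi> - 3 * (\<phi> * \<phi>) - A * fps_X ^ 2"
  have sq: "fps_nth (\<psi> * \<psi>) n = (if n < 4 then 0 else (\<Sum>i=2..n-2. h i * h (n - i)))" for n
  proof -
    have "fps_nth (\<psi> * \<psi>) n = (\<Sum>i\<in>{0..n}. if i \<ge> 2 \<and> i + 2 \<le> n then h i * h (n - i) else 0)"
      unfolding fps_mult_nth \<psi>_def by (intro sum.cong) auto
    also have "\<dots> = (\<Sum>i\<in>{i\<in>{0..n}. i \<ge> 2 \<and> i + 2 \<le> n}. h i * h (n - i))"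
      by (rule sum.inter_filter[symmetric]) auto
    also have "{i\<in>{0..n}. i \<ge> 2 \<and> i + 2 \<le> n} = (if n < 4 then {} else {2..n-2})" by auto
    finally show ?thesis by auto
  qed
  have V0: "V = 0"
  proof (rule fps_ext)
    fix n
    have c: "fps_nth (numeral k * f) i = numeral k * fps_nth f i" for k i and f :: "'a fps"
      by (simp add: numeral_fps_const)
    have V: "V = 2 * euler_op (euler_op \<phi>) - 5 * euler_op \<phi> - 3 * \<psi> - 3 * (\<psi> * \<psi>) - A * fps_X ^ 2"
      unfolding V_def \<phi>_def by (simp add: algebra_simps)
    have e: "fps_nth V n = 2 * of_nat n * of_nat n * fps_nth \<psi> n - 5 * of_nat n * fps_nth \<psi> n - 3 * fps_nth \<psi> n 
        - 3 * fps_nth (\<psi> * \<psi>) n + (if n = 2 then 5 * h 2 else 0)"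
      unfolding V fps_sub_nth c euler_op_nth A_def by (auto simp: \<phi>_def \<psi>_def algebra_simps)
    consider "n < 2" | "n = 2" | "n = 3" | "n \<ge> 4" by linarith
    then show "fps_nth V n = fps_nth 0 n"
    proof cases
      case 4
      have "fps_nth V n = of_int ((2 * int n + 1) * (int n - 3)) * h n - 3 * (\<Sum>i=2..n-2. h i * h (n - i))"
        using 4 by (subst e, subst sq) (auto simp: \<psi>_def algebra_simps)
      then show ?thesis using rec 4 unfolding wp_rec_def by simp
    next
      case 1 then show ?thesis by (subst e, subst sq) (simp add: \<psi>_def)
    next
      case 2 then show ?thesis by (subst e, subst sq) (simp add: \<psi>_def)
    next
      case 3
      have "fps_nth V n = 2 * 3 * 3 * h 3 - 5 * 3 * h 3 - 3 * h 3" by (subst e, subst sq) (simp add: \<psi>_def 3)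
      then show ?thesis by (simp add: algebra_simps)
    qed
  qed
  define W where "W = T * T - \<phi> * \<phi> * \<phi> - A * fps_X ^ 2 * \<phi> - B * fps_X ^ 3"
  have eA: "euler_op A = 0" "euler_op B = 0" "euler_op (numeral k) = 0" for k
    by (simp_all add: A_def B_def euler_op_simps numeral_fps_const)
  define p where "p = euler_op \<phi>"
  define q where "q = euler_op p"
  define X where "X = (fps_X :: 'a fps) ^ 2"
  have eX: "euler_op X = 2 * X" "euler_op ((fps_X :: 'a fps) ^ 3) = 3 * fps_X ^ 3"
    by (auto simp: X_def euler_op_simps power2_eq_square power3_eq_cube algebra_simps)
  have "euler_op W = 2 * (q - p) * (p - \<phi>) - 3 * \<phi> * \<phi> * p - A * (2 * X * \<phi> + X * p) - B * (3 * fps_X ^ 3)"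
    unfolding W_def X_def[symmetric] T_def mult.assoc
    by (simp add: euler_op_simps eA eX p_def[symmetric] q_def[symmetric] algebra_simps)
  then have "euler_op W - 3 * W = T * V"
    unfolding W_def V_def T_def p_def[symmetric] q_def[symmetric] X_def[symmetric]
    by (simp add: algebra_simps)
  then have "fps_nth (euler_op W - 3 * W) m = 0" by (simp add: V0)
  then have "of_nat m * fps_nth W m - 3 * fps_nth W m = 0" by (simp add: numeral_fps_const)
  then have "(of_nat m - of_nat 3) * fps_nth W m = 0" by (simp add: algebra_simps)
  then have W: "fps_nth W m = 0" using m by (simp only: mult_eq_0_iff right_minus_eq of_nat_eq_iff) linarith
  \<comment> \<open>The constant terms of \<open>T\<close> and \<open>\<phi>\<close> cancel, and the
    terms linear in \<open>h m\<close> add up to \<open>2 (m - 1) + 3 = 2 m + 1\<close>; all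
    products involve lower indices only.\<close>
  have "W = (\<eta> * \<eta> - 3 * (\<psi> * \<psi>) - \<psi> * (\<psi> * \<psi>)) - 2 * \<eta> - 3 * \<psi> - A * fps_X ^ 2 - A * \<psi> * fps_X ^ 2 - B * fps_X ^ 3"
    unfolding W_def T \<phi>_def by (simp add: algebra_simps)
  then have "0 = fps_nth (\<eta> * \<eta> - 3 * (\<psi> * \<psi>) - \<psi> * (\<psi> * \<psi>)) m - 2 * fps_nth \<eta> m - 3 * fps_nth \<psi> m + 5 * h 2 * fps_nth \<psi> (m - 2)"
    using W m by (simp add: A_def B_def numeral_fps_const mult.assoc fps_X_power_mult_right_nth)
  then show ?thesis using m by (simp add: \<eta>_def \<psi>_def algebra_simps)
qed

section \<open>Integrality at 2 of the universal coefficient polynomials\<close>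

definition int2_poly :: "rat poly \<Rightarrow> bool" where "int2_poly P \<longleftrightarrow> (\<forall>i. coeff P i \<in> loc2)"
definition even2_poly :: "rat poly \<Rightarrow> bool" where "even2_poly P \<longleftrightarrow> (\<forall>i. even2 (coeff P i))"

lemma int2_poly_add: "int2_poly P \<Longrightarrow> int2_poly Q \<Longrightarrow> int2_poly (P + Q)"
  by (auto simp: int2_poly_def)

lemma int2_poly_diff: "int2_poly P \<Longrightarrow> int2_poly Q \<Longrightarrow> int2_poly (P - Q)"
  by (auto simp: int2_poly_def)

lemma int2_poly_mult: "int2_poly P \<Longrightarrow> int2_poly Q \<Longrightarrow> int2_poly (P * Q)"
  by (auto simp: int2_poly_def coeff_mult)

lemma int2_poly_smult: "c \<in> loc2 \<Longrightarrow> int2_poly Q \<Longrightarrow> int2_poly (smult c Q)"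
  by (auto simp: int2_poly_def)

lemma int2_poly_const: "c \<in> loc2 \<Longrightarrow> int2_poly [:c:]"
  by (auto simp: int2_poly_def coeff_pCons split: nat.splits)

lemma int2_poly_0 [simp]: "int2_poly 0" by (auto simp: int2_poly_def)
lemma int2_poly_1 [simp]: "int2_poly 1" using int2_poly_const[of 1] by (simp add: pCons_one)

lemma int2_poly_of_int: "int2_poly (of_int n)" 
  using int2_poly_const[of "of_int n"] by (simp add: of_int_poly)

lemma int2_poly_numeral: "int2_poly (numeral n)" 
  using int2_poly_of_int[of "numeral n"] by simp

lemma int2_poly_power: "int2_poly P \<Longrightarrow> int2_poly (P ^ n)"
  by (induction n) (auto intro: int2_poly_mult)

lemma int2_poly_sum: "(\<And>i. i \<in> S \<Longrightarrow> int2_poly (f i)) \<Longrightarrow> int2_poly (sum f S)"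
  by (induction S rule: infinite_finite_induct) (auto intro: int2_poly_add)

lemma even2_poly_add: "even2_poly P \<Longrightarrow> even2_poly Q \<Longrightarrow> even2_poly (P + Q)"
  by (auto simp: even2_poly_def intro: even2_add)

lemma even2_poly_mult: "int2_poly P \<Longrightarrow> even2_poly Q \<Longrightarrow> even2_poly (P * Q)"
  by (auto simp: even2_poly_def int2_poly_def coeff_mult intro!: even2_sum even2_mult)

lemma even2_poly_twice: "int2_poly P \<Longrightarrow> even2_poly (2 * P)"
  by (auto simp: even2_poly_def int2_poly_def numeral_poly intro!: even2_twice)

text \<open>
  The weighted homogeneous polynomial \<open>H\<^sub>m(E\<^sub>4, F)\<close>, dehomogenised by \<open>E\<^sub>4 = 1\<close>: a monomial \<open>E\<^sub>4\<^sup>i F\<^sup>j\<close> of \<open>H\<^sub>m\<close> has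
  \<open>m = 2 i + 3 j\<close>, so nothing is lost.
\<close>
function wp_poly :: "nat \<Rightarrow> rat poly" where
  "wp_poly m = (if m < 2 then 0 else if m = 2 then [:1/15:] else if m = 3 then [:0, -1/189:]
     else smult (3 / of_int ((2 * int m + 1) * (int m - 3))) (\<Sum>i=2..m-2. wp_poly i * wp_poly (m - i)))"
  by auto
termination by (relation "Wellfounded.measure id") auto

declare wp_poly.simps [simp del]

text \<open>The initial values 1/15 and -1/189 are dictated by the Eisenstein series of weight 4 and
  6, see \<open>wp_norm_2\<close> and \<open>wp_norm_3\<close> with
  \<open>F = 2 E_6\<close>.\<close>

lemma wp_poly_2: "wp_poly 2 = [:1/15:]" and wp_poly_3: "wp_poly 3 = [:0, -1/189:]"
  by (subst wp_poly.simps, simp)+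

lemma wp_poly_rec:
  "m \<ge> 4 \<Longrightarrow> wp_poly m = smult (3 / of_int ((2 * int m + 1) * (int m - 3))) (\<Sum>i=2..m-2. wp_poly i * wp_poly (m - i))"
  by (subst wp_poly.simps) simp

lemma wp_rec_wp_poly: "wp_rec wp_poly"
  unfolding wp_rec_def
proof (intro allI impI)
  fix m :: nat assume m: "m \<ge> 4"
  define k where "k = (2 * int m + 1) * (int m - 3)"
  have "k \<noteq> 0" using m by (simp add: k_def)
  then show "of_int k * wp_poly m = 3 * (\<Sum>i=2..m-2. wp_poly i * wp_poly (m - i))"
    by (subst wp_poly_rec[OF m]) (simp add: of_int_poly k_def[symmetric] numeral_poly)
qed

text \<open>Weights add under the recurrence. The number \<open>i\<close> is the exponent of
  \<open>E_4\<close> that was lost by setting \<open>E_4 = 1\<close>.\<close>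

lemma wp_poly_support: "coeff (wp_poly m) j \<noteq> 0 \<Longrightarrow> \<exists>i. m = 2 * i + 3 * j"
proof (induction m arbitrary: j rule: less_induct)
  case (less m)
  consider "m < 2" | "m = 2" | "m = 3" | "m \<ge> 4" by linarith
  then show ?case
  proof cases
    case 1 then show ?thesis using less.prems by (simp add: wp_poly.simps)
  next
    case 2 then show ?thesis using less.prems by (cases j) (auto simp: wp_poly_2)
  next
    case 3 then show ?thesis using less.prems by (cases j) (auto simp: wp_poly_3 coeff_pCons split: nat.splits)
  next
    case 4
    have "(\<Sum>i=2..m-2. \<Sum>k\<le>j. coeff (wp_poly i) k * coeff (wp_poly (m - i)) (j - k)) \<noteq> 0"
      using less.prems by (subst (asm) wp_poly_rec[OF 4]) (auto simp: coeff_sum coeff_mult)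
    then obtain i where i: "i \<in> {2..m-2}" "(\<Sum>k\<le>j. coeff (wp_poly i) k * coeff (wp_poly (m - i)) (j - k)) \<noteq> 0"
      by (rule sum.not_neutral_contains_not_neutral)
    then obtain k where k: "k \<le> j" "coeff (wp_poly i) k * coeff (wp_poly (m - i)) (j - k) \<noteq> 0"
      using sum.not_neutral_contains_not_neutral[OF i(2)] by auto
    obtain a b where "i = 2 * a + 3 * k" "m - i = 2 * b + 3 * (j - k)"
      using less.IH[of i k] less.IH[of "m - i" "j - k"] k i 4 by force
    then have "m = 2 * (a + b) + 3 * j" using i k by auto
    then show ?thesis by blast
  qed
qed

text \<open>Vanishing constant terms keep the index \<open>m\<close> itself out of the convolution;
  this is what lets the strong induction in \<open>int2_wp_poly\<close> go through.\<close>

lemma int2_fps_mult_nth: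
  assumes "fps_nth f 0 = 0" "fps_nth g 0 = 0" "\<And>i. i < m \<Longrightarrow> int2_poly (fps_nth f i)" "\<And>i. i < m \<Longrightarrow> int2_poly (fps_nth g i)"
  shows "int2_poly (fps_nth (f * g) m)"
  unfolding fps_mult_nth
proof (rule int2_poly_sum)
  fix i assume i: "i \<in> {0..m}"
  show "int2_poly (fps_nth f i * fps_nth g (m - i))"
  proof (cases "i = 0 \<or> i = m")
    case True then show ?thesis using assms(1,2) by auto
  next
    case False then show ?thesis using i by (intro int2_poly_mult assms) auto
  qed
qed

text \<open>The defining recurrence divides by \<open>m - 3\<close>, which may be even, so it says
  nothing about integrality at 2. In the formula of \<open>wp_rec_first_order\<close> the only
  divisor is \<open>2 m + 1\<close>, which is odd.\<close>

lemma int2_wp_poly: "int2_poly (wp_poly m)"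
proof (induction m rule: less_induct)
  case (less m)
  consider "m < 2" | "m = 2" | "m = 3" | "m \<ge> 4" by linarith
  then show ?case
  proof cases
    case 1 then show ?thesis by (simp add: wp_poly.simps)
  next
    case 2 then show ?thesis by (auto simp: wp_poly_2 intro!: int2_poly_const loc2I[of 15 _ 1])
  next
    case 3 
    have "-1/189 \<in> loc2" by (rule loc2I[of 189 _ "-1"]) auto
    then show ?thesis using 3 by (auto simp: wp_poly_3 int2_poly_def coeff_pCons split: nat.splits)
  next
    case 4
    define \<psi> where "\<psi> = Abs_fps (\<lambda>n. if n < 2 then 0 else wp_poly n)"
    define \<eta> where "\<eta> = Abs_fps (\<lambda>n. if n < 2 then 0 else of_int (int n - 1) * wp_poly n)"
    have z: "fps_nth \<psi> 0 = 0" "fps_nth \<eta> 0 = 0" "fps_nth (\<psi> * \<psi>) 0 = 0" by (auto simp: \<psi>_def \<eta>_def)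
    have p: "int2_poly (fps_nth \<psi> i)" if "i < m" for i
      using less.IH that by (auto simp: \<psi>_def)
    have e: "int2_poly (fps_nth \<eta> i)" if "i < m" for i
      using less.IH[OF that] int2_poly_mult[OF int2_poly_of_int[of "int i - 1"]] unfolding \<eta>_def
      by (simp_all del: of_int_diff)
    have pp: "int2_poly (fps_nth (\<psi> * \<psi>) i)" if "i \<le> m" for i
      using that p z by (intro int2_fps_mult_nth) auto
    have "int2_poly (fps_nth (\<eta> * \<eta> - 3 * (\<psi> * \<psi>) - \<psi> * (\<psi> * \<psi>)) m + 5 * wp_poly 2 * fps_nth \<psi> (m - 2))"
      unfolding fps_sub_nth numeral_fps_const fps_mult_left_const_nth
      using 4 p e pp z less.IH[of 2]
      by (intro int2_poly_add int2_poly_diff int2_poly_mult int2_poly_numeral int2_fps_mult_nth) auto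
    then have i: "int2_poly (of_nat (2 * m + 1) * wp_poly m)"
      using wp_rec_first_order[OF wp_rec_wp_poly 4] unfolding \<psi>_def \<eta>_def by simp
    have "of_int (2 * int m + 1) * coeff (wp_poly m) j \<in> loc2" for j
    proof -
      have "of_nat (2 * m + 1) * wp_poly m = smult (of_int (2 * int m + 1)) (wp_poly m)"
        by (simp add: of_nat_poly add.commute)
      then show ?thesis using i unfolding int2_poly_def by (metis coeff_smult)
    qed
    moreover have "odd (2 * int m + 1)" by simp
    ultimately show ?thesis unfolding int2_poly_def using loc2_odd_mult_cancel by blast
  qed
qed

section \<open>The universal polynomials modulo 2 and modulo 4\<close>

lemma not_even2_1: "\<not> even2 1" using even2_of_int_iff[of 1] by simp

lemma not_even2_odd: "odd n \<Longrightarrow> \<not> even2 (of_int n)" by (simp add: even2_of_int_iff)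

lemma even2_cancel_odd:
  assumes "even2 (of_int b * x)" "odd b" shows "even2 x"
  unfolding even2_def using assms loc2_odd_mult_cancel[of b "x/2"] by (simp add: even2_def)

text \<open>At an even index \<open>2 m\<close> the factor \<open>(4 m + 1) (2 m - 3)\<close> is
  odd, and the off-diagonal terms of the convolution pair up, so modulo 2 only the middle square
  survives.\<close>

lemma wp_poly_double_cong:
  assumes "m \<ge> 2"
  shows "even2_poly (wp_poly (2 * m) - wp_poly m ^ 2)"
proof -
  define S where "S = (\<Sum>i=2..<m. wp_poly i * wp_poly (2*m-i))"
  define k where "k = (4 * int m + 1) * (2 * int m - 3)"
  have k: "odd k" by (simp add: k_def)
  have S: "int2_poly S" unfolding S_def by (intro int2_poly_sum int2_poly_mult int2_wp_poly)
  have "of_int k * wp_poly (2*m) = 3 * (wp_poly m ^ 2 + 2 * S)"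
    using wp_rec_wp_poly assms sum_symmetric_even[of 2 m wp_poly]
    unfolding wp_rec_def S_def k_def by (auto dest!: spec[of _ "2*m"] simp: algebra_simps)
  then have e: "of_int k * (wp_poly (2*m) - wp_poly m ^ 2) = 2 * (3 * S) - of_int (k - 3) * wp_poly m ^ 2"
    by (simp add: algebra_simps)
  have "even (k - 3)" using k by simp
  then obtain c where c: "k - 3 = 2 * c" by blast
  have "of_int k * (wp_poly (2*m) - wp_poly m ^ 2) = 2 * (3 * S - of_int c * wp_poly m ^ 2)"
    unfolding e c by (simp add: algebra_simps)
  also have "even2_poly \<dots>"
    by (intro even2_poly_twice int2_poly_diff int2_poly_mult int2_poly_power int2_poly_numeral int2_poly_of_int S int2_wp_poly)
  finally have *: "even2_poly (of_int k * (wp_poly (2*m) - wp_poly m ^ 2))" .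
  have "even2 (of_int k * coeff (wp_poly (2*m) - wp_poly m ^ 2) j)" for j
    using * unfolding even2_poly_def by (simp add: of_int_poly)
  then show ?thesis unfolding even2_poly_def using even2_cancel_odd[OF _ k] by blast
qed

lemma wp_poly_cong: "even2_poly (wp_poly (3 * 2 ^ j) - monom 1 (2 ^ j))"
proof (induction j)
  case 0
  \<comment> \<open>This is \<open>-1/189 - 1\<close>, the difference of the coefficients of
    \<open>F\<close>.\<close>
  have "even2 (-190/189)" unfolding even2_def by (rule loc2I[of 189 _ "-95"]) auto
  then show ?case
    by (auto simp: even2_poly_def wp_poly_3 coeff_pCons split: nat.splits)
next
  case (Suc j)
  define M where "M = (monom 1 (2^j) :: rat poly)"
  define H where "H = wp_poly (3 * 2^j)"
  have "wp_poly (3 * 2 ^ Suc j) - monom 1 (2 ^ Suc j) = (wp_poly (2 * (3 * 2^j)) - H ^ 2) + (H + M) * (H - M)"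
    by (simp add: H_def[symmetric] M_def algebra_simps power2_eq_square mult_monom mult_2)
  moreover have "even2_poly \<dots>"
  proof (intro even2_poly_add even2_poly_mult)
    show "even2_poly (wp_poly (2 * (3 * 2^j)) - H ^ 2)" unfolding H_def 
      using one_le_power[of "2::nat" j] by (intro wp_poly_double_cong) linarith
    show "int2_poly (H + M)" unfolding H_def M_def
      by (intro int2_poly_add int2_wp_poly) (auto simp: int2_poly_def)
  qed (use Suc in \<open>simp add: H_def M_def\<close>)
  ultimately show ?case by (simp only:)
qed

text \<open>The coefficient of \<open>E\<^sub>4\<^sup>n\<close> in \<open>H\<^sub>2\<^sub>n\<close>; modulo 2 only the powers of two survive.\<close>
definition wp0 :: "nat \<Rightarrow> rat" where "wp0 n = coeff (wp_poly (2 * n)) 0"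

lemma wp0_loc2: "wp0 n \<in> loc2" using int2_wp_poly unfolding wp0_def int2_poly_def by blast

lemma wp0_1: "wp0 1 = 1/15" by (simp add: wp0_def wp_poly_2)

text \<open>Setting \<open>F = 0\<close> kills the odd indices, because an odd weight
  \<open>m\<close> needs an odd power of \<open>F\<close>. What remains is again a convolution
  recurrence, now with an odd factor for every \<open>n\<close>.\<close>

lemma wp0_rec:
  assumes "n \<ge> 2"
  shows "of_int ((4 * int n + 1) * (2 * int n - 3)) * wp0 n = 3 * (\<Sum>i=1..n-1. wp0 i * wp0 (n - i))"
proof -
  have odd0: "coeff (wp_poly i) 0 = 0" if "odd i" for i
    using wp_poly_support[of i 0] that by fastforce
  have "coeff (of_int ((2 * int (2 * n) + 1) * (int (2 * n) - 3)) * wp_poly (2*n)) 0 = coeff (3 * (\<Sum>i=2..2*n-2. wp_poly i * wp_poly (2*n - i))) 0"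
    using wp_rec_wp_poly assms unfolding wp_rec_def by (auto dest!: spec[of _ "2*n"])
  then have "of_int ((4 * int n + 1) * (2 * int n - 3)) * wp0 n = 3 * (\<Sum>i=2..2*n-2. coeff (wp_poly i) 0 * coeff (wp_poly (2*n - i)) 0)"
    by (simp add: of_int_poly numeral_poly coeff_sum coeff_mult wp0_def)
  also have "(\<Sum>i=2..2*n-2. coeff (wp_poly i) 0 * coeff (wp_poly (2*n - i)) 0) = (\<Sum>i\<in>(\<lambda>i. 2*i) ` {1..n-1}. coeff (wp_poly i) 0 * coeff (wp_poly (2*n - i)) 0)"
  proof (rule sum.mono_neutral_right)
    show "\<forall>i\<in>{2..2 * n - 2} - (\<lambda>i. 2*i) ` {1..n-1}. coeff (wp_poly i) 0 * coeff (wp_poly (2*n - i)) 0 = 0"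
    proof
      fix i assume i: "i \<in> {2..2 * n - 2} - (\<lambda>i. 2*i) ` {1..n-1}"
      have "odd i"
      proof
        assume "even i" then obtain c where "i = 2 * c" by blast
        then show False using i assms by auto
      qed
      then show "coeff (wp_poly i) 0 * coeff (wp_poly (2*n - i)) 0 = 0" by (simp add: odd0)
    qed
  qed (use assms in auto)
  also have "\<dots> = (\<Sum>i=1..n-1. wp0 i * wp0 (n - i))"
    by (subst sum.reindex) (auto simp: wp0_def inj_on_def diff_mult_distrib2)
  finally show ?thesis .
qed

text \<open>By symmetry of the convolution, modulo 2 the value at \<open>2 m\<close> is the square
  of the value at \<open>m\<close> and the value at an odd index above 1 is zero, while
  \<open>wp0 1 = 1/15\<close> is odd.\<close>

lemma even2_wp0_iff: "n \<ge> 1 \<Longrightarrow> even2 (wp0 n) \<longleftrightarrow> (\<nexists>j. n = 2 ^ j)"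
proof (induction n rule: less_induct)
  case (less n)
  consider "n = 1" | m where "n = 2 * m" "m \<ge> 1" | m where "n = 2 * m + 1" "m \<ge> 1"
    using less.prems by (metis One_nat_def Suc_leI add.commute even_Suc evenE nat_neq_iff not_less_eq not_less_zero oddE plus_1_eq_Suc mult_is_0 neq0_conv not_one_le_zero)
  then show ?case
  proof cases
    case 1
    have "\<not> even2 (1/15)" using even2_frac_iff[of 15 1] by simp
    then have "\<not> even2 (wp0 n)" by (simp only: 1 wp0_1 not_False_eq_True)
    moreover have "n = 2 ^ 0" using 1 by simp
    ultimately show ?thesis by blast
  next
    case (2 m)
    define k where "k = (4 * int n + 1) * (2 * int n - 3)"
    have k: "odd k" by (simp add: k_def)
    define S where "S = (\<Sum>i=1..<m. wp0 i * wp0 (2*m-i))"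
    have S: "S \<in> loc2" unfolding S_def by (auto intro: wp0_loc2)
    have r: "of_int k * wp0 n = 3 * (wp0 m ^ 2) + 2 * (3 * S)"
      using wp0_rec[of n] sum_symmetric_even[of 1 m wp0] 2 unfolding k_def S_def by (simp add: algebra_simps)
    have "even2 (wp0 n) \<longleftrightarrow> even2 (of_int k * wp0 n)"
      using even2_cancel_odd[of k "wp0 n"] k even2_mult[of "of_int k" "wp0 n"] by auto
    also have "\<dots> \<longleftrightarrow> even2 (of_int 3 * wp0 m ^ 2)"
      unfolding r of_int_numeral by (rule odd2_add_even) (intro even2_twice loc2_mult loc2_numeral S)
    also have "\<dots> \<longleftrightarrow> even2 (wp0 m ^ 2)"
      using even2_cancel_odd[of 3 "wp0 m ^ 2"] even2_mult[of "of_int 3" "wp0 m ^ 2"] by (meson loc2_of_int odd_numeral)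
    also have "\<dots> \<longleftrightarrow> even2 (wp0 m)"
      using odd2_power[OF wp0_loc2] even2_mult[OF wp0_loc2] by (metis power2_eq_square)
    also have "\<dots> \<longleftrightarrow> (\<nexists>j. m = 2 ^ j)" using less.IH[of m] 2 by simp
    also have "\<dots> \<longleftrightarrow> (\<nexists>j. n = 2 ^ j)"
    proof -
      have "(\<exists>j. n = 2^j) \<longleftrightarrow> (\<exists>j. m = 2^j)"
      proof
        assume "\<exists>j. n = 2 ^ j" then obtain j where j: "n = 2 ^ j" by blast
        then have "j \<noteq> 0" using 2 by (intro notI) auto
        then obtain i where "j = Suc i" using not0_implies_Suc by blast
        then show "\<exists>j. m = 2^j" using j 2 by auto
      next
        assume "\<exists>j. m = 2 ^ j" then show "\<exists>j. n = 2^j" using 2 by (metis power_Suc)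
      qed
      then show ?thesis by simp
    qed
    finally show ?thesis .
  next
    case (3 m)
    define k where "k = (4 * int n + 1) * (2 * int n - 3)"
    have k: "odd k" by (simp add: k_def)
    define S where "S = (\<Sum>i=1..m. wp0 i * wp0 (2*m+1-i))"
    have S: "S \<in> loc2" unfolding S_def by (auto intro: wp0_loc2)
    have "of_int k * wp0 n = 2 * (3 * S)"
      using wp0_rec[of n] sum_symmetric_odd[of 1 m wp0] 3 unfolding k_def S_def by simp
    then have "even2 (wp0 n)" using even2_cancel_odd[OF _ k] S by (metis even2_twice loc2_mult loc2_numeral)
    moreover have "n \<noteq> 2 ^ j" for j using 3 by (cases j) (simp, simp, presburger)
    ultimately show ?thesis by blast
  qed
qed

text \<open>Write \<open>m = 3 * 2^i\<close>. As \<open>wp0 m\<close> is even, its square vanishes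
  modulo 4, so \<open>wp0 (2 m) / 2\<close> has the parity of the half convolution \<open>S\<close>.
  A summand of \<open>S\<close> is odd only if both of its indices are powers of 2, and
  \<open>6 * 2^i = 2^(i+1) + 2^(i+2)\<close> is the only such decomposition.\<close>

lemma wp0_three_power: "even2 (wp0 (3 * 2 ^ j)) \<and> \<not> even2 (wp0 (3 * 2 ^ j) / 2)"
proof (cases j)
  case 0
  have w1: "wp0 (Suc 0) = 1/15" using wp0_1 by simp
  have "wp0 2 = 1/675" using wp0_rec[of 2] by (simp add: w1)
  then have "wp0 3 = 2 / 131625"
    using wp0_rec[of 3] by (simp add: sum.atLeast_Suc_atMost w1 numeral_2_eq_2[symmetric])
  then have w: "wp0 (3 * 2 ^ j) = of_int 2 / of_int 131625" "wp0 (3 * 2 ^ j) / 2 = of_int 1 / of_int 131625"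
    using 0 by simp_all
  show ?thesis unfolding w using even2_frac_iff[of 131625 2] even2_frac_iff[of 131625 1] by auto
next
  case (Suc i)
  define m :: nat where "m = 3 * 2 ^ i"
  have m: "m \<ge> 1" "3 * 2 ^ j = 2 * m" by (auto simp: m_def Suc)
  define k where "k = (4 * int (2*m) + 1) * (2 * int (2*m) - 3)"
  have k: "odd k" by (simp add: k_def)
  define S where "S = (\<Sum>i=1..<m. wp0 i * wp0 (2*m-i))"
  have S: "S \<in> loc2" unfolding S_def by (auto intro: wp0_loc2)
  have r: "of_int k * wp0 (2*m) = 2 * (3 * S) + 3 * (wp0 m ^ 2)"
    using wp0_rec[of "2*m"] sum_symmetric_even[of 1 m wp0] m unfolding k_def S_def by (simp add: algebra_simps)
  have np: "3 * 2 ^ a \<noteq> (2::nat) ^ b" for a b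
  proof
    assume "3 * 2 ^ a = (2::nat) ^ b"
    then have "3 dvd (2::nat) ^ b" by (metis dvd_triv_left)
    moreover have "\<not> 3 dvd (2::nat) ^ b"
    proof (induction b)
      case (Suc b) then show ?case by (simp only: power_Suc) presburger
    qed simp
    ultimately show False by blast
  qed
  have em: "even2 (wp0 m)" using even2_wp0_iff[OF m(1)] np by (simp add: m_def)
  then obtain c where c: "c \<in> loc2" "wp0 m = 2 * c" by (metis even2_def mult.commute nonzero_eq_divide_eq zero_neq_numeral)
  have oddS: "\<not> even2 S"
  proof -
    define i0 :: nat where "i0 = 2 ^ Suc i"
    have i0: "i0 \<in> {1..<m}" "2 * m - i0 = 2 ^ (i+2)" by (auto simp: i0_def m_def)
    have "S = wp0 i0 * wp0 (2*m-i0) + (\<Sum>i\<in>{1..<m}-{i0}. wp0 i * wp0 (2*m-i))"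
      unfolding S_def by (rule sum.remove) (use i0 in auto)
    moreover have "even2 (\<Sum>i\<in>{1..<m}-{i0}. wp0 i * wp0 (2*m-i))"
    proof (rule even2_sum)
      fix x assume x: "x \<in> {1..<m}-{i0}"
      have "\<not> ((\<exists>a. x = 2^a) \<and> (\<exists>b. 2*m-x = 2^b))"
      proof
        assume "(\<exists>a. x = 2^a) \<and> (\<exists>b. 2*m-x = 2^b)"
        then obtain a b where ab: "x = 2 ^ a" "2 * m - x = 2 ^ b" by blast
        \<comment> \<open>Since \<open>x < m\<close>, the other summand \<open>2^b\<close> lies
          between \<open>3 * 2^i\<close> and \<open>6 * 2^i\<close>, where the only power of 2 is
          \<open>2^(i+2)\<close>.\<close>
        have "(2::nat) ^ b \<le> 2 * m" using ab(2) by (metis diff_le_self)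
        also have "2 * m < 2 ^ (i+3)" by (simp add: m_def power_add)
        finally have "(2::nat) ^ b < 2 ^ (i+3)" .
        moreover have "(2::nat) ^ (i+1) < 2 ^ b" using x ab by (auto simp: m_def)
        ultimately have "b < i + 3" "i + 1 < b" by (metis power_less_imp_less_exp one_less_numeral_iff semiring_norm(76))+
        then have "b = i + 2" by simp
        then have "x = i0" using ab x by (auto simp: m_def i0_def)
        then show False using x by simp
      qed
      then consider "even2 (wp0 x)" | "even2 (wp0 (2*m-x))"
        using even2_wp0_iff[of x] even2_wp0_iff[of "2*m-x"] x by fastforce
      then show "even2 (wp0 x * wp0 (2*m-x))"
        using even2_mult[OF wp0_loc2] by cases (metis mult.commute)+
    qed
    moreover have "\<not> even2 (wp0 i0)" "\<not> even2 (wp0 (2*m-i0))"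
      using even2_wp0_iff[of i0] even2_wp0_iff[of "2*m-i0"] i0 by (auto simp: i0_def intro: exI[of _ "Suc i"] exI[of _ "i+2"])
    then have "\<not> even2 (wp0 i0 * wp0 (2*m-i0))" by (intro odd2_mult wp0_loc2)
    ultimately show ?thesis using odd2_add_even by simp
  qed
  have e: "of_int k * (wp0 (2*m) / 2) = 3 * S + 2 * (3 * c^2)" using r unfolding c(2) by (simp add: power2_eq_square)
  have n: "\<not> even2 (3 * S + 2 * (3 * c^2))"
  proof -
    have "even2 (2 * (3 * c^2))" by (intro even2_twice loc2_mult loc2_power loc2_numeral c(1))
    moreover have "\<not> even2 (3 * S)" using even2_cancel_odd[of 3 S] oddS by auto
    ultimately show ?thesis using odd2_add_even by blast
  qed
  have "\<not> even2 (wp0 (2*m) / 2)"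
  proof
    assume "even2 (wp0 (2*m) / 2)"
    then have "even2 (of_int k * (wp0 (2*m) / 2))" by (rule even2_mult[OF loc2_of_int])
    then show False using n unfolding e by blast
  qed
  moreover have "even2 (wp0 (2*m))" using even2_wp0_iff[of "3 * 2 ^ j"] np unfolding m(2)[symmetric] by auto
  ultimately show ?thesis by (simp add: m(2))
qed

section \<open>Irreducibility\<close>

lemma common_denominator:
  assumes "finite (S :: rat set)" shows "\<exists>d. d \<noteq> 0 \<and> (\<forall>x\<in>S. of_int d * x \<in> \<int>)"
  using assms
proof (induction S rule: finite_induct)
  case empty then show ?case by (auto intro: exI[of _ 1])
next
  case (insert x S)
  then obtain d where d: "d \<noteq> 0" "\<forall>x\<in>S. of_int d * x \<in> \<int>" by blast
  obtain a b where ab: "b \<noteq> 0" "x = of_int a / of_int b"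
    by (metis Fract_of_int_quotient Rat_cases less_irrefl)
  have "of_int (b * d) * y \<in> \<int>" if "y \<in> insert x S" for y
  proof (cases "y = x")
    case True
    then have "of_int (b * d) * y = of_int (a * d)" using ab by simp
    then show ?thesis by (metis Ints_of_int)
  next
    case False
    then have "of_int d * y \<in> \<int>" using d that by auto
    then have "of_int b * (of_int d * y) \<in> \<int>" by (rule Ints_mult[OF Ints_of_int])
    then show ?thesis by (simp only: of_int_mult mult.assoc)
  qed
  moreover have "b * d \<noteq> 0" using ab d by simp
  ultimately show ?case by blast
qed

text \<open>Clearing denominators and dividing by the content leaves a primitive integer polynomial,
  whose coefficients are not all even. This plays the part of Gauss's lemma at the prime 2.\<close>

lemma loc2_normalize:
  assumes "f \<noteq> (0 :: rat poly)"
  obtains c where "c \<noteq> 0" "int2_poly (smult c f)" "\<not> even2_poly (smult c f)"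
proof -
  have "finite (set (coeffs f))" by simp
  then obtain d where d: "d \<noteq> 0" "\<forall>x\<in>set (coeffs f). of_int d * x \<in> \<int>"
    using common_denominator by blast
  have dc: "of_int d * coeff f i \<in> \<int>" for i
  proof (cases "coeff f i = 0")
    case False then show ?thesis using d(2) coeff_in_coeffs[OF assms le_degree] by blast
  qed simp
  define g where "g = map_poly (\<lambda>x. \<lfloor>of_int d * x\<rfloor>) f"
  have g: "of_int (coeff g i) = of_int d * coeff f i" for i
    using dc[of i] by (auto simp: g_def coeff_map_poly elim!: Ints_cases)
  have g0: "g \<noteq> 0"
  proof
    assume "g = 0"
    then have "coeff f i = 0" for i using g[of i] d(1) by simp
    then show False using assms by (simp add: poly_eq_iff)
  qed
  then have cg: "content g \<noteq> 0" by simp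
  define h where "h = primitive_part g"
  have gh: "coeff g i = content g * coeff h i" for i
    unfolding h_def by (metis coeff_smult content_times_primitive_part)
  have h: "coeff (smult (of_int d / of_int (content g)) f) i = of_int (coeff h i)" for i
    using g[of i] cg by (simp add: gh field_simps)
  have "content h = 1" unfolding h_def using g0 by simp
  then have "\<not> (\<forall>i. even (coeff h i))"
    using const_poly_dvd_iff_dvd_content[of 2 h] by (auto simp: const_poly_dvd_iff)
  then have "\<not> even2_poly (smult (of_int d / of_int (content g)) f)"
    unfolding even2_poly_def h even2_of_int_iff .
  moreover have "int2_poly (smult (of_int d / of_int (content g)) f)"
    unfolding int2_poly_def h by simp
  ultimately show ?thesis using d(1) cg by (intro that) auto
qed

text \<open>The index found is the degree of the reduction of \<open>f\<close> modulo 2.\<close>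

lemma top_odd_coeff:
  assumes "\<not> even2_poly f"
  obtains i where "\<not> even2 (coeff f i)" "\<And>j. j > i \<Longrightarrow> even2 (coeff f j)"
proof -
  have fin: "finite {i. \<not> even2 (coeff f i)}"
    by (rule finite_subset[of _ "{..degree f}"]) (auto intro: le_degree)
  have "{i. \<not> even2 (coeff f i)} \<noteq> {}" using assms by (auto simp: even2_poly_def)
  from that[of "Max {i. \<not> even2 (coeff f i)}"] Max_in[OF fin this] Max_ge[OF fin] show ?thesis
    by (metis (mono_tags) mem_Collect_eq not_less)
qed

text \<open>Degrees of the reductions add because polynomials over the field with two elements form
  a domain.\<close>

lemma odd_coeff_mult:
  assumes "int2_poly f" "int2_poly g" "\<not> even2 (coeff f i)" "\<And>j. j > i \<Longrightarrow> even2 (coeff f j)"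
     "\<not> even2 (coeff g k)" "\<And>j. j > k \<Longrightarrow> even2 (coeff g j)"
  shows "\<not> even2 (coeff (f * g) (i + k))"
proof -
  have "coeff (f * g) (i + k) = coeff f i * coeff g k + (\<Sum>j\<in>{..i+k}-{i}. coeff f j * coeff g (i + k - j))"
    unfolding coeff_mult by (subst sum.remove[of _ i]) auto
  moreover have "even2 (\<Sum>j\<in>{..i+k}-{i}. coeff f j * coeff g (i + k - j))"
  proof (rule even2_sum)
    fix j assume j: "j \<in> {..i+k}-{i}"
    then consider "j > i" | "i + k - j > k" by force
    then show "even2 (coeff f j * coeff g (i + k - j))"
    proof cases
      case 1 then show ?thesis using assms(2) assms(4)[of j] even2_mult[of "coeff g (i+k-j)" "coeff f j"]
        by (simp add: int2_poly_def mult.commute)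
    next
      case 2 then show ?thesis using assms(1) assms(6)[of "i+k-j"] even2_mult[of "coeff f j" "coeff g (i+k-j)"]
        by (simp add: int2_poly_def)
    qed
  qed
  moreover have "\<not> even2 (coeff f i * coeff g k)" using assms by (intro odd2_mult) (auto simp: int2_poly_def)
  ultimately show ?thesis using odd2_add_even by simp
qed

text \<open>Eisenstein's criterion at 2, with the roles of constant and leading coefficient
  exchanged. The reduction of \<open>Q\<close> is a nonzero constant, hence so are those of the
  normalised factors; two factors of positive degree would both have even leading coefficient, and
  their product would make that of \<open>Q\<close> divisible by 4.\<close>

lemma reversed_eisenstein:
  assumes "degree Q > 0" "int2_poly Q" "\<not> even2 (coeff Q 0)" "\<And>i. i > 0 \<Longrightarrow> even2 (coeff Q i)"
    "\<not> even2 (lead_coeff Q / 2)"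
  shows "irreducible Q"
proof (rule irreducibleI)
  show "Q \<noteq> 0" using assms(1) by auto
  then show "\<not> is_unit Q" using assms(1) is_unit_iff_degree[of Q] by simp
  fix f g assume fg: "Q = f * g"
  have nz: "f \<noteq> 0" "g \<noteq> 0" using fg \<open>Q \<noteq> 0\<close> by auto
  obtain c where c: "c \<noteq> 0" "int2_poly (smult c f)" "\<not> even2_poly (smult c f)" using loc2_normalize[OF nz(1)] .
  obtain d where d: "d \<noteq> 0" "int2_poly (smult d g)" "\<not> even2_poly (smult d g)" using loc2_normalize[OF nz(2)] .
  define F where "F = smult c f" define G where "G = smult d g"
  obtain i where i: "\<not> even2 (coeff F i)" "\<And>j. j > i \<Longrightarrow> even2 (coeff F j)"
    using top_odd_coeff[OF c(3)] unfolding F_def by blast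
  obtain k where k: "\<not> even2 (coeff G k)" "\<And>j. j > k \<Longrightarrow> even2 (coeff G j)"
    using top_odd_coeff[OF d(3)] unfolding G_def by blast
  have FG: "F * G = smult (c * d) Q" by (simp add: F_def G_def fg mult.commute)
  have odd: "\<not> even2 (c * d * coeff Q (i + k))"
    using odd_coeff_mult[OF c(2) d(2), folded F_def G_def, OF i k] FG by simp
  have int: "c * d * coeff Q j \<in> loc2" for j
    using int2_poly_mult[OF c(2) d(2), folded F_def G_def] unfolding FG int2_poly_def by simp
  \<comment> \<open>The constant coefficient is a unit at 2, so integrality of
    \<open>c * d * coeff Q 0\<close> passes to \<open>c * d\<close>.\<close>
  have "1 / coeff Q 0 \<in> loc2"
  proof -
    obtain a b where ab: "odd b" "b \<noteq> 0" "coeff Q 0 = of_int a / of_int b"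
      using assms(2) loc2E unfolding int2_poly_def by metis
    then have "odd a" using assms(3) even2_frac_iff by auto
    then show ?thesis using ab by (intro loc2I[of a _ b]) auto
  qed
  from loc2_mult[OF this int[of 0]] have cd: "c * d \<in> loc2" using assms(3) by (auto split: if_splits)
  have ik: "i = 0" "k = 0"
  proof -
    have "i + k = 0"
    proof (rule ccontr)
      assume "i + k \<noteq> 0"
      then show False using odd even2_mult[OF cd assms(4)[of "i+k"]] by simp
    qed
    then show "i = 0" "k = 0" by auto
  qed
  have cdo: "\<not> even2 (c * d)"
  proof
    assume "even2 (c * d)"
    then show False using odd even2_mult[of "coeff Q 0" "c * d"] assms(2) ik unfolding int2_poly_def
      by (simp add: mult.commute)
  qed
  show "f dvd 1 \<or> g dvd 1"
  proof (rule ccontr)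
    assume "\<not> (f dvd 1 \<or> g dvd 1)"
    then have "degree f > 0" "degree g > 0" using nz by (auto simp: is_unit_iff_degree)
    then have "degree F > 0" "degree G > 0" using c d by (auto simp: F_def G_def)
    then have "even2 (lead_coeff F)" "even2 (lead_coeff G)" using i k ik by auto
    then have "even2 (lead_coeff F / 2 * lead_coeff G)" by (intro even2_mult) (auto simp: even2_def)
    also have "lead_coeff F / 2 * lead_coeff G = c * d * (lead_coeff Q / 2)"
      using c(1) d(1) by (simp add: F_def G_def fg lead_coeff_mult mult_ac)
    finally show False using odd2_mult[of "c*d" "lead_coeff Q / 2"] cd cdo assms(1,4,5) 
      by (auto simp: even2_def)
  qed
qed

text \<open>
  Substituting \<open>F\<^sup>2 = 4 E\<^sub>4\<^sup>3 - 27 D\<close> and \<open>E\<^sub>4\<^sup>3 = y D\<close> into \<open>H\<^sub>6\<^sub>n\<close> gives \<open>D\<^sup>n\<close> times this polynomial in \<open>y\<close>.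
\<close>
definition wp_qpoly :: "nat \<Rightarrow> rat poly" where
  "wp_qpoly n = (\<Sum>j\<le>n. smult (coeff (wp_poly (6 * n)) (2 * j)) (monom 1 (n - j) * [:-27, 4:] ^ j))"

lemma coeff_linear_power_degree: "coeff ([:a, b:] ^ n :: rat poly) n = b ^ n"
proof (cases "b = 0")
  case True 
  then have "[:a, b:] ^ n = [:a ^ n:]" by (simp add: poly_const_pow)
  then show ?thesis using True by (cases n) auto
next
  case False
  have "degree ([:a, b:] ^ n) = n" using False by (simp add: degree_power_eq)
  then show ?thesis using lead_coeff_power[of "[:a, b:]" n] False by simp
qed

lemma degree_linear_power_le: "degree ([:a, b:] ^ n :: rat poly) \<le> n"
  using degree_power_le[of "[:a,b:]" n] by (simp split: if_splits)

lemma degree_wp_qpoly_le: "degree (wp_qpoly n) \<le> n"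
  unfolding wp_qpoly_def
proof (rule degree_sum_le)
  fix j assume j: "j \<in> {..n}"
  have "degree (monom 1 (n - j) * [:-27, 4:] ^ j :: rat poly) \<le> (n - j) + j"
    by (rule order.trans[OF degree_mult_le]) (intro add_mono degree_monom_le degree_linear_power_le)
  then show "degree (smult (coeff (wp_poly (6 * n)) (2 * j)) (monom 1 (n - j) * [:-27, 4:] ^ j)) \<le> n"
    using j degree_smult_le[of "coeff (wp_poly (6 * n)) (2 * j)" "monom 1 (n - j) * [:-27, 4:] ^ j"] by simp
qed simp

text \<open>This is the value of \<open>H_6n\<close> at \<open>E_4 = 1\<close>,
  \<open>F^2 = 4\<close>, that is \<open>D = 0\<close>: the cusp. It returns as such in
  \<open>wp_norm_0_qpoly\<close>.\<close>

lemma coeff_wp_qpoly_top: "coeff (wp_qpoly n) n = (\<Sum>j\<le>n. coeff (wp_poly (6 * n)) (2 * j) * 4 ^ j)"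
  unfolding wp_qpoly_def coeff_sum coeff_smult
proof (rule sum.cong)
  fix j assume "j \<in> {..n}"
  then show "coeff (wp_poly (6 * n)) (2 * j) * coeff (monom 1 (n - j) * [:- 27, 4:] ^ j) n = coeff (wp_poly (6 * n)) (2 * j) * 4 ^ j"
    by (simp add: coeff_monom_mult coeff_linear_power_degree)
qed simp

text \<open>By \<open>wp_poly_cong\<close> the coefficient \<open>r n\<close> is odd and every other
  \<open>r j\<close> is even, and \<open>[:-27, 4:]\<close> is an odd constant modulo 2, so
  \<open>Q\<close> reduces to a constant. In the coefficient of degree \<open>n\<close> the factors
  \<open>4^j\<close> leave only \<open>r 0\<close> modulo 4, and \<open>r 0\<close> is the number
  treated in \<open>wp0_three_power\<close>.\<close>

lemma wp_qpoly_eisenstein: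
  fixes l :: nat
  defines "n \<equiv> 2 ^ l" defines "Q \<equiv> wp_qpoly n"
  shows "int2_poly Q" "\<not> even2 (coeff Q 0)" "\<And>i. i > 0 \<Longrightarrow> even2 (coeff Q i)" "\<not> even2 (coeff Q n / 2)"
proof -
  define r where "r = (\<lambda>j. coeff (wp_poly (6 * n)) (2 * j))"
  have n6: "6 * n = 3 * 2 ^ (Suc l)" "6 * n = 2 * (3 * 2 ^ l)" by (simp_all add: n_def)
  have rl: "r j \<in> loc2" for j using int2_wp_poly unfolding r_def int2_poly_def by blast
  have re: "even2 (r j)" if "j \<noteq> n" for j
    using wp_poly_cong[of "Suc l"] that unfolding even2_poly_def r_def n6(1)
    by (auto dest!: spec[of _ "2*j"] simp: n_def)
  have rn: "\<not> even2 (r n)"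
  proof
    assume "even2 (r n)"
    moreover have "even2 (r n - 1)"
      using wp_poly_cong[of "Suc l"] unfolding even2_poly_def r_def n6(1)
      by (auto dest!: spec[of _ "2*n"] simp: n_def)
    ultimately have "even2 (r n - (r n - 1))" by (rule even2_diff)
    moreover have "r n - (r n - 1) = 1" by simp
    ultimately show False using not_even2_1 by (simp only:)
  qed
  have r0: "even2 (r 0)" "\<not> even2 (r 0 / 2)"
    using wp0_three_power[of l] unfolding r_def wp0_def n6(2) by auto
  have il: "int2_poly [:-27, 4:]"
    by (auto simp: int2_poly_def coeff_pCons loc2_minus split: nat.splits)
  have im: "int2_poly (monom 1 (n - j) * [:-27, 4:] ^ j)" for j
    by (intro int2_poly_mult int2_poly_power il) (auto simp: int2_poly_def)
  have Q: "Q = (\<Sum>j\<le>n. smult (r j) (monom 1 (n - j) * [:-27, 4:] ^ j))"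
    by (simp add: Q_def wp_qpoly_def r_def)
  show iQ: "int2_poly Q" unfolding Q by (intro int2_poly_sum int2_poly_smult rl im)
  define P where "P = (\<Sum>j<n. smult (r j) (monom 1 (n - j) * [:-27, 4:] ^ j))"
  have QP: "Q = P + smult (r n) ([:-27, 4:] ^ n)"
    unfolding Q P_def by (simp add: lessThan_Suc_atMost[symmetric])
  have eP: "even2 (coeff P i)" for i
    unfolding P_def coeff_sum coeff_smult
  proof (rule even2_sum)
    fix j assume "j \<in> {..<n}"
    then show "even2 (r j * coeff (monom 1 (n - j) * [:-27, 4:] ^ j) i)"
      using even2_mult[OF _ re[of j]] im[of j] unfolding int2_poly_def by (subst mult.commute) auto
  qed
  have pw: "even2_poly ([:-27, 4:] ^ m - [:(-27) ^ m:])" for m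
  proof (induction m)
    case 0 then show ?case by (simp add: even2_poly_def one_pCons)
  next
    case (Suc m)
    have e: "([:-27, 4:] ^ Suc m - [:(-27) ^ Suc m:] :: rat poly) = [:-27, 4:] * ([:-27, 4:] ^ m - [:(-27) ^ m:]) + 2 * [:0, 2 * (-27) ^ m:]"
      by (simp add: algebra_simps numeral_poly)
    show ?case unfolding e using Suc il
      by (intro even2_poly_add even2_poly_mult even2_poly_twice)
        (auto simp: int2_poly_def coeff_pCons split: nat.splits intro!: loc2_mult loc2_power loc2_minus)
  qed
  show "\<not> even2 (coeff Q 0)"
  proof -
    have "coeff Q 0 = coeff P 0 + r n * (-27) ^ n" by (simp add: QP coeff_0_power)
    moreover have "\<not> even2 (r n * (-27) ^ n)"
      using not_even2_odd[of "-27"] rn rl by (intro odd2_mult odd2_power loc2_power) (auto intro: loc2_minus)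
    ultimately show ?thesis using odd2_add_even[OF eP, of "r n * (-27) ^ n" 0] by (simp add: add.commute)
  qed
  show "even2 (coeff Q i)" if "i > 0" for i
  proof -
    have "even2 (coeff ([:-27, 4:] ^ n) i)"
    proof -
      have "even2 (coeff ([:-27, 4:] ^ n - [:(-27) ^ n:]) i)" using pw[of n] unfolding even2_poly_def ..
      then show ?thesis using that by (cases i) auto
    qed
    then show ?thesis unfolding QP using even2_add[OF eP even2_mult[OF rl]] by simp
  qed
  show "\<not> even2 (coeff Q n / 2)"
  proof -
    have "coeff Q n = (\<Sum>j\<le>n. r j * 4 ^ j)" unfolding Q_def coeff_wp_qpoly_top r_def ..
    also have "\<dots> = r 0 + (\<Sum>j\<in>{..n}-{0}. r j * 4 ^ j)" by (subst sum.remove[of _ 0]) auto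
    finally have "coeff Q n / 2 = (\<Sum>j\<in>{..n}-{0}. r j * 4 ^ j / 2) + r 0 / 2" by (simp add: add_divide_distrib sum_divide_distrib)
    moreover have "even2 (\<Sum>j\<in>{..n}-{0}. r j * 4 ^ j / 2)"
    proof (rule even2_sum)
      fix j assume "j \<in> {..n}-{0}"
      then obtain i where "j = Suc i" using not0_implies_Suc by auto
      then have "r j * 4 ^ j / 2 = 2 * (r j * 4 ^ i)" by simp
      then show "even2 (r j * 4 ^ j / 2)" by (metis even2_twice loc2_mult loc2_power loc2_numeral rl)
    qed
    ultimately show ?thesis using odd2_add_even r0 by (metis add.commute)
  qed
qed

lemma irreducible_wp_qpoly:
  "irreducible (wp_qpoly (2 ^ l))" and degree_wp_qpoly: "degree (wp_qpoly (2 ^ l)) = 2 ^ l"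
proof -
  have "coeff (wp_qpoly (2 ^ l)) (2 ^ l) \<noteq> 0" using wp_qpoly_eisenstein(4)[of l] by auto
  then show d: "degree (wp_qpoly (2 ^ l)) = 2 ^ l" using degree_wp_qpoly_le[of "2^l"] le_degree by (metis antisym)
  show "irreducible (wp_qpoly (2 ^ l))"
    using wp_qpoly_eisenstein(1,2,4)[of l] wp_qpoly_eisenstein(3)[of _ l]
    by (intro reversed_eisenstein) (simp_all add: d)
qed

lemma poly_wp_qpoly_0: "poly (wp_qpoly (2 ^ l)) 0 \<noteq> 0"
  using wp_qpoly_eisenstein(2)[of l] by (auto simp: poly_0_coeff_0)

text \<open>The point \<open>27/4 = 1728/256\<close> is where \<open>4 y - 27\<close>, that is
  \<open>F^2 / D\<close>, vanishes, so only the pure power of \<open>E_4\<close>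
  contributes.\<close>

lemma poly_wp_qpoly_27_4: "poly (wp_qpoly (2 ^ l)) (27/4) \<noteq> 0"
proof -
  define n :: nat where "n = 2 ^ l"
  have "poly (wp_qpoly n) (27/4) = (\<Sum>j\<le>n. coeff (wp_poly (6 * n)) (2 * j) * ((27/4) ^ (n - j) * 0 ^ j))"
    by (simp add: wp_qpoly_def poly_sum poly_monom)
  also have "\<dots> = coeff (wp_poly (6 * n)) 0 * (27/4) ^ n"
    by (subst sum.remove[of _ 0]) (auto intro!: sum.neutral)
  finally have e: "poly (wp_qpoly n) (27/4) = coeff (wp_poly (6 * n)) 0 * (27/4) ^ n" .
  have "coeff (wp_poly (6 * n)) 0 \<noteq> 0"
    using wp0_three_power[of l] unfolding wp0_def n_def by (auto simp: mult.assoc[symmetric])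
  then show ?thesis unfolding n_def[symmetric] e by simp
qed

section \<open>A doubly periodic function\<close>

text \<open>At the poles, i.e. at the integers, the value is 0.\<close>
definition csq :: "complex \<Rightarrow> complex" where "csq z = (of_real pi / sin (of_real pi * z))\<^sup>2"

lemma sin_pi_eq_0_iff: "sin (of_real pi * z :: complex) = 0 \<longleftrightarrow> z \<in> \<int>"
proof -
  have "sin (of_real pi * z :: complex) = 0 \<longleftrightarrow> (\<exists>n::int. of_real pi * z = of_real (of_int n * pi))"
    by (simp add: sin_eq_0)
  also have "\<dots> \<longleftrightarrow> (\<exists>n::int. z = of_int n)" by (auto simp: field_simps)
  finally show ?thesis by (auto simp: Ints_def)
qed

lemma csq_plus_of_int [simp]: "csq (z + of_int n) = csq z"
proof -
  have a: "sin (of_real pi * (z + 1)) ^ 2 = sin (of_real pi * z) ^ 2" for z :: complex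
    by (simp add: ring_distribs sin_add flip: sin_of_real cos_of_real)
  have b: "csq (z + 1) = csq z" for z by (simp add: csq_def power_divide a)
  show ?thesis
  proof (induction n rule: int_induct[where k=0])
    case base then show ?case by simp
  next
    case (step1 i) then show ?case using b[of "z + of_int i"] by (simp add: add.assoc)
  next
    case (step2 i) then show ?case using b[of "z + of_int (i - 1)"] by (simp add: add.assoc)
  qed
qed

lemma csq_minus [simp]: "csq (-z) = csq z"
  by (simp add: csq_def power_divide)

lemma csq_analytic: "z \<notin> \<int> \<Longrightarrow> csq analytic_on {z}"
  unfolding csq_def by (intro analytic_intros) (auto simp: sin_pi_eq_0_iff)

lemma csq_exp: 
  assumes "z \<notin> \<int>"
  shows "csq z = (2*pi*\<i>)^2 * exp (2*pi*\<i>*z) / (1 - exp (2*pi*\<i>*z))^2"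
proof -
  define u where "u = exp (\<i> * (of_real pi * z))"
  have u0: "u \<noteq> 0" by (simp add: u_def)
  have e: "exp (2*pi*\<i>*z) = u^2" by (simp add: u_def algebra_simps flip: exp_double)
  have s: "sin (of_real pi * z) = (u - 1/u) / (2*\<i>)"
    by (simp add: u_def sin_exp_eq exp_minus field_simps)
  then have "u^2 \<noteq> 1" using assms u0 sin_pi_eq_0_iff[of z] by (auto simp: field_simps power2_eq_square)
  then show ?thesis unfolding csq_def s e using u0
    by (simp add: field_simps) (simp add: power2_eq_square field_simps)
qed

text \<open>From \<open>Im z \<ge> 1\<close> the exponential has norm at most 1/2, which bounds the
  denominator in \<open>csq_exp\<close> away from 0. This decay makes the sum over all shifts by
  multiples of \<open>\<tau>\<close> absolutely convergent.\<close>

lemma norm_csq_le: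
  assumes "Im z \<ge> 1"
  shows "norm (csq z) \<le> 16 * pi^2 * exp (- 2 * pi * Im z)"
proof -
  have "z \<notin> \<int>" using assms by (auto simp: Ints_def)
  define u where "u = exp (2*pi*\<i>*z)"
  have nu: "norm u = exp (- 2 * pi * Im z)" by (simp add: u_def)
  have "exp (- 2 * pi * Im z) \<le> exp (-1)"
    using assms pi_gt3 mult_mono[of 3 pi 1 "Im z"] by (subst exp_le_cancel_iff) simp
  also have "\<dots> \<le> 1/2" using exp_ge_add_one_self[of 1] by (simp add: exp_minus field_simps)
  finally have "norm u \<le> 1/2" by (simp add: nu)
  then have "norm (1 - u) \<ge> 1/2" using norm_triangle_ineq2[of 1 u] by simp
  then have d: "norm (1 - u) ^ 2 \<ge> 1/4" using power_mono[of "1/2" "norm (1-u)" 2] by (simp add: power2_eq_square)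
  have "norm (csq z) = 4 * pi^2 * norm u / norm (1 - u) ^ 2"
    unfolding csq_exp[OF \<open>z \<notin> \<int>\<close>] u_def[symmetric]
    by (simp add: norm_mult norm_divide norm_power power_mult_distrib)
  also have "\<dots> \<le> 4 * pi^2 * norm u / (1/4)"
    using d by (intro divide_left_mono) auto
  finally show ?thesis by (simp add: nu)
qed

text \<open>Lipschitz's formula in weight 2, obtained by differentiating the geometric
  series.\<close>

lemma csq_series:
  assumes "Im z > 0"
  shows "(\<lambda>n. (2*pi*\<i>)^2 * of_nat (Suc n) * exp (2*pi*\<i>*z)^(Suc n)) sums csq z"
proof -
  have n: "norm (exp (2*pi*\<i>*z)) < 1" using assms by simp
  have "z \<notin> \<int>" using assms by (auto simp: Ints_def)
  note c = csq_exp[OF this]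
  from sums_mult[OF geometric_deriv_sums[OF n], of "(2*pi*\<i>)^2 * exp (2*pi*\<i>*z)"] show ?thesis
    by (simp add: c mult_ac)
qed

definition lat :: "complex \<Rightarrow> complex set" where
  "lat \<tau> = {of_int a + of_int b * \<tau> | a b. True}"

text \<open>For \<open>Im \<tau> > 0\<close> this is \<wp> up to an additive constant depending on
  \<open>\<tau>\<close>: in the lattice sum of \<open>1 / (z + w)^2\<close> the summation over the
  integers has been carried out in closed form.\<close>

definition wp_sum :: "complex \<Rightarrow> complex \<Rightarrow> complex" where
  "wp_sum \<tau> z = (\<Sum>\<^sub>\<infinity>m\<in>(UNIV::int set). csq (z + of_int m * \<tau>))"

lemma latI: "of_int a + of_int b * \<tau> \<in> lat \<tau>" unfolding lat_def by blast

lemma lat_0 [simp]: "0 \<in> lat \<tau>" and lat_1 [simp]: "1 \<in> lat \<tau>" and lat_self [simp]: "\<tau> \<in> lat \<tau>"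
  using latI[of 0 0 \<tau>] latI[of 1 0 \<tau>] latI[of 0 1 \<tau>] by simp_all

lemma lat_add: "x \<in> lat \<tau> \<Longrightarrow> y \<in> lat \<tau> \<Longrightarrow> x + y \<in> lat \<tau>"
  unfolding lat_def
proof clarify
  fix a b c d
  show "\<exists>a' b'. of_int a + of_int b * \<tau> + (of_int c + of_int d * \<tau>) = of_int a' + of_int b' * \<tau> \<and> True"
    by (rule exI[of _ "a+c"], rule exI[of _ "b+d"]) (simp add: algebra_simps)
qed

lemma lat_of_int_mult: "x \<in> lat \<tau> \<Longrightarrow> of_int n * x \<in> lat \<tau>"
  unfolding lat_def
proof clarify
  fix a b
  show "\<exists>a' b'. of_int n * (of_int a + of_int b * \<tau>) = of_int a' + of_int b' * \<tau> \<and> True"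
    by (rule exI[of _ "n*a"], rule exI[of _ "n*b"]) (simp add: algebra_simps)
qed

lemma lat_minus: "x \<in> lat \<tau> \<Longrightarrow> -x \<in> lat \<tau>"
  using lat_of_int_mult[of x \<tau> "-1"] by simp

lemma lat_diff: "x \<in> lat \<tau> \<Longrightarrow> y \<in> lat \<tau> \<Longrightarrow> x - y \<in> lat \<tau>"
  using lat_add[of x \<tau> "-y"] lat_minus[of y] by simp

lemma in_lat_iff: "z \<in> lat \<tau> \<longleftrightarrow> (\<exists>m. z + of_int m * \<tau> \<in> \<int>)"
proof
  assume "z \<in> lat \<tau>"
  then obtain a b where "z = of_int a + of_int b * \<tau>" unfolding lat_def by blast
  then have "z + of_int (-b) * \<tau> \<in> \<int>" by simp
  then show "\<exists>m. z + of_int m * \<tau> \<in> \<int>" by blast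
next
  assume "\<exists>m. z + of_int m * \<tau> \<in> \<int>"
  then obtain m n where "z + of_int m * \<tau> = of_int n" by (auto simp: Ints_def)
  then have "z = of_int n + of_int (-m) * \<tau>" by (simp add: algebra_simps)
  then show "z \<in> lat \<tau>" unfolding lat_def by blast
qed

lemma lat_small:
  assumes "Im \<tau> > 0" "z \<in> lat \<tau>" "norm z < min 1 (Im \<tau>)" shows "z = 0"
proof -
  obtain a b where z: "z = of_int a + of_int b * \<tau>" using assms(2) unfolding lat_def by blast
  have "\<bar>Im z\<bar> < Im \<tau>" using assms(3) abs_Im_le_cmod[of z] by linarith
  then have "\<bar>real_of_int b\<bar> * Im \<tau> < 1 * Im \<tau>" using assms(1) by (simp add: z abs_mult)
  then have "b = 0" using assms(1) by (simp only: mult_less_cancel_right) auto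
  then have "norm (of_int a :: complex) < 1" using assms(3) z by simp
  then have "a = 0" by simp
  then show ?thesis using z \<open>b = 0\<close> by simp
qed

lemma closed_lat: "Im \<tau> > 0 \<Longrightarrow> closed (lat \<tau>)"
  by (rule discrete_imp_closed[of "min 1 (Im \<tau>)"])
    (use lat_small lat_diff in \<open>force simp: dist_norm\<close>)+

lemma countable_lat: "countable (lat \<tau>)"
proof -
  have "lat \<tau> = (\<lambda>(a,b). of_int a + of_int b * \<tau>) ` (UNIV :: (int \<times> int) set)"
    unfolding lat_def by auto
  then show ?thesis by simp
qed

lemma wp_sum_plus_tau: "wp_sum \<tau> (z + \<tau>) = wp_sum \<tau> z"
proof -
  have "bij_betw (\<lambda>m::int. m + 1) UNIV UNIV" by (rule bij_betwI[of _ _ _ "\<lambda>m. m - 1"]) auto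
  from infsum_reindex_bij_betw[OF this, of "\<lambda>m. csq (z + of_int m * \<tau>)"]
  show ?thesis unfolding wp_sum_def by (simp add: algebra_simps)
qed

lemma wp_sum_plus_of_int: "wp_sum \<tau> (z + of_int n) = wp_sum \<tau> z"
proof -
  have "csq (z + of_int n + w) = csq (z + w)" for w
    using csq_plus_of_int[of "z + w" n] by (simp add: algebra_simps)
  then show ?thesis unfolding wp_sum_def by simp
qed

lemma periodic_lat:
  assumes "\<And>z. f (z + 1) = (f z :: 'a)" "\<And>z. f (z + \<tau>) = f z" "w \<in> lat \<tau>"
  shows "f (z + w) = f z"
proof -
  have 1: "f (z + of_int n * p) = f z" if "\<And>z. f (z + p) = f z" for n p z
  proof (induction n rule: int_induct[where k=0])
    case base then show ?case by simp
  next
    case (step1 i) then show ?case using that[of "z + of_int i * p"] by (simp add: algebra_simps)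
  next
    case (step2 i) then show ?case using that[of "z + of_int (i - 1) * p"] by (simp add: algebra_simps)
  qed
  obtain a b where w: "w = of_int a + of_int b * \<tau>" using assms(3) unfolding lat_def by blast
  show ?thesis using 1[of 1 z a] 1[of \<tau> "z + of_int a" b] assms(1,2) by (simp add: w add.assoc)
qed

lemma wp_sum_plus_lat: "w \<in> lat \<tau> \<Longrightarrow> wp_sum \<tau> (z + w) = wp_sum \<tau> z"
  by (rule periodic_lat) (use wp_sum_plus_of_int[of \<tau> _ 1] wp_sum_plus_tau in auto)

lemma summable_on_int_power:
  fixes r :: real assumes "0 \<le> r" "r < 1"
  shows "(\<lambda>m::int. r ^ nat \<bar>m\<bar>) summable_on UNIV"
proof -
  have "(\<lambda>n::nat. r ^ n) summable_on UNIV"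
    using assms by (intro norm_summable_imp_summable_on) (simp add: summable_geometric)
  then have 1: "(\<lambda>m::int. r ^ nat \<bar>m\<bar>) summable_on (range int)"
    by (subst summable_on_reindex) (auto simp: o_def)
  have "(\<lambda>n::nat. r ^ n) summable_on UNIV"
    using assms by (intro norm_summable_imp_summable_on) (simp add: summable_geometric)
  then have 2: "(\<lambda>m::int. r ^ nat \<bar>m\<bar>) summable_on (range (\<lambda>n. - int n))"
    by (subst summable_on_reindex) (auto simp: o_def inj_on_def)
  have "UNIV = range int \<union> range (\<lambda>n. - int n)"
  proof (intro equalityI subsetI)
    fix x :: int
    have "x = int (nat x) \<or> x = - int (nat (-x))" by auto
    then show "x \<in> range int \<union> range (\<lambda>n. - int n)" by blast
  qed auto
  then show ?thesis using summable_on_union[OF 1 2] by simp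
qed

lemma norm_csq_shift_le:
  assumes "\<bar>real_of_int m\<bar> * Im \<tau> - \<bar>Im z\<bar> \<ge> 1"
  shows "norm (csq (z + of_int m * \<tau>)) \<le> 16 * pi^2 * exp (2 * pi * \<bar>Im z\<bar>) * exp (- 2 * pi * Im \<tau>) ^ nat \<bar>m\<bar>"
proof -
  define w where "w = (if m \<ge> 0 then z + of_int m * \<tau> else - (z + of_int m * \<tau>))"
  have c: "csq (z + of_int m * \<tau>) = csq w"
    unfolding w_def using csq_minus[of "z + of_int m * \<tau>"] by (cases "m \<ge> 0") (simp_all only: if_True if_False)
  have w: "Im w \<ge> \<bar>real_of_int m\<bar> * Im \<tau> - \<bar>Im z\<bar>" by (auto simp: w_def)
  then have "norm (csq w) \<le> 16 * pi^2 * exp (- 2 * pi * Im w)" using assms by (intro norm_csq_le) linarith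
  also have "\<dots> \<le> 16 * pi^2 * exp (- 2 * pi * (\<bar>real_of_int m\<bar> * Im \<tau> - \<bar>Im z\<bar>))"
    using w by (intro mult_left_mono) auto
  also have "exp (- 2 * pi * (\<bar>real_of_int m\<bar> * Im \<tau> - \<bar>Im z\<bar>)) = exp (2 * pi * \<bar>Im z\<bar>) * exp (- 2 * pi * Im \<tau>) ^ nat \<bar>m\<bar>"
    by (simp add: exp_of_nat_mult[symmetric] exp_add[symmetric] algebra_simps)
  finally show ?thesis using c by (simp add: mult.assoc)
qed

text \<open>The bound \<open>M\<close> serves a whole strip: beyond it every shifted point is at
  height at least 1 above or below the real axis, where the decay of \<open>csq\<close>
  applies.\<close>

lemma wp_tail:
  assumes "Im \<tau> > 0"
  obtains M :: nat where "\<And>m z. \<bar>m\<bar> \<ge> int M \<Longrightarrow> \<bar>Im z\<bar> \<le> B \<Longrightarrow> \<bar>real_of_int m\<bar> * Im \<tau> - \<bar>Im z\<bar> \<ge> 1"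
proof -
  obtain M :: nat where M: "real M \<ge> (B + 1) / Im \<tau>" using real_arch_simple by blast
  show ?thesis
  proof (rule that[of M])
    fix m :: int and z assume m: "\<bar>m\<bar> \<ge> int M" and z: "\<bar>Im z\<bar> \<le> B"
    have "B + 1 \<le> real M * Im \<tau>" using M assms by (simp add: field_simps)
    also have "\<dots> \<le> \<bar>real_of_int m\<bar> * Im \<tau>" using m assms by (intro mult_right_mono) linarith+
    finally show "\<bar>real_of_int m\<bar> * Im \<tau> - \<bar>Im z\<bar> \<ge> 1" using z by linarith
  qed
qed

lemma csq_shift_summable:
  assumes "Im \<tau> > 0"
  shows "(\<lambda>m::int. csq (z + of_int m * \<tau>)) summable_on S"
proof -
  obtain M :: nat where M: "\<And>m w. \<bar>m\<bar> \<ge> int M \<Longrightarrow> \<bar>Im w\<bar> \<le> \<bar>Im z\<bar> \<Longrightarrow> \<bar>real_of_int m\<bar> * Im \<tau> - \<bar>Im w\<bar> \<ge> 1"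
    using wp_tail[OF assms] by blast
  define r where "r = exp (- 2 * pi * Im \<tau>)"
  have r: "0 \<le> r" "r < 1" using assms by (auto simp: r_def)
  have "(\<lambda>m. 16 * pi^2 * exp (2 * pi * \<bar>Im z\<bar>) * r ^ nat \<bar>m\<bar>) summable_on {m. \<bar>m\<bar> \<ge> int M}"
    by (intro summable_on_cmult_right summable_on_subset[OF summable_on_int_power[OF r]]) auto
  then have "(\<lambda>m. norm (csq (z + of_int m * \<tau>))) summable_on {m. \<bar>m\<bar> \<ge> int M}"
    by (rule summable_on_comparison_test) (use norm_csq_shift_le M in \<open>auto simp: r_def\<close>)
  then have 1: "(\<lambda>m. csq (z + of_int m * \<tau>)) summable_on {m. \<bar>m\<bar> \<ge> int M}"
    by (rule abs_summable_summable)
  have "{m. \<bar>m\<bar> < int M} \<subseteq> {- int M..int M}" by auto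
  then have "finite {m. \<bar>m\<bar> < int M}" using finite_subset by blast
  then have "(\<lambda>m. csq (z + of_int m * \<tau>)) summable_on {m. \<bar>m\<bar> < int M}" by simp
  from summable_on_union[OF this 1] show ?thesis by (rule summable_on_subset_banach) auto
qed

text \<open>Only finitely many shifts can bring a point of the disc near a pole of
  \<open>csq\<close>; they form \<open>A1\<close>. The remaining ones, \<open>A2\<close>, converge
  uniformly by the M-test.\<close>

lemma wp_part_analytic:
  assumes \<tau>: "Im \<tau> > 0" and z0: "\<And>m. m \<in> S \<Longrightarrow> z0 + of_int m * \<tau> \<notin> \<int>"
  shows "(\<lambda>z. \<Sum>\<^sub>\<infinity>m\<in>S. csq (z + of_int m * \<tau>)) analytic_on {z0}"
proof -
  define B where "B = \<bar>Im z0\<bar> + 1"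
  obtain M :: nat where M: "\<And>m w. \<bar>m\<bar> \<ge> int M \<Longrightarrow> \<bar>Im w\<bar> \<le> B \<Longrightarrow> \<bar>real_of_int m\<bar> * Im \<tau> - \<bar>Im w\<bar> \<ge> 1"
    using wp_tail[OF \<tau>] by blast
  have Bz: "\<bar>Im z\<bar> \<le> B" if "z \<in> cball z0 1" for z
    using that abs_Im_le_cmod[of "z - z0"] by (simp add: B_def dist_norm norm_minus_commute)
  define r where "r = exp (- 2 * pi * Im \<tau>)"
  have r: "0 \<le> r" "r < 1" using \<tau> by (auto simp: r_def)
  define A1 where "A1 = {m\<in>S. \<bar>m\<bar> < int M}" define A2 where "A2 = {m\<in>S. \<bar>m\<bar> \<ge> int M}"
  have "A1 \<subseteq> {- int M..int M}" by (auto simp: A1_def)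
  then have fin: "finite A1" using finite_subset by blast
  have hol: "(\<lambda>z. csq (z + of_int m * \<tau>)) analytic_on cball z0 1" if "m \<in> A2" for m
  proof -
    have "csq analytic_on (\<lambda>z. z + of_int m * \<tau>) ` cball z0 1"
    proof (subst analytic_on_analytic_at, intro ballI csq_analytic)
      fix w assume "w \<in> (\<lambda>z. z + of_int m * \<tau>) ` cball z0 1"
      then obtain z where z: "z \<in> cball z0 1" "w = z + of_int m * \<tau>" by blast
      have "\<bar>real_of_int m\<bar> * Im \<tau> - \<bar>Im z\<bar> \<ge> 1" using M[of m z] Bz[OF z(1)] that by (simp add: A2_def)
      then have "\<bar>real_of_int m * Im \<tau>\<bar> - \<bar>Im z\<bar> \<ge> 1" using \<tau> by (simp add: abs_mult)
      moreover have "Im w = Im z + real_of_int m * Im \<tau>" using z(2) by simp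
      ultimately have "Im w \<noteq> 0" by linarith
      then show "w \<notin> \<int>" by (auto simp: Ints_def)
    qed
    then have "(csq \<circ> (\<lambda>z. z + of_int m * \<tau>)) analytic_on cball z0 1"
      by (intro analytic_on_compose) (auto intro!: analytic_intros)
    then show ?thesis by (simp add: o_def)
  qed
  have ul: "uniform_limit (cball z0 1) (\<lambda>X z. \<Sum>m\<in>X. csq (z + of_int m * \<tau>)) 
      (\<lambda>z. \<Sum>\<^sub>\<infinity>m\<in>A2. csq (z + of_int m * \<tau>)) (finite_subsets_at_top A2)"
  proof (rule Weierstrass_m_test_general)
    fix m z assume m: "m \<in> A2" and z: "z \<in> cball z0 1"
    have "norm (csq (z + of_int m * \<tau>)) \<le> 16 * pi^2 * exp (2 * pi * \<bar>Im z\<bar>) * r ^ nat \<bar>m\<bar>"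
      unfolding r_def using m M[of m z] Bz[OF z] by (intro norm_csq_shift_le) (simp add: A2_def)
    also have "\<dots> \<le> 16 * pi^2 * exp (2 * pi * B) * r ^ nat \<bar>m\<bar>"
      using Bz[OF z] r by (intro mult_right_mono mult_left_mono) auto
    finally show "norm (csq (z + of_int m * \<tau>)) \<le> 16 * pi^2 * exp (2 * pi * B) * r ^ nat \<bar>m\<bar>" .
  next
    show "(\<lambda>m. 16 * pi^2 * exp (2 * pi * B) * r ^ nat \<bar>m\<bar>) summable_on A2"
      by (intro summable_on_cmult_right summable_on_subset[OF summable_on_int_power[OF r]]) auto
  qed
  have "(\<lambda>z. \<Sum>\<^sub>\<infinity>m\<in>A2. csq (z + of_int m * \<tau>)) holomorphic_on ball z0 1"
  proof (rule holomorphic_uniform_limit[OF _ ul])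
    show "\<forall>\<^sub>F X in finite_subsets_at_top A2. continuous_on (cball z0 1) (\<lambda>z. \<Sum>m\<in>X. csq (z + of_int m * \<tau>)) \<and>
        (\<lambda>z. \<Sum>m\<in>X. csq (z + of_int m * \<tau>)) holomorphic_on ball z0 1"
    proof (rule eventually_finite_subsets_at_top_weakI)
      fix X assume X: "finite X" "X \<subseteq> A2"
      have "(\<lambda>z. \<Sum>m\<in>X. csq (z + of_int m * \<tau>)) analytic_on cball z0 1"
        using X hol by (intro analytic_on_sum) auto
      then have "(\<lambda>z. \<Sum>m\<in>X. csq (z + of_int m * \<tau>)) holomorphic_on cball z0 1" by (rule analytic_imp_holomorphic)
      then show "continuous_on (cball z0 1) (\<lambda>z. \<Sum>m\<in>X. csq (z + of_int m * \<tau>)) \<and>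
        (\<lambda>z. \<Sum>m\<in>X. csq (z + of_int m * \<tau>)) holomorphic_on ball z0 1"
        using holomorphic_on_imp_continuous_on holomorphic_on_subset ball_subset_cball by blast
    qed
  qed auto
  then have a2: "(\<lambda>z. \<Sum>\<^sub>\<infinity>m\<in>A2. csq (z + of_int m * \<tau>)) analytic_on {z0}"
    by (auto simp: analytic_at intro!: exI[of _ "ball z0 1"])
  have a1: "(\<lambda>z. \<Sum>m\<in>A1. csq (z + of_int m * \<tau>)) analytic_on {z0}"
  proof (rule analytic_on_sum)
    fix m assume m: "m \<in> A1"
    have "csq analytic_on (\<lambda>z. z + of_int m * \<tau>) ` {z0}"
      using csq_analytic z0[of m] m by (simp add: A1_def)
    then have "(csq \<circ> (\<lambda>z. z + of_int m * \<tau>)) analytic_on {z0}"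
      by (intro analytic_on_compose) (auto intro!: analytic_intros)
    then show "(\<lambda>z. csq (z + of_int m * \<tau>)) analytic_on {z0}" by (simp add: o_def)
  qed
  have S: "S = A1 \<union> A2" "A1 \<inter> A2 = {}" by (auto simp: A1_def A2_def)
  have "(\<Sum>\<^sub>\<infinity>m\<in>S. csq (z + of_int m * \<tau>)) = (\<Sum>m\<in>A1. csq (z + of_int m * \<tau>)) + (\<Sum>\<^sub>\<infinity>m\<in>A2. csq (z + of_int m * \<tau>))" for z
    unfolding S(1) using fin S(2) by (subst infsum_Un_disjoint) (auto intro: csq_shift_summable[OF \<tau>])
  then show ?thesis using analytic_on_add[OF a1 a2] by simp
qed

lemma wp_sum_analytic:
  assumes "Im \<tau> > 0" "z \<notin> lat \<tau>" shows "wp_sum \<tau> analytic_on {z}"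
  using wp_part_analytic[OF assms(1), of UNIV z] assms(2) unfolding wp_sum_def[abs_def] in_lat_iff by blast

definition wp_rest :: "complex \<Rightarrow> complex \<Rightarrow> complex" where
  "wp_rest \<tau> z = (\<Sum>\<^sub>\<infinity>m\<in>(- {0::int}). csq (z + of_int m * \<tau>))"

lemma wp_sum_eq: "Im \<tau> > 0 \<Longrightarrow> wp_sum \<tau> z = csq z + wp_rest \<tau> z"
  using infsum_Un_disjoint[of "\<lambda>m. csq (z + of_int m * \<tau>)" "{0}" "- {0}"] csq_shift_summable[of \<tau> z]
  unfolding wp_sum_def wp_rest_def by simp

section \<open>Lambert series and the Taylor expansion of the terms with nonzero shift\<close>

definition lambert :: "nat \<Rightarrow> complex \<Rightarrow> complex" where
  "lambert r q = (\<Sum>n. of_nat (divisor_sigma r (Suc n)) * q ^ Suc n)"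

text \<open>The general term of \<open>csq (z + (m + 1) \<tau>)\<close> after expanding by
  \<open>csq_series\<close> (index \<open>n\<close>) and then expanding
  \<open>exp (2 pi i (n + 1) z)\<close> in powers of \<open>z\<close> (index
  \<open>k\<close>).\<close>

definition wp_term :: "complex \<Rightarrow> complex \<Rightarrow> nat \<times> nat \<times> nat \<Rightarrow> complex" where
  "wp_term q z = (\<lambda>(m, n, k). (2*pi*\<i>)^2 * of_nat (Suc n) * q ^ (Suc m * Suc n) * ((2*pi*\<i> * of_nat (Suc n) * z) ^ k / fact k))"

lemma summable_on_nat_of_norm:
  fixes f :: "nat \<Rightarrow> 'a::banach"
  shows "summable (\<lambda>n. norm (f n)) \<Longrightarrow> f summable_on UNIV"
  by (rule norm_summable_imp_summable_on)

lemma exp_series_has_sum: "((\<lambda>k. x ^ k / fact k) has_sum exp x) (UNIV::nat set)" for x :: "'a::{banach,real_normed_field}"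
proof -
  have "(\<lambda>k. x ^ k / fact k) sums exp x" using exp_converges[of x] by (simp add: scaleR_conv_of_real field_simps)
  moreover have "summable (\<lambda>k. norm (x ^ k / fact k))"
    using summable_norm_exp[of x] by (simp add: norm_mult norm_inverse norm_power divide_inverse mult.commute)
  ultimately show ?thesis by (rule norm_summable_imp_has_sum[rotated])
qed

lemma summable_Suc_power:
  fixes x :: real assumes "0 \<le> x" "x < 1" shows "(\<lambda>n. of_nat (Suc n) * x ^ Suc n) summable_on UNIV"
proof -
  have "(\<lambda>n. of_nat (Suc n) * x ^ n) sums (1 / (1 - x)^2)" using geometric_deriv_sums[of x] assms by simp
  from sums_mult[OF this, of x] have "summable (\<lambda>n. of_nat (Suc n) * x ^ Suc n)" by (simp add: sums_iff mult_ac)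
  then show ?thesis using assms by (intro summable_on_nat_of_norm) (simp add: abs_mult)
qed

text \<open>Summing absolute values over \<open>k\<close> gives an exponential, and then
  \<open>|q|^(m (n + 1)) \<le> |q|^m\<close> separates the sums over \<open>m\<close> and
  \<open>n\<close>. For \<open>q = nome \<tau>\<close> the first hypothesis says
  \<open>norm z < Im \<tau>\<close>.\<close>

lemma wp_term_summable:
  assumes "norm q * exp (2 * pi * norm z) < 1" "norm q < 1"
  shows "wp_term q z summable_on UNIV"
proof (rule abs_summable_summable)
  define x where "x = norm q * exp (2 * pi * norm z)"
  have x: "0 \<le> x" "x < 1" using assms by (auto simp: x_def)
  define g where "g = (\<lambda>(m,n). 4 * pi^2 * of_nat (Suc n) * norm q ^ (Suc m * Suc n) * exp (2 * pi * of_nat (Suc n) * norm z))"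
  have hs: "((\<lambda>k. norm (wp_term q z (m, n, k))) has_sum g (m, n)) UNIV" for m n
  proof -
    have "((\<lambda>k. 4 * pi^2 * of_nat (Suc n) * norm q ^ (Suc m * Suc n) * ((2 * pi * of_nat (Suc n) * norm z) ^ k / fact k)) has_sum g (m, n)) UNIV"
      unfolding g_def prod.case by (intro has_sum_cmult_right exp_series_has_sum)
    moreover have "norm (wp_term q z (m, n, k)) = 4 * pi^2 * of_nat (Suc n) * norm q ^ (Suc m * Suc n) * ((2 * pi * of_nat (Suc n) * norm z) ^ k / fact k)" for k
      unfolding wp_term_def prod.case
      by (simp only: norm_mult norm_power norm_divide norm_of_nat norm_of_real norm_ii norm_fact power_mult_distrib) (simp add: power2_eq_square)
    ultimately show ?thesis by simp
  qed
  have gle: "g (m, n) \<le> (4 * pi^2 * norm q ^ m) * (of_nat (Suc n) * x ^ Suc n)" for m n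
  proof -
    have "norm q ^ (Suc m * Suc n) * exp (2 * pi * of_nat (Suc n) * norm z) = norm q ^ (m * Suc n) * x ^ Suc n"
      unfolding x_def power_mult_distrib exp_of_nat_mult[symmetric] by (simp add: power_add mult_ac)
    also have "\<dots> \<le> norm q ^ m * x ^ Suc n"
      using x assms(2) by (intro mult_right_mono power_decreasing) auto
    finally show ?thesis unfolding g_def prod.case
      using mult_left_mono[of _ _ "4 * pi^2 * of_nat (Suc n)"] by (fastforce simp: mult_ac)
  qed
  have g0: "g y \<ge> 0" for y by (auto simp: g_def split: prod.split)
  define C where "C = (\<Sum>\<^sub>\<infinity>n. of_nat (Suc n) * x ^ Suc n)"
  have "((\<lambda>n. of_nat (Suc n) * x ^ Suc n) has_sum C) UNIV"
    unfolding C_def using summable_Suc_power[OF x] by (rule has_sum_infsum)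
  then have i: "((\<lambda>n. (4 * pi^2 * norm q ^ m) * (of_nat (Suc n) * x ^ Suc n)) has_sum (4 * pi^2 * norm q ^ m * C)) UNIV" for m
    by (rule has_sum_cmult_right)
  have "(\<lambda>m. 4 * pi^2 * norm q ^ m * C) summable_on UNIV"
    using assms(2) by (intro summable_on_cmult_left summable_on_cmult_right summable_on_nat_of_norm) (simp add: summable_geometric norm_power)
  then have "(\<lambda>(m,n). (4 * pi^2 * norm q ^ m) * (of_nat (Suc n) * x ^ Suc n)) summable_on Sigma UNIV (\<lambda>_. UNIV)"
    using i x by (intro summable_on_SigmaI[where g = "\<lambda>m. 4 * pi^2 * norm q ^ m * C"]) auto
  then have gs: "g summable_on UNIV"
    unfolding UNIV_Times_UNIV by (rule summable_on_comparison_test) (use gle g0 in auto)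
  have "(\<lambda>((m,n),k). norm (wp_term q z (m, n, k))) summable_on Sigma UNIV (\<lambda>_. UNIV)"
    using hs gs by (intro summable_on_SigmaI[where g = g]) auto
  then have "(\<lambda>((m,n),k). norm (wp_term q z (m, n, k))) summable_on UNIV" by simp
  moreover have "bij_betw (\<lambda>(m,n,k). ((m,n),k)) (UNIV :: (nat \<times> nat \<times> nat) set) UNIV"
    by (rule bij_betwI[of _ _ _ "\<lambda>((m,n),k). (m,n,k)"]) auto
  ultimately have "(\<lambda>y. (\<lambda>((m,n),k). norm (wp_term q z (m, n, k))) ((\<lambda>(m,n,k). ((m,n),k)) y)) summable_on UNIV"
    using summable_on_reindex_bij_betw by blast
  then show "(\<lambda>y. norm (wp_term q z y)) summable_on UNIV" by (simp add: case_prod_unfold)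
qed

lemma lambert_has_sum:
  assumes "norm q < 1"
  shows "((\<lambda>(m,n). of_nat (Suc n) ^ r * q ^ (Suc m * Suc n)) has_sum lambert r q) UNIV" 
    and "(\<lambda>n. of_nat (divisor_sigma r (Suc n)) * q ^ Suc n) sums lambert r q"
    and "(\<lambda>n. of_nat (divisor_sigma r (Suc n)) * norm q ^ Suc n) summable_on UNIV"
proof -
  have *: "(\<lambda>(m,n). of_nat (Suc n) ^ r * q ^ (Suc m * Suc n)) summable_on UNIV" if q: "norm q < 1" for q :: complex
  proof (cases "q = 0")
    case True
    then have "(\<lambda>(m,n). of_nat (Suc n) ^ r * q ^ (Suc m * Suc n)) = (\<lambda>_. 0)" by auto
    then show ?thesis by simp
  next
    case False
    \<comment> \<open>For this \<open>z\<close> the number \<open>exp (2 pi |z|)\<close> is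
      \<open>|q|^(-1/2)\<close>, so \<open>wp_term_summable\<close> applies. The slice
      \<open>k = r\<close> is, up to a constant, the wanted family with exponent
      \<open>Suc r\<close>, which dominates the one with exponent \<open>r\<close>.\<close>
    define z where "z = (of_real (- ln (norm q) / (4 * pi)) :: complex)"
    have ln0: "ln (norm q) < 0" using q False by simp
    then have z0: "z \<noteq> 0" by (simp add: z_def)
    have nz: "2 * pi * norm z = - ln (norm q) / 2" using ln0 by (simp add: z_def norm_divide del: of_real_minus of_real_divide)
    have "norm q * exp (2 * pi * norm z) = exp (ln (norm q)) * exp (- ln (norm q) / 2)" using False nz by simp
    also have "\<dots> = exp (ln (norm q) / 2)" by (simp add: exp_add[symmetric])
    also have "\<dots> < 1" using ln0 by simp
    finally have "wp_term q z summable_on UNIV" using q by (intro wp_term_summable)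
    then have "wp_term q z summable_on ((\<lambda>(m,n). (m, n, r)) ` UNIV)" by (rule summable_on_subset_banach) auto
    then have "(wp_term q z \<circ> (\<lambda>(m,n). (m, n, r))) summable_on UNIV"
      by (subst (asm) summable_on_reindex) (auto simp: inj_on_def)
    then have "(\<lambda>y. (fact r / ((2*pi*\<i>)^2 * (2*pi*\<i> * z) ^ r)) * (wp_term q z \<circ> (\<lambda>(m,n). (m, n, r))) y) summable_on UNIV"
      by (rule summable_on_cmult_right)
    then have "(\<lambda>(m,n). of_nat (Suc n) ^ Suc r * q ^ (Suc m * Suc n)) summable_on UNIV"
    proof (rule summable_on_cong[THEN iffD1, rotated])
      fix y :: "nat \<times> nat"
      obtain m n where y: "y = (m, n)" by fastforce
      define A Z s Q where "A = (2*pi*\<i>)^2" "Z = 2*pi*\<i> * z" "s = (of_nat (Suc n) :: complex)" "Q = q ^ (Suc m * Suc n)"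
      have "A \<noteq> 0" "Z \<noteq> 0" using z0 by (auto simp: A_Z_s_Q_def)
      moreover have eq: "2*pi*\<i> * s * z = Z * s" by (simp add: A_Z_s_Q_def)
      ultimately show "(fact r / ((2*pi*\<i>)^2 * (2*pi*\<i> * z) ^ r)) * (wp_term q z \<circ> (\<lambda>(m,n). (m, n, r))) y = (\<lambda>(m,n). of_nat (Suc n) ^ Suc r * q ^ (Suc m * Suc n)) y"
        unfolding y wp_term_def o_def prod.case A_Z_s_Q_def[symmetric] eq
        by (simp add: power_mult_distrib)
    qed
    then have "(\<lambda>y. norm ((\<lambda>(m,n). of_nat (Suc n) ^ Suc r * q ^ (Suc m * Suc n)) y)) summable_on UNIV"
      by (simp only: summable_on_iff_abs_summable_on_complex)
    then have "(\<lambda>y. norm ((\<lambda>(m,n). of_nat (Suc n) ^ r * q ^ (Suc m * Suc n)) y)) summable_on UNIV"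
    proof (rule summable_on_comparison_test)
      fix y :: "nat \<times> nat"
      obtain m n where y: "y = (m, n)" by fastforce
      have "real (Suc n) ^ r \<le> real (Suc n) ^ Suc r" by (rule power_increasing) auto
      then show "norm ((\<lambda>(m,n). of_nat (Suc n) ^ r * q ^ (Suc m * Suc n)) y) \<le> norm ((\<lambda>(m,n). of_nat (Suc n) ^ Suc r * q ^ (Suc m * Suc n)) y)"
        unfolding y prod.case norm_mult norm_power norm_of_nat by (intro mult_right_mono) auto
    qed auto
    then show ?thesis by (rule abs_summable_summable)
  qed
  define W where "W = (\<lambda>q. \<Sum>\<^sub>\<infinity>(m,n). of_nat (Suc n) ^ r * q ^ (Suc m * Suc n) :: complex)"
  have hs: "((\<lambda>N. of_nat (divisor_sigma r (Suc N)) * q ^ Suc N) has_sum W q) UNIV \<and> ((\<lambda>(m,n). of_nat (Suc n) ^ r * q ^ (Suc m * Suc n)) has_sum W q) UNIV" 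
    if q: "norm q < 1" for q :: complex
  proof -
    have 1: "((\<lambda>(m,n). of_nat (Suc n) ^ r * q ^ (Suc m * Suc n)) has_sum W q) UNIV"
      unfolding W_def using *[OF q] by (rule has_sum_infsum)
    \<comment> \<open>Pairs are grouped by their product: \<open>Suc N = Suc m * Suc n\<close> with
      divisor \<open>d = Suc n\<close>, which turns the double sum into divisor sums.\<close>
    have b: "bij_betw (\<lambda>(m,n). (Suc m * Suc n - 1, Suc n)) UNIV (Sigma UNIV (\<lambda>N. {d. d dvd Suc N}))"
    proof (rule bij_betwI[of _ _ _ "\<lambda>(N,d). (Suc N div d - 1, d - 1)"])
      fix y assume y: "y \<in> Sigma UNIV (\<lambda>N. {d. d dvd Suc N})"
      obtain N d where Nd: "y = (N, d)" by fastforce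
      then obtain k where k: "Suc N = d * k" using y by (auto elim: dvdE)
      then obtain d' k' where "d = Suc d'" "k = Suc k'" by (metis mult_0 mult_0_right not0_implies_Suc nat.distinct(1))
      then show "(\<lambda>(m,n). (Suc m * Suc n - 1, Suc n)) ((\<lambda>(N,d). (Suc N div d - 1, d - 1)) y) = y"
        using k Nd by (simp only: prod.case nonzero_mult_div_cancel_left nat.distinct not_False_eq_True diff_Suc_1) (simp add: algebra_simps)
    qed (auto simp del: mult_Suc mult_Suc_right)
    have "((\<lambda>(N,d). of_nat d ^ r * q ^ Suc N) has_sum W q) (Sigma UNIV (\<lambda>N. {d. d dvd Suc N}))"
      using 1 by (subst has_sum_reindex_bij_betw[OF b, symmetric]) (simp add: case_prod_unfold)
    then have "((\<lambda>N. \<Sum>d\<in>{d. d dvd Suc N}. of_nat d ^ r * q ^ Suc N) has_sum W q) UNIV"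
      by (rule has_sum_SigmaD) (auto intro!: has_sum_finite)
    then show ?thesis using 1 by (simp add: divisor_sigma_def sum_distrib_right)
  qed
  have sums: "(\<lambda>N. of_nat (divisor_sigma r (Suc N)) * q ^ Suc N) sums W q"
    using hs[OF assms] by (intro has_sum_imp_sums) blast
  then have W: "W q = lambert r q" unfolding lambert_def by (simp add: sums_iff)
  show "((\<lambda>(m,n). of_nat (Suc n) ^ r * q ^ (Suc m * Suc n)) has_sum lambert r q) UNIV" 
    and "(\<lambda>n. of_nat (divisor_sigma r (Suc n)) * q ^ Suc n) sums lambert r q"
    using hs[OF assms] sums by (auto simp: W)
  have "(\<lambda>N. of_nat (divisor_sigma r (Suc N)) * q ^ Suc N) summable_on UNIV" using hs[OF assms] has_sum_imp_summable by blast
  then show "(\<lambda>n. of_nat (divisor_sigma r (Suc n)) * norm q ^ Suc n) summable_on UNIV"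
    by (subst (asm) summable_on_iff_abs_summable_on_complex) (simp add: norm_mult norm_power)
qed

section \<open>Laurent coefficients and Eisenstein series\<close>

abbreviation tpi :: complex where "tpi \<equiv> complex_of_real (2 * pi) * \<i>"

abbreviation nome :: "complex \<Rightarrow> complex" where "nome \<tau> \<equiv> exp (tpi * \<tau>)"

text \<open>One absolutely convergent triple sum is evaluated in two orders: for fixed
  \<open>k\<close> the sum over \<open>m\<close> and \<open>n\<close> is a Lambert series, while for
  fixed \<open>m\<close> the sum over \<open>k\<close> and \<open>n\<close> is a value of
  \<open>csq\<close>. Only positive shifts occur here; the negative ones follow by replacing
  \<open>z\<close> with \<open>-z\<close>.\<close>

lemma wp_half_expansion:
  assumes \<tau>: "Im \<tau> > 0" and z: "norm z < Im \<tau>"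
  defines "q \<equiv> nome \<tau>"
  obtains W where "((\<lambda>k. tpi^(k+2) / fact k * lambert (Suc k) q * z^k) has_sum W) UNIV"
    "((\<lambda>m. csq (z + of_nat (Suc m) * \<tau>)) has_sum W) UNIV"
proof -
  have nq: "norm q = exp (- 2 * pi * Im \<tau>)" by (simp add: q_def)
  have q1: "norm q < 1" using \<tau> by (simp add: nq)
  have "norm q * exp (2 * pi * norm z) = exp (2 * pi * (norm z - Im \<tau>))"
    by (simp add: nq exp_add[symmetric] algebra_simps)
  also have "\<dots> < 1" using z by (simp add: mult_pos_neg)
  finally have sm: "wp_term q z summable_on UNIV" using q1 by (intro wp_term_summable)
  define W where "W = infsum (wp_term q z) UNIV"
  have hs: "(wp_term q z has_sum W) UNIV" unfolding W_def using sm by (rule has_sum_infsum)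
  have bij: "bij_betw (\<lambda>(k,m,n). (m,n,k)) (UNIV :: (nat \<times> nat \<times> nat) set) UNIV"
    by (rule bij_betwI[of _ _ _ "\<lambda>(m,n,k). (k,m,n)"]) auto
  have "((\<lambda>(k,m,n). wp_term q z (m,n,k)) has_sum W) UNIV"
    using hs by (subst (asm) has_sum_reindex_bij_betw[OF bij, symmetric]) (simp add: case_prod_unfold)
  then have "((\<lambda>(k,m,n). wp_term q z (m,n,k)) has_sum W) (Sigma UNIV (\<lambda>_. UNIV))" by simp
  then have 1: "((\<lambda>k. tpi^(k+2) / fact k * lambert (Suc k) q * z^k) has_sum W) UNIV"
  proof (rule has_sum_SigmaD)
    fix k :: nat
    have "((\<lambda>y. tpi^(k+2) / fact k * z^k * (\<lambda>(m,n). of_nat (Suc n) ^ Suc k * q ^ (Suc m * Suc n)) y) has_sum (tpi^(k+2) / fact k * z^k * lambert (Suc k) q)) UNIV"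
      by (intro has_sum_cmult_right lambert_has_sum(1) q1)
    then show "((\<lambda>y. (\<lambda>(k,m,n). wp_term q z (m,n,k)) (k, y)) has_sum (tpi^(k+2) / fact k * lambert (Suc k) q * z^k)) UNIV"
      unfolding wp_term_def case_prod_unfold fst_conv snd_conv
      by (simp add: power_mult_distrib mult_ac power_add power2_eq_square del: mult_Suc mult_Suc_right of_nat_Suc)
  qed
  have "(wp_term q z has_sum W) (Sigma UNIV (\<lambda>_. UNIV))" using hs by simp
  then have 2: "((\<lambda>m. csq (z + of_nat (Suc m) * \<tau>)) has_sum W) UNIV"
  proof (rule has_sum_SigmaD)
    fix m :: nat
    define u where "u = exp (tpi*(z + of_nat (Suc m) * \<tau>))"
    have Iz: "Im (z + of_nat (Suc m) * \<tau>) > 0"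
    proof -
      have "\<bar>Im z\<bar> < Im \<tau>" using z abs_Im_le_cmod[of z] by linarith
      moreover have "1 * Im \<tau> \<le> real (Suc m) * Im \<tau>" using \<tau> by (intro mult_right_mono) auto
      ultimately show ?thesis by simp
    qed
    have "(\<lambda>y. wp_term q z (m, y)) summable_on UNIV"
    proof -
      have "wp_term q z summable_on (Pair m ` UNIV)" by (rule summable_on_subset_banach[OF sm]) auto
      then show ?thesis by (subst (asm) summable_on_reindex) (auto simp: inj_on_def o_def)
    qed
    then have s: "((\<lambda>y. wp_term q z (m, y)) has_sum infsum (\<lambda>y. wp_term q z (m, y)) UNIV) (Sigma UNIV (\<lambda>_. UNIV))"
      by (simp add: has_sum_infsum)
    have "((\<lambda>n. tpi^2 * of_nat (Suc n) * u ^ Suc n) has_sum infsum (\<lambda>y. wp_term q z (m, y)) UNIV) UNIV"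
    proof (rule has_sum_SigmaD[OF s])
      fix n :: nat
      have "((\<lambda>k. tpi^2 * of_nat (Suc n) * q ^ (Suc m * Suc n) * ((tpi * of_nat (Suc n) * z) ^ k / fact k)) has_sum
         (tpi^2 * of_nat (Suc n) * q ^ (Suc m * Suc n) * exp (tpi * of_nat (Suc n) * z))) UNIV"
        by (intro has_sum_cmult_right exp_series_has_sum)
      moreover have e: "q ^ (Suc m * Suc n) * exp (tpi * of_nat (Suc n) * z) = u ^ Suc n"
        unfolding q_def u_def exp_of_nat_mult[symmetric] exp_add[symmetric] by (simp add: algebra_simps)
      have "tpi^2 * of_nat (Suc n) * q ^ (Suc m * Suc n) * exp (tpi * of_nat (Suc n) * z) = tpi^2 * of_nat (Suc n) * u ^ Suc n"
        unfolding e[symmetric] by (simp only: mult.assoc)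
      ultimately show "((\<lambda>k. wp_term q z (m, n, k)) has_sum (tpi^2 * of_nat (Suc n) * u ^ Suc n)) UNIV"
        unfolding wp_term_def prod.case by (simp only:)
    qed
    from has_sum_imp_sums[OF this] have "infsum (\<lambda>y. wp_term q z (m, y)) UNIV = csq (z + of_nat (Suc m) * \<tau>)"
      using csq_series[OF Iz] unfolding u_def[symmetric] by (rule sums_unique2)
    then show "((\<lambda>y. wp_term q z (m, y)) has_sum csq (z + of_nat (Suc m) * \<tau>)) UNIV"
      using s by simp
  qed
  from that[OF 1 2] show ?thesis .
qed

text \<open>The shifts by negative multiples of \<open>\<tau>\<close> repeat the positive ones at
  \<open>-z\<close>, whence the factor \<open>1 + (-1)^k\<close>.\<close>

definition rest_coeff :: "nat \<Rightarrow> complex \<Rightarrow> complex" where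
  "rest_coeff k q = tpi^(k+2) / fact k * (1 + (-1)^k) * lambert (Suc k) q"

lemma wp_rest_sums:
  assumes \<tau>: "Im \<tau> > 0" and z: "norm z < Im \<tau>"
  shows "(\<lambda>k. rest_coeff k (nome \<tau>) * z ^ k) sums wp_rest \<tau> z"
proof -
  define q where "q = nome \<tau>"
  obtain W1 where W1: "((\<lambda>k. tpi^(k+2) / fact k * lambert (Suc k) q * z^k) has_sum W1) UNIV"
    "((\<lambda>m. csq (z + of_nat (Suc m) * \<tau>)) has_sum W1) UNIV"
    using wp_half_expansion[OF assms] unfolding q_def by blast
  have "norm (-z) < Im \<tau>" using z by simp
  then obtain W2 where W2: "((\<lambda>k. tpi^(k+2) / fact k * lambert (Suc k) q * (-z)^k) has_sum W2) UNIV"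
    "((\<lambda>m. csq (- z + of_nat (Suc m) * \<tau>)) has_sum W2) UNIV"
    using wp_half_expansion[OF \<tau>, of "-z"] unfolding q_def by blast
  have "((\<lambda>k. tpi^(k+2) / fact k * lambert (Suc k) q * z^k + tpi^(k+2) / fact k * lambert (Suc k) q * (-z)^k) has_sum (W1 + W2)) UNIV"
    by (rule has_sum_add[OF W1(1) W2(1)])
  then have 1: "(\<lambda>k. rest_coeff k q * z ^ k) sums (W1 + W2)"
  proof (rule has_sum_imp_sums[THEN sums_cong[THEN iffD1, rotated]])
    fix k show "tpi^(k+2) / fact k * lambert (Suc k) q * z^k + tpi^(k+2) / fact k * lambert (Suc k) q * (-z)^k = rest_coeff k q * z ^ k"
    proof -
      define A where "A = tpi^(k+2) / fact k"
      show ?thesis unfolding rest_coeff_def power_minus[of z] A_def[symmetric] by (simp add: algebra_simps)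
    qed
  qed
  have r1: "bij_betw (\<lambda>m. int (Suc m)) UNIV {0<..}"
    by (rule bij_betwI[of _ _ _ "\<lambda>i. nat i - 1"]) auto
  have r2: "bij_betw (\<lambda>m. - int (Suc m)) UNIV {..<0}"
    by (rule bij_betwI[of _ _ _ "\<lambda>i. nat (-i) - 1"]) auto
  have "((\<lambda>i. csq (z + of_int i * \<tau>)) has_sum W1) {0<..}"
    using W1(2) by (subst has_sum_reindex_bij_betw[OF r1, symmetric]) simp
  moreover have "csq (z + of_int (- int (Suc m)) * \<tau>) = csq (- z + of_nat (Suc m) * \<tau>)" for m
    using csq_minus[of "- z + of_nat (Suc m) * \<tau>"] by (simp add: algebra_simps)
  then have "((\<lambda>i. csq (z + of_int i * \<tau>)) has_sum W2) {..<0}"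
    using W2(2) by (subst has_sum_reindex_bij_betw[OF r2, symmetric]) (simp only:)
  ultimately have "((\<lambda>i. csq (z + of_int i * \<tau>)) has_sum (W1 + W2)) ({0<..} \<union> {..<0})"
    by (rule has_sum_Un_disjoint) auto
  moreover have "{0<..} \<union> {..<0} = - {0::int}" by auto
  ultimately have "wp_rest \<tau> z = W1 + W2" unfolding wp_rest_def by (simp add: infsumI)
  then show ?thesis using 1 unfolding q_def by simp
qed

lemma wp_rest_fps: "Im \<tau> > 0 \<Longrightarrow> wp_rest \<tau> has_fps_expansion Abs_fps (\<lambda>k. rest_coeff k (nome \<tau>))"
  by (rule has_fps_expansionI, rule eventually_nhds_in_open[of "ball 0 (Im \<tau>)", THEN eventually_mono])
    (simp_all only: fps_nth_Abs_fps mem_ball dist_0_norm wp_rest_sums open_ball norm_zero)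

section \<open>Bernoulli numbers and the Laurent expansion of \<open>csq\<close>\<close>

definition bern_fps :: "complex fps" where
  "bern_fps = Abs_fps (\<lambda>k. of_rat (bernoulli k) / fact k)"

declare bernoulli.simps [simp del]

lemma bernoulli_0: "bernoulli 0 = 1" by (simp add: bernoulli.simps)

lemma bernoulli_rec: "n \<ge> 2 \<Longrightarrow> (\<Sum>j<n. of_nat (n choose j) * bernoulli j) = 0"
proof -
  assume n: "n \<ge> 2"
  then obtain m where m: "n = Suc m" "m > 0" by (cases n) auto
  have "bernoulli m * of_nat (m + 1) = - (\<Sum>j<m. of_nat ((m + 1) choose j) * bernoulli j)"
    using m(2) by (subst bernoulli.simps) (simp add: field_simps del: of_nat_Suc of_nat_add)
  then show ?thesis using m by (simp add: algebra_simps)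
qed

lemma bern_fps_exp: "bern_fps * (fps_exp 1 - 1) = fps_X"
proof (rule fps_ext)
  fix n
  show "fps_nth (bern_fps * (fps_exp 1 - 1)) n = fps_nth fps_X n"
  proof (cases "n < 2")
    case True
    then consider "n = 0" | "n = 1" by linarith
    then show ?thesis by cases (auto simp: fps_mult_nth bern_fps_def bernoulli_0)
  next
    case False
    have "fps_nth (bern_fps * (fps_exp 1 - 1)) n = (\<Sum>j\<in>{0..n}. of_rat (bernoulli j) / fact j * (if j = n then 0 else 1 / fact (n - j)))"
      unfolding fps_mult_nth by (intro sum.cong) (auto simp: bern_fps_def)
    also have "\<dots> = (\<Sum>j<n. of_rat (bernoulli j) / fact j * (1 / fact (n - j)))"
      by (rule sum.mono_neutral_cong_right) auto
    also have "\<dots> = (\<Sum>j<n. of_rat (of_nat (n choose j) * bernoulli j) / fact n)"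
      by (intro sum.cong) (auto simp only: of_rat_mult of_rat_of_nat_eq, simp add: binomial_fact)
    also have "\<dots> = of_rat (\<Sum>j<n. of_nat (n choose j) * bernoulli j) / fact n"
      by (simp add: sum_divide_distrib of_rat_sum)
    also have "\<dots> = 0" using bernoulli_rec[of n] False by simp
    finally show ?thesis using False by simp
  qed
qed

text \<open>With \<open>b = x / (e^x - 1)\<close> this is the derivative of
  \<open>1 / (e^x - 1)\<close> in disguise. It makes the coefficients of
  \<open>x^2 e^x / (e^x - 1)^2\<close> linear in the Bernoulli numbers.\<close>

lemma bern_fps_square: "fps_exp 1 * bern_fps ^ 2 = bern_fps - fps_X * fps_deriv bern_fps"
proof -
  have "fps_deriv (bern_fps * (fps_exp 1 - 1)) = 1" by (simp add: bern_fps_exp)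
  then have d: "fps_deriv bern_fps * (fps_exp 1 - 1) + bern_fps * fps_exp 1 = 1"
    by (simp add: algebra_simps)
  have "bern_fps = bern_fps * (fps_deriv bern_fps * (fps_exp 1 - 1) + bern_fps * fps_exp 1)" by (simp add: d)
  also have "\<dots> = fps_deriv bern_fps * (bern_fps * (fps_exp 1 - 1)) + fps_exp 1 * bern_fps ^ 2"
    by (simp add: algebra_simps power2_eq_square)
  finally show ?thesis unfolding bern_fps_exp by (simp add: algebra_simps)
qed

text \<open>With \<open>x = 2 pi i z\<close> the function \<open>z^2 csq z\<close> equals
  \<open>x^2 e^x / (e^x - 1)^2\<close>, so \<open>bern_fps_square\<close> gives its coefficients.
  The value 1 at 0 fills the removable singularity.\<close>

lemma csq_fps:
  "(\<lambda>z. if z = 0 then 1 else z^2 * csq z) has_fps_expansion Abs_fps (\<lambda>k. tpi^k * ((1 - of_nat k) * of_rat (bernoulli k) / fact k))"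
proof -
  define S where "S = fps_shift 1 (fps_exp 1 - 1 :: complex fps)"
  define s where "s = (\<lambda>w::complex. if w = 0 then 1 else (exp w - 1) / w ^ 1)"
  have sS: "s has_fps_expansion S" unfolding s_def S_def
    by (intro has_fps_expansion_shift fps_expansion_intros subdegree_geI) (auto simp: fps_eq_iff)
  have XS: "fps_exp 1 - 1 = fps_X * S"
    by (rule fps_ext) (auto simp: S_def fps_X_mult_nth)
  have "fps_X * (bern_fps * S) = fps_X * (1 :: complex fps)"
    using bern_fps_exp unfolding XS by (simp add: mult_ac)
  then have bS: "bern_fps * S = 1" by (metis mult_cancel_left fps_X_neq_zero)
  have S0: "fps_nth S 0 \<noteq> 0" by (simp add: S_def)
  have inv: "inverse S = bern_fps" using bS by (metis inverse_mult_eq_1 S0 mult.commute mult.left_commute mult.right_neutral)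
  have "(\<lambda>w. exp w * inverse (s w) ^ 2) has_fps_expansion fps_exp 1 * bern_fps ^ 2"
    unfolding inv[symmetric] by (intro fps_expansion_intros sS S0)
  then have G: "(\<lambda>w. exp w * inverse (s w) ^ 2) has_fps_expansion (bern_fps - fps_X * fps_deriv bern_fps)"
    by (simp only: bern_fps_square)
  have l: "(\<lambda>z. tpi * z) has_fps_expansion (fps_const tpi * fps_X)"
    by (intro fps_expansion_intros)
  have F: "((\<lambda>w. exp w * inverse (s w) ^ 2) \<circ> (\<lambda>z. tpi * z)) has_fps_expansion 
      fps_compose (bern_fps - fps_X * fps_deriv bern_fps) (fps_const tpi * fps_X)"
    by (rule has_fps_expansion_compose[OF G l]) simp
  show ?thesis
  proof (rule has_fps_expansion_cong[THEN iffD1, OF _ _ F])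
    show "fps_compose (bern_fps - fps_X * fps_deriv bern_fps) (fps_const tpi * fps_X) = 
        Abs_fps (\<lambda>k. tpi^k * ((1 - of_nat k) * of_rat (bernoulli k) / fact k))"
    proof (rule fps_ext)
      fix k
      have "fps_nth (bern_fps - fps_X * fps_deriv bern_fps) k = (1 - of_nat k) * of_rat (bernoulli k) / fact k"
        by (cases k) (simp_all add: bern_fps_def bernoulli_0 algebra_simps diff_divide_distrib add_divide_distrib)
      then show "fps_nth (fps_compose (bern_fps - fps_X * fps_deriv bern_fps) (fps_const tpi * fps_X)) k =
        fps_nth (Abs_fps (\<lambda>k. tpi^k * ((1 - of_nat k) * of_rat (bernoulli k) / fact k))) k"
        by (simp only: fps_nth_compose_linear fps_nth_Abs_fps)
    qed
    have "eventually (\<lambda>z. z \<in> ball 0 1) (nhds (0::complex))" by (intro eventually_nhds_in_open) auto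
    then show "eventually (\<lambda>z. ((\<lambda>w. exp w * inverse (s w) ^ 2) \<circ> (\<lambda>z. tpi * z)) z = (if z = 0 then 1 else z^2 * csq z)) (nhds 0)"
    proof eventually_elim
      case (elim z)
      show ?case
      proof (cases "z = 0")
        case False
        have "z \<notin> \<int>"
        proof
          assume "z \<in> \<int>" then obtain n where "z = of_int n" by (auto simp: Ints_def)
          then show False using elim False by auto
        qed
        define u where "u = exp (tpi*z)"
        have w: "tpi*z \<noteq> 0" using False by simp
        have "((\<lambda>w. exp w * inverse (s w) ^ 2) \<circ> (\<lambda>z. tpi * z)) z = u * inverse ((u - 1) / (tpi*z)) ^ 2"
          using w by (simp add: s_def u_def)
        also have "\<dots> = z^2 * (tpi^2 * u / (1 - u)^2)"
          by (simp add: power_divide power_mult_distrib field_simps power2_commute)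
        finally show ?thesis using False csq_exp[OF \<open>z \<notin> \<int>\<close>] unfolding u_def by simp
      qed (simp add: s_def)
    qed
  qed
qed

text \<open>The coefficient for \<open>k = 2\<close> involves \<open>E\<^sub>2\<close> and is not homogeneous in the lattice.\<close>
definition wp_coeff :: "nat \<Rightarrow> complex \<Rightarrow> complex" where
  "wp_coeff k q = tpi^k * ((1 - of_nat k) * of_rat (bernoulli k) / fact k) + (if k < 2 then 0 else rest_coeff (k - 2) q)"

definition wp_reg :: "complex \<Rightarrow> complex \<Rightarrow> complex" where
  "wp_reg \<tau> z = (if z = 0 then 1 else z^2 * wp_sum \<tau> z)"

lemma wp_reg_fps:
  assumes "Im \<tau> > 0"
  shows "wp_reg \<tau> has_fps_expansion Abs_fps (\<lambda>k. wp_coeff k (nome \<tau>))"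
proof -
  have "(\<lambda>z. (if z = 0 then 1 else z^2 * csq z) + z^2 * wp_rest \<tau> z) has_fps_expansion 
     Abs_fps (\<lambda>k. tpi^k * ((1 - of_nat k) * of_rat (bernoulli k) / fact k)) + fps_X ^ 2 * Abs_fps (\<lambda>k. rest_coeff k (nome \<tau>))"
    by (intro fps_expansion_intros csq_fps wp_rest_fps assms)
  also have "(\<lambda>z. (if z = 0 then 1 else z^2 * csq z) + z^2 * wp_rest \<tau> z) = wp_reg \<tau>"
    by (auto simp: fun_eq_iff wp_reg_def wp_sum_eq[OF assms] algebra_simps)
  also have "Abs_fps (\<lambda>k. tpi^k * ((1 - of_nat k) * of_rat (bernoulli k) / fact k)) + fps_X ^ 2 * Abs_fps (\<lambda>k. rest_coeff k (nome \<tau>)) = Abs_fps (\<lambda>k. wp_coeff k (nome \<tau>))"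
    by (rule fps_ext) (simp add: wp_coeff_def fps_X_power_mult_nth)
  finally show ?thesis .
qed

lemma wp_coeff_0 [simp]: "wp_coeff 0 q = 1" and wp_coeff_1 [simp]: "wp_coeff (Suc 0) q = 0"
  by (simp_all add: wp_coeff_def bernoulli_0)

lemma upper_half_exp_ex:
  assumes "norm q < 1" "q \<noteq> 0"
  obtains \<tau> where "Im \<tau> > 0" "q = nome \<tau>"
proof (rule that[of "ln q / tpi"])
  show "q = exp (tpi * (ln q / tpi))" using assms(2) by simp
  have "Im (ln q / tpi) = - ln (norm q) / (2 * pi)" using assms(2) by (simp add: Im_divide Re_divide power2_eq_square)
  then show "Im (ln q / tpi) > 0" using assms by (simp add: divide_neg_pos)
qed

lemma rest_coeff_odd: "odd k \<Longrightarrow> rest_coeff k q = 0"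
  by (simp add: rest_coeff_def)

text \<open>The function \<open>csq\<close> is even, so the odd coefficients in
  \<open>csq_fps\<close> vanish. The factor \<open>1 - k\<close> in them is nonzero only for
  \<open>k\<close> other than 1.\<close>

lemma bernoulli_odd:
  assumes "odd k" "k > 1" shows "bernoulli k = 0"
proof -
  define \<Phi> where "\<Phi> = (\<lambda>z::complex. if z = 0 then 1 else z^2 * csq z)"
  define F where "F = Abs_fps (\<lambda>k. tpi^k * ((1 - of_nat k) * of_rat (bernoulli k) / fact k))"
  have 1: "\<Phi> has_fps_expansion F" unfolding \<Phi>_def F_def by (rule csq_fps)
  have m: "(\<lambda>z. (-1) * z) has_fps_expansion (fps_const (-1 :: complex) * fps_X)"
    by (intro fps_expansion_intros)
  have "(\<Phi> \<circ> (\<lambda>z. (-1) * z)) has_fps_expansion fps_compose F (fps_const (-1) * fps_X)"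
    by (rule has_fps_expansion_compose[OF 1 m]) simp
  also have "(\<Phi> \<circ> (\<lambda>z. (-1) * z)) = \<Phi>" by (auto simp: \<Phi>_def fun_eq_iff)
  finally have "fps_compose F (fps_const (-1) * fps_X) = F" using 1 by (metis fps_expansion_unique_complex)
  then have "(-1) ^ k * fps_nth F k = fps_nth F k" by (metis fps_nth_compose_linear)
  then have "fps_nth F k = 0" using assms(1) by simp
  then show ?thesis using assms(2) by (simp add: F_def)
qed

lemma wp_coeff_odd: "odd k \<Longrightarrow> wp_coeff k q = 0"
  using bernoulli_odd[of k] by (cases "k < 2") (auto simp: wp_coeff_def rest_coeff_odd less_2_cases_iff)

section \<open>Consequences of Liouville's theorem\<close>

text \<open>After removing the singularities, continuity on the compact period parallelogram gives
  boundedness, and Liouville's theorem applies. The conclusion is about the Laurent series because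
  \<open>f\<close> may take arbitrary values at lattice points.\<close>

lemma elliptic_constant:
  assumes \<tau>: "Im \<tau> > 0" and per: "\<And>z. f (z + 1) = f z" "\<And>z. f (z + \<tau>) = f z"
    and an: "\<And>z. z \<notin> lat \<tau> \<Longrightarrow> f analytic_on {z}"
    and F: "f has_laurent_expansion F" and neg: "\<And>n. n < 0 \<Longrightarrow> fls_nth F n = 0"
  shows "F = fls_const (fls_nth F 0)"
proof -
  define G where "G = fls_regpart F"
  have FG: "F = fps_to_fls G" unfolding G_def
    by (rule fls_eqI) (auto simp: neg)
  define g where "g = (\<lambda>z. if z = 0 then fls_nth F 0 else f z)"
  have g1: "g has_laurent_expansion F"
    by (rule has_laurent_expansion_cong[THEN iffD1, OF _ refl F]) (auto simp: g_def eventually_at_filter)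
  then have g: "g has_fps_expansion G"
  proof -
    have "g 0 = fps_nth G 0" by (simp add: g_def G_def)
    then show ?thesis using g1 FG has_fps_expansion_to_laurent by metis
  qed
  have per_lat: "f (z + w) = f z" if "w \<in> lat \<tau>" for z w
    using periodic_lat[of f \<tau> w z] per that by blast
  \<comment> \<open>The holomorphic continuation: at every lattice point the value of
    \<open>f\<close> is replaced by the constant term of the Laurent series.\<close>
  define h where "h = (\<lambda>z. if z \<in> lat \<tau> then fls_nth F 0 else f z)"
  have in_lat: "z + w \<in> lat \<tau> \<longleftrightarrow> z \<in> lat \<tau>" if "w \<in> lat \<tau>" for z w
    using lat_add[OF _ that, of z] lat_diff[OF _ that, of "z + w"] by auto
  have h_per: "h (z + w) = h z" if "w \<in> lat \<tau>" for z w
    using in_lat[OF that] per_lat[OF that] by (simp add: h_def)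
  have "h analytic_on {z}" for z
  proof (cases "z \<in> lat \<tau>")
    case False
    have "eventually (\<lambda>w. w \<in> - lat \<tau>) (nhds z)"
      using closed_lat[OF \<tau>] False by (intro eventually_nhds_in_open) auto
    then have "eventually (\<lambda>w. f w = h w) (nhds z)" by eventually_elim (auto simp: h_def)
    then show ?thesis using an[OF False] analytic_at_cong by blast
  next
    case True
    have "eventually (\<lambda>w. w \<in> ball z (min 1 (Im \<tau>))) (nhds z)"
      using \<tau> by (intro eventually_nhds_in_open) auto
    then have "eventually (\<lambda>w. g (w - z) = h w) (nhds z)"
    proof eventually_elim
      case (elim w)
      have "w - z \<in> lat \<tau> \<longleftrightarrow> w = z"
        using lat_small[OF \<tau>, of "w - z"] elim by (auto simp: dist_norm norm_minus_commute)
      then show ?case using h_per[OF True, of "w - z"] True by (auto simp: g_def h_def)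
    qed
    moreover have "(g \<circ> (\<lambda>w. w - z)) analytic_on {z}"
      using has_fps_expansion_imp_analytic_0[OF g] by (intro analytic_on_compose) (auto intro!: analytic_intros)
    ultimately show ?thesis using analytic_at_cong[of "\<lambda>w. g (w - z)" h z z] by (simp add: o_def)
  qed
  then have ha: "h analytic_on UNIV" using analytic_on_analytic_at by blast
  then have hol: "h holomorphic_on UNIV" by (rule analytic_imp_holomorphic)
  define K where "K = (\<lambda>(s,t). of_real s + of_real t * \<tau>) ` ({0..1} \<times> {0..1::real})"
  have "compact K" unfolding K_def
    by (intro compact_continuous_image compact_Times) (auto simp: case_prod_unfold intro!: continuous_intros)
  then have "compact (h ` K)"
    using hol holomorphic_on_imp_continuous_on holomorphic_on_subset by (intro compact_continuous_image) blast+
  moreover have "range h \<subseteq> h ` K"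
  proof clarify
    fix z
    define t where "t = Im z / Im \<tau>" define s where "s = Re z - t * Re \<tau>"
    have z: "z = of_real s + of_real t * \<tau>" using \<tau> by (simp add: complex_eq_iff s_def t_def)
    define w where "w = of_int (- \<lfloor>s\<rfloor>) + of_int (- \<lfloor>t\<rfloor>) * \<tau>"
    have "w \<in> lat \<tau>" unfolding w_def by (rule latI)
    then have "h z = h (z + w)" using h_per by simp
    moreover have "z + w = of_real (frac s) + of_real (frac t) * \<tau>" by (simp add: z w_def frac_def algebra_simps)
    moreover have "\<dots> \<in> K" unfolding K_def
      using frac_ge_0 frac_lt_1[THEN less_imp_le] by (intro image_eqI[of _ _ "(frac s, frac t)"]) auto
    ultimately show "h z \<in> h ` K" by simp
  qed
  ultimately have "bounded (range h)" using compact_imp_bounded bounded_subset by blast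
  then obtain c where c: "\<And>z. h z = c"
    using Liouville_theorem[OF hol] by (auto simp: constant_on_def)
  have "eventually (\<lambda>w. w \<in> ball 0 (min 1 (Im \<tau>)) - {0}) (at 0)"
    using \<tau> by (intro eventually_at_in_open) auto
  then have "eventually (\<lambda>w. f w = c) (at 0)"
  proof eventually_elim
    case (elim w)
    then have "w \<notin> lat \<tau>" using lat_small[OF \<tau>, of w] by auto
    then show ?case using c[of w] by (simp add: h_def)
  qed
  then have "(\<lambda>_. c) has_laurent_expansion F" using has_laurent_expansion_cong[of f "\<lambda>_. c" F F] F by simp
  then have "F = fls_const c" using has_laurent_expansion_unique[OF has_laurent_expansion_const] by simp
  then show ?thesis by simp
qed

definition wp_fps :: "complex \<Rightarrow> complex fps" where "wp_fps q = Abs_fps (\<lambda>k. wp_coeff k q)"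

lemma wp_laurent:
  assumes "Im \<tau> > 0" "\<mu> \<noteq> 0"
  shows "(\<lambda>z. \<mu>^2 * wp_sum \<tau> (\<mu> * z)) has_laurent_expansion
    fls_shift 2 (fps_to_fls (Abs_fps (\<lambda>k. \<mu> ^ k * wp_coeff k (nome \<tau>))))"
proof -
  have l: "(\<lambda>z. \<mu> * z) has_fps_expansion (fps_const \<mu> * fps_X)" by (intro fps_expansion_intros)
  have "(wp_reg \<tau> \<circ> (\<lambda>z. \<mu> * z)) has_fps_expansion fps_compose (Abs_fps (\<lambda>k. wp_coeff k (nome \<tau>))) (fps_const \<mu> * fps_X)"
    by (rule has_fps_expansion_compose[OF wp_reg_fps[OF assms(1)] l]) simp
  also have "fps_compose (Abs_fps (\<lambda>k. wp_coeff k (nome \<tau>))) (fps_const \<mu> * fps_X) = Abs_fps (\<lambda>k. \<mu> ^ k * wp_coeff k (nome \<tau>))"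
    by (rule fps_ext) (simp only: fps_nth_compose_linear fps_nth_Abs_fps)
  finally have "(\<lambda>z. (wp_reg \<tau> \<circ> (\<lambda>z. \<mu> * z)) z * z powi (-2)) has_laurent_expansion
    fls_shift 2 (fps_to_fls (Abs_fps (\<lambda>k. \<mu> ^ k * wp_coeff k (nome \<tau>))))"
    by (intro has_laurent_expansion_shift' has_laurent_expansion_fps)
  then show ?thesis
    by (rule has_laurent_expansion_cong[THEN iffD1, OF _ refl, rotated])
      (use assms(2) in \<open>auto simp: eventually_at_filter wp_reg_def power_mult_distrib power_int_minus field_simps\<close>)
qed

lemma wp_laurent_1:
  assumes "Im \<tau> > 0"
  shows "wp_sum \<tau> has_laurent_expansion fls_shift 2 (fps_to_fls (wp_fps (nome \<tau>)))"
  using wp_laurent[OF assms, of 1] by (simp add: wp_fps_def)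

text \<open>At \<open>q = 0\<close> all Lambert series vanish and only the unshifted term of
  \<open>wp_sum\<close> remains: this is the degenerate case of \<open>wp_laurent\<close>, with the
  integers as lattice.\<close>

lemma csq_laurent:
  assumes "\<mu> \<noteq> 0"
  shows "(\<lambda>z. \<mu>^2 * csq (\<mu> * z)) has_laurent_expansion
    fls_shift 2 (fps_to_fls (Abs_fps (\<lambda>k. \<mu> ^ k * wp_coeff k 0)))"
proof -
  define F where "F = Abs_fps (\<lambda>k. tpi^k * ((1 - of_nat k) * of_rat (bernoulli k) / fact k))"
  define \<Phi> where "\<Phi> = (\<lambda>z. if z = 0 then 1 else z^2 * csq z)"
  have \<Phi>: "\<Phi> has_fps_expansion F" unfolding \<Phi>_def F_def by (rule csq_fps)
  have l: "(\<lambda>z. \<mu> * z) has_fps_expansion (fps_const \<mu> * fps_X)" by (intro fps_expansion_intros)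
  have "(\<Phi> \<circ> (\<lambda>z. \<mu> * z)) has_fps_expansion fps_compose F (fps_const \<mu> * fps_X)"
    by (rule has_fps_expansion_compose[OF \<Phi> l]) simp
  also have "fps_compose F (fps_const \<mu> * fps_X) = Abs_fps (\<lambda>k. \<mu> ^ k * wp_coeff k 0)"
    by (rule fps_ext) (simp only: fps_nth_compose_linear fps_nth_Abs_fps F_def wp_coeff_def rest_coeff_def lambert_def, simp)
  finally have "(\<lambda>z. (\<Phi> \<circ> (\<lambda>z. \<mu> * z)) z * z powi (-2)) has_laurent_expansion
    fls_shift 2 (fps_to_fls (Abs_fps (\<lambda>k. \<mu> ^ k * wp_coeff k 0)))"
    by (intro has_laurent_expansion_shift' has_laurent_expansion_fps)
  then show ?thesis
    by (rule has_laurent_expansion_cong[THEN iffD1, OF _ refl, rotated])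
      (use assms in \<open>auto simp: eventually_at_filter \<Phi>_def power_mult_distrib power_int_minus field_simps\<close>)
qed

text \<open>Both functions in the difference \<open>f\<close> are periodic for
  \<open>lat \<tau>\<close> with principal part \<open>z^(-2)\<close> at 0, so they differ by a
  constant. That constant sits at \<open>k = 2\<close>, hence the bound on \<open>k\<close>.\<close>

lemma wp_coeff_homogeneous:
  assumes \<tau>: "Im \<tau> > 0" "Im \<tau>' > 0" "\<mu> \<noteq> 0" and lat: "lat \<tau>' = (\<lambda>w. \<mu> * w) ` lat \<tau>" and k: "k \<ge> 3"
  shows "wp_coeff k (nome \<tau>) = \<mu> ^ k * wp_coeff k (nome \<tau>')"
proof -
  define f where "f = (\<lambda>z. wp_sum \<tau> z - \<mu>^2 * wp_sum \<tau>' (\<mu> * z))"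
  define F where "F = fls_shift 2 (fps_to_fls (wp_fps (nome \<tau>))) - fls_shift 2 (fps_to_fls (Abs_fps (\<lambda>k. \<mu> ^ k * wp_coeff k (nome \<tau>'))))"
  have F: "f has_laurent_expansion F" unfolding f_def F_def
    by (intro laurent_expansion_intros wp_laurent wp_laurent_1 \<tau>)
  have nth: "fls_nth F n = (if n < 0 then 0 else wp_coeff (nat (n+2)) (nome \<tau>) - \<mu> ^ (nat (n+2)) * wp_coeff (nat (n+2)) (nome \<tau>'))" for n
  proof -
    consider "n < -2" | "n = -2" | "n = -1" | "n \<ge> 0" by linarith
    then show ?thesis by cases (simp_all add: F_def wp_fps_def)
  qed
  have per: "f (z + w) = f z" if "w \<in> lat \<tau>" for z w
  proof -
    have "\<mu> * w \<in> lat \<tau>'" using that lat by blast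
    then show ?thesis using wp_sum_plus_lat[OF that, of z] wp_sum_plus_lat[of "\<mu> * w" \<tau>' "\<mu> * z"]
      by (simp add: f_def distrib_left)
  qed
  have "F = fls_const (fls_nth F 0)"
  proof (rule elliptic_constant[OF \<tau>(1) _ _ _ F])
    fix z show "f (z + 1) = f z" "f (z + \<tau>) = f z" using per by auto
  next
    fix z assume z: "z \<notin> lat \<tau>"
    then have "\<mu> * z \<notin> lat \<tau>'" using lat \<tau>(3) by auto
    then have "wp_sum \<tau>' analytic_on (\<lambda>z. \<mu> * z) ` {z}" using wp_sum_analytic[OF \<tau>(2)] by simp
    then have "(wp_sum \<tau>' \<circ> (\<lambda>z. \<mu> * z)) analytic_on {z}"
      by (intro analytic_on_compose) (auto intro!: analytic_intros)
    then show "f analytic_on {z}" unfolding f_def using wp_sum_analytic[OF \<tau>(1) z]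
      by (intro analytic_intros) (simp_all add: o_def)
  qed (simp add: nth)
  then have "fls_nth F (int k - 2) = 0" using k by (metis fls_const_nonzero diff_eq_eq of_nat_eq_iff of_nat_numeral add.commute add_0 eq_numeral_Suc not_less_eq_eq fls_const_nth numeral_3_eq_3 numeral_2_eq_2 order_refl)
  then show ?thesis using nth[of "int k - 2"] k by (simp split: if_splits)
qed

lemma deriv_periodic:
  assumes "\<And>z. f (z + p) = (f z :: complex)" shows "deriv f (z + p) = deriv f z"
proof -
  have "(f has_field_derivative D) (at (z + p)) \<longleftrightarrow> (f has_field_derivative D) (at z)" for D
    using DERIV_shift[of f D z p] by (simp add: assms)
  then show ?thesis by (simp add: deriv_def)
qed

text \<open>Once the constant term of \<open>wp_sum\<close> is removed, \<open>\<psi>\<close> is 1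
  up to degree 3, so the poles of \<open>P''\<close> and \<open>6 P^2\<close> cancel and Liouville
  applies to the difference. The surviving constant sits at \<open>k = 4\<close>, hence the strict
  bound.\<close>

lemma wp_coeff_rec:
  assumes \<tau>: "Im \<tau> > 0" and k: "k > 4"
  defines "q \<equiv> nome \<tau>"
  defines "\<psi> \<equiv> wp_fps q - fps_const (wp_coeff 2 q) * fps_X ^ 2"
  shows "(of_nat k - 2) * (of_nat k - 3) * wp_coeff k q = 6 * fps_nth (\<psi> * \<psi>) k"
proof -
  define c where "c = wp_coeff 2 q"
  define P where "P = (\<lambda>z. wp_sum \<tau> z - c)"
  define L where "L = fls_shift 2 (fps_to_fls \<psi>)"
  have "P has_laurent_expansion fls_shift 2 (fps_to_fls (wp_fps q)) - fls_const c"
    unfolding P_def q_def by (intro laurent_expansion_intros wp_laurent_1 \<tau>)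
  also have "fls_shift 2 (fps_to_fls (wp_fps q)) - fls_const c = L"
    unfolding L_def \<psi>_def c_def by (rule fls_eqI) (auto simp: nat_eq_iff2)
  finally have P: "P has_laurent_expansion L" .
  define f where "f = (\<lambda>z. deriv (deriv P) z - 6 * (P z)^2)"
  define F where "F = fls_deriv (fls_deriv L) - fls_const 6 * L ^ 2"
  have F: "f has_laurent_expansion F" unfolding f_def F_def by (intro laurent_expansion_intros P)
  have LL: "L ^ 2 = fls_shift 4 (fps_to_fls (\<psi> * \<psi>))"
    by (simp add: L_def power2_eq_square fls_times_both_shifted_simp fls_times_fps_to_fls)
  have nth: "fls_nth F (int k - 4) = (of_nat k - 2) * (of_nat k - 3) * fps_nth \<psi> k - 6 * fps_nth (\<psi> * \<psi>) k" for k
    unfolding F_def LL by (simp add: L_def algebra_simps)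
  have \<psi>: "fps_nth \<psi> 0 = 1" "fps_nth \<psi> 1 = 0" "fps_nth \<psi> 2 = 0" "fps_nth \<psi> 3 = 0"
    by (simp_all add: \<psi>_def wp_fps_def wp_coeff_odd)
  have z4: "{0..0::nat} = {0}" "{0..1::nat} = {0,1}" "{0..2::nat} = {0,1,2}" "{0..3::nat} = {0,1,2,3}" by auto
  have neg: "fls_nth F n = 0" if "n < 0" for n
  proof (cases "n < -4")
    case True then show ?thesis unfolding F_def LL by (simp add: L_def)
  next
    case False
    then have "n = int 0 - 4 \<or> n = int 1 - 4 \<or> n = int 2 - 4 \<or> n = int 3 - 4" using that by auto
    then show ?thesis
    proof (elim disjE)
      assume n: "n = int 0 - 4" show ?thesis unfolding n nth fps_mult_nth z4 using \<psi> by simp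
    next
      assume n: "n = int 1 - 4" show ?thesis unfolding n nth fps_mult_nth z4 using \<psi> by simp
    next
      assume n: "n = int 2 - 4" show ?thesis unfolding n nth fps_mult_nth z4 using \<psi> by simp
    next
      assume n: "n = int 3 - 4" show ?thesis unfolding n nth fps_mult_nth z4 using \<psi> by simp
    qed
  qed
  have "F = fls_const (fls_nth F 0)"
  proof (rule elliptic_constant[OF \<tau> _ _ _ F])
    have p: "P (z + 1) = P z" "P (z + \<tau>) = P z" for z
      using wp_sum_plus_lat[of 1 \<tau>] wp_sum_plus_lat[of \<tau> \<tau>] by (auto simp: P_def)
    have d: "deriv (deriv P) (z + 1) = deriv (deriv P) z" "deriv (deriv P) (z + \<tau>) = deriv (deriv P) z" for z
      by (intro deriv_periodic p)+
    show "f (z + 1) = f z" "f (z + \<tau>) = f z" for z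
      unfolding f_def p d by simp_all
  next
    fix z assume "z \<notin> lat \<tau>"
    then have "P analytic_on {z}" unfolding P_def by (intro analytic_intros wp_sum_analytic \<tau>)
    then show "f analytic_on {z}" unfolding f_def by (intro analytic_intros analytic_deriv)
  qed (rule neg)
  then have "fls_nth F (int k - 4) = 0" using k by (metis (no_types) fls_const_nth diff_gt_0_iff_gt less_irrefl of_nat_less_iff of_nat_numeral)
  moreover have "fps_nth \<psi> k = wp_coeff k q" using k by (simp add: \<psi>_def wp_fps_def)
  ultimately show ?thesis unfolding nth by simp
qed

section \<open>Recovering a lattice from its Laurent coefficients\<close>

lemma pole_sets_subset:
  fixes f g :: "complex \<Rightarrow> complex"
  assumes A: "closed A" "countable A" "\<And>z. z \<notin> A \<Longrightarrow> f analytic_on {z}" "\<And>z. z \<in> A \<Longrightarrow> is_pole f z"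
    and B: "closed B" "countable B" "\<And>z. z \<notin> B \<Longrightarrow> g analytic_on {z}"
    and eq: "eventually (\<lambda>z. f z = g z + c) (at 0)"
  shows "A \<subseteq> B"
proof
  fix a assume a: "a \<in> A"
  show "a \<in> B"
  proof (rule ccontr)
    assume aB: "a \<notin> B"
    \<comment> \<open>A closed countable set does not disconnect the plane, so the relation near 0
      continues to all of \<open>S\<close>. Approaching \<open>a\<close> inside \<open>S\<close>,
      \<open>f\<close> tends to infinity while \<open>g + c\<close> stays bounded.\<close>
    define S where "S = - (A \<union> B)"
    have opS: "open S" unfolding S_def using A(1) B(1) by auto
    have cnt: "countable (A \<union> B)" using A(2) B(2) by simp
    have conS: "connected S"
      using connected_open_diff_countable[OF _ open_UNIV connected_UNIV cnt] unfolding S_def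
      by (simp add: Compl_eq_Diff_UNIV)
    have lim: "z islimpt S" for z
      unfolding islimpt_approachable
    proof (intro allI impI)
      fix e :: real assume e: "e > 0"
      have "\<not> ball z e \<subseteq> insert z (A \<union> B)"
      proof
        assume "ball z e \<subseteq> insert z (A \<union> B)"
        from countable_subset[OF this] cnt have "countable (ball z e)" by simp
        then show False using uncountable_ball[OF e, of z] by blast
      qed
      then obtain x where "x \<in> ball z e" "x \<notin> insert z (A \<union> B)" by blast
      then have "x \<in> S" "x \<noteq> z" "dist x z < e" by (simp_all add: S_def dist_commute)
      then show "\<exists>x'\<in>S. x' \<noteq> z \<and> dist x' z < e" by blast
    qed
    have fh: "f holomorphic_on S" and gh: "g holomorphic_on S"
      by (rule analytic_imp_holomorphic, rule analytic_on_analytic_at[THEN iffD2], rule ballI,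
          rule A(3) B(3), simp add: S_def)+
    obtain U where U: "open U" "0 \<in> U" "\<And>z. z \<in> U \<Longrightarrow> z \<noteq> 0 \<Longrightarrow> f z = g z + c"
      using eq unfolding eventually_at_topological by blast
    have ne: "S \<inter> (U - {0}) \<noteq> {}"
      using lim[of 0] U(1,2) unfolding islimpt_def by fast
    have fg: "f z = g z + c" if "z \<in> S" for z
    proof (rule analytic_continuation_open[of "S \<inter> (U - {0})" S f "\<lambda>z. g z + c"])
      show "open (S \<inter> (U - {0}))" using opS U(1) by auto
    qed (use opS conS ne U that fh gh in \<open>auto intro!: holomorphic_intros\<close>)
    have nt: "at a within S \<noteq> bot" using lim[of a] trivial_limit_within by blast
    have "filterlim f at_infinity (at a within S)"
      using A(4)[OF a] unfolding is_pole_def by (rule filterlim_mono) (auto intro: at_le)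
    moreover have "(f \<longlongrightarrow> g a + c) (at a within S)"
    proof -
      have "isCont g a" using analytic_at_imp_isCont[OF B(3)[OF aB]] .
      then have "((\<lambda>z. g z + c) \<longlongrightarrow> g a + c) (at a within S)"
        by (intro tendsto_intros) (auto simp: isCont_def intro: tendsto_within_subset)
      moreover have "eventually (\<lambda>z. g z + c = f z) (at a within S)"
        using fg by (auto simp: eventually_at_filter)
      ultimately show ?thesis by (rule Lim_transform_eventually)
    qed
    ultimately show False using nt not_tendsto_and_filterlim_at_infinity by blast
  qed
qed

lemma wp_sum_pole:
  assumes \<tau>: "Im \<tau> > 0" and w: "w \<in> lat \<tau>" shows "is_pole (wp_sum \<tau>) w"
proof (rule has_laurent_expansion_imp_is_pole)
  have "(\<lambda>x. wp_sum \<tau> (w + x)) = wp_sum \<tau>"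
    using wp_sum_plus_lat[OF w] by (auto simp: add.commute)
  then show "(\<lambda>x. wp_sum \<tau> (w + x)) has_laurent_expansion fls_shift 2 (fps_to_fls (wp_fps (nome \<tau>)))"
    using wp_laurent_1[OF \<tau>] by simp
  have "fls_subdegree (fls_shift 2 (fps_to_fls (wp_fps (nome \<tau>)))) \<le> -2"
    by (rule fls_subdegree_leI) (simp add: wp_fps_def)
  then show "fls_subdegree (fls_shift 2 (fps_to_fls (wp_fps (nome \<tau>)))) < 0" by simp
qed

lemma eventually_eq_of_coeffs:
  assumes f: "f has_laurent_expansion fls_shift 2 (fps_to_fls (Abs_fps u))"
    and g: "g has_laurent_expansion fls_shift 2 (fps_to_fls (Abs_fps v))"
    and uv: "\<And>k. k \<noteq> 2 \<Longrightarrow> u k = v k"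
  shows "eventually (\<lambda>z. f z = g z + (u 2 - v 2)) (at 0)"
proof -
  have "(\<lambda>z. f z - g z) has_laurent_expansion fls_shift 2 (fps_to_fls (Abs_fps u)) - fls_shift 2 (fps_to_fls (Abs_fps v))"
    by (intro laurent_expansion_intros f g)
  also have "fls_shift 2 (fps_to_fls (Abs_fps u)) - fls_shift 2 (fps_to_fls (Abs_fps v)) = fls_const (u 2 - v 2)"
    using uv by (intro fls_eqI) (auto simp: nat_eq_iff2)
  finally have "(\<lambda>z. f z - g z) has_laurent_expansion fls_const (u 2 - v 2)" .
  then have "eventually (\<lambda>z. eval_fls (fls_const (u 2 - v 2)) z = f z - g z) (at 0)"
    unfolding has_laurent_expansion_def by simp
  then show ?thesis by eventually_elim (auto simp: algebra_simps)
qed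

lemma closed_countable_scale:
  assumes "\<mu> \<noteq> 0" "closed A" "countable A"
  shows "closed ((\<lambda>w. w / \<mu>) ` A :: complex set)" "countable ((\<lambda>w. w / \<mu>) ` A)"
proof -
  have "(\<lambda>w. w / \<mu>) ` A = (\<lambda>z. \<mu> * z) -` A" using assms(1) by (auto simp: image_iff intro!: bexI[of _ "\<mu> * _"])
  then show "closed ((\<lambda>w. w / \<mu>) ` A :: complex set)"
    using continuous_closed_vimage[OF assms(2), of "\<lambda>z. \<mu> * z"] by (simp add: continuous_intros)
qed (use assms in simp)

lemma analytic_scale:
  assumes "f analytic_on {\<mu> * z}" shows "(\<lambda>z. \<mu>^2 * f (\<mu> * z)) analytic_on {z}"
proof -
  have "(f \<circ> (\<lambda>z. \<mu> * z)) analytic_on {z}"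
    using assms by (intro analytic_on_compose) (auto intro!: analytic_intros)
  then show ?thesis by (intro analytic_intros) (simp add: o_def)
qed

lemma lattice_rigid_subset:
  assumes "Im \<tau> > 0" "Im \<tau>' > 0" "\<mu> \<noteq> 0"
    and c: "\<And>k. k \<ge> 3 \<Longrightarrow> wp_coeff k (nome \<tau>) = \<mu> ^ k * wp_coeff k (nome \<tau>')"
  shows "lat \<tau> \<subseteq> (\<lambda>w. w / \<mu>) ` lat \<tau>'"
proof (rule pole_sets_subset)
  have "wp_coeff k (nome \<tau>) = \<mu> ^ k * wp_coeff k (nome \<tau>')" if "k \<noteq> 2" for k
  proof -
    have "k = 0 \<or> k = Suc 0 \<or> k \<ge> 3" using that by presburger
    then show ?thesis using c by auto
  qed
  then show "eventually (\<lambda>z. wp_sum \<tau> z = \<mu>^2 * wp_sum \<tau>' (\<mu> * z) + (wp_coeff 2 (nome \<tau>) - \<mu> ^ 2 * wp_coeff 2 (nome \<tau>'))) (at 0)"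
    using wp_laurent_1[OF assms(1)] wp_laurent[OF assms(2,3)] unfolding wp_fps_def
    by (intro eventually_eq_of_coeffs)
  fix z assume "z \<notin> (\<lambda>w. w / \<mu>) ` lat \<tau>'"
  then have "\<mu> * z \<notin> lat \<tau>'" using assms(3) by (auto simp: image_iff)
  then show "(\<lambda>z. \<mu>^2 * wp_sum \<tau>' (\<mu> * z)) analytic_on {z}"
    by (intro analytic_scale wp_sum_analytic assms)
qed (use assms closed_countable_scale[of \<mu> "lat \<tau>'"] in \<open>auto intro: closed_lat countable_lat wp_sum_pole wp_sum_analytic\<close>)

text \<open>The second inclusion is the first one with \<open>\<tau>\<close> and
  \<open>\<tau>'\<close> exchanged and \<open>\<mu>\<close> inverted.\<close>

lemma lattice_rigid:
  assumes "Im \<tau> > 0" "Im \<tau>' > 0" "\<mu> \<noteq> 0"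
    and c: "\<And>k. k \<ge> 3 \<Longrightarrow> wp_coeff k (nome \<tau>) = \<mu> ^ k * wp_coeff k (nome \<tau>')"
  shows "lat \<tau>' = (\<lambda>w. \<mu> * w) ` lat \<tau>"
proof
  show "(\<lambda>w. \<mu> * w) ` lat \<tau> \<subseteq> lat \<tau>'"
    using lattice_rigid_subset[OF assms] assms(3) by auto
  have "lat \<tau>' \<subseteq> (\<lambda>w. w / inverse \<mu>) ` lat \<tau>"
    using assms by (intro lattice_rigid_subset) (auto simp: power_inverse field_simps)
  then show "lat \<tau>' \<subseteq> (\<lambda>w. \<mu> * w) ` lat \<tau>" by (simp add: divide_inverse mult.commute)
qed

text \<open>
  The functions \<open>z\<^sup>-\<^sup>2\<close> (for \<open>\<mu> = 0\<close>) and \<open>\<mu>\<^sup>2 csq (\<mu> z)\<close> have their poles on a line, unlike \<open>wp_sum \<tau>\<close>.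
\<close>
lemma not_degenerate:
  assumes \<tau>: "Im \<tau> > 0"
    and c: "\<And>k. k \<ge> 3 \<Longrightarrow> wp_coeff k (nome \<tau>) = \<mu> ^ k * wp_coeff k 0"
  shows False
proof -
  have c': "wp_coeff k (nome \<tau>) = \<mu> ^ k * wp_coeff k 0" if "k \<noteq> 2" for k
  proof -
    have "k = 0 \<or> k = Suc 0 \<or> k \<ge> 3" using that by presburger
    then show ?thesis using c by auto
  qed
  define B :: "complex set" where "B = (if \<mu> = 0 then {0} else (\<lambda>w. w / \<mu>) ` \<int>)"
  define g where "g = (if \<mu> = 0 then (\<lambda>z. z powi (-2)) else (\<lambda>z. \<mu>^2 * csq (\<mu> * z)))"
  have g: "g has_laurent_expansion fls_shift 2 (fps_to_fls (Abs_fps (\<lambda>k. \<mu> ^ k * wp_coeff k 0)))"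
  proof (cases "\<mu> = 0")
    case True
    have "Abs_fps (\<lambda>k. \<mu> ^ k * wp_coeff k 0) = 1" using True by (intro fps_ext) auto
    moreover have "(\<lambda>z::complex. 1 * z powi (-2)) has_laurent_expansion fls_shift 2 1"
      by (intro has_laurent_expansion_shift' has_laurent_expansion_1)
    ultimately show ?thesis using True by (simp add: g_def)
  qed (simp add: g_def csq_laurent)
  have "lat \<tau> \<subseteq> B"
  proof (rule pole_sets_subset)
    show "eventually (\<lambda>z. wp_sum \<tau> z = g z + (wp_coeff 2 (nome \<tau>) - \<mu> ^ 2 * wp_coeff 2 0)) (at 0)"
      using wp_laurent_1[OF \<tau>] g c' unfolding wp_fps_def by (intro eventually_eq_of_coeffs)
    have cl: "closed (\<int> :: complex set)" by simp
    have ct: "countable (\<int> :: complex set)" by (simp add: Ints_def)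
    show "closed B" "countable B" using closed_countable_scale[OF _ cl ct] ct by (auto simp: B_def)
    fix z assume z: "z \<notin> B"
    show "g analytic_on {z}"
    proof (cases "\<mu> = 0")
      case True then show ?thesis using z by (auto simp: g_def B_def intro!: analytic_intros)
    next
      case False
      then have "\<mu> * z \<notin> \<int>" using z by (auto simp: B_def image_iff)
      then show ?thesis using False by (simp add: g_def analytic_scale csq_analytic)
    qed
  qed (use \<tau> in \<open>auto intro: closed_lat countable_lat wp_sum_pole wp_sum_analytic\<close>)
  then have 1: "1 \<in> B" "\<tau> \<in> B" by auto
  then have "\<mu> \<noteq> 0" by (auto simp: B_def)
  then obtain m n :: int where "1 = of_int m / \<mu>" "\<tau> = of_int n / \<mu>" using 1 by (auto simp: B_def Ints_def)
  then have "\<mu> = of_int m" "m \<noteq> 0" using \<open>\<mu> \<noteq> 0\<close> by auto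
  then have "\<tau> = of_real (of_int n / of_int m)" using \<open>\<tau> = of_int n / \<mu>\<close> by simp
  then show False using \<tau> by (metis Im_complex_of_real less_irrefl)
qed

section \<open>The normalised coefficients\<close>

lemma lambert_0 [simp]: "lambert r 0 = 0" by (simp add: lambert_def)

lemma lambert_sums:
  assumes "norm q < 1"
  shows "(\<lambda>n. (if n = 0 then 0 else of_nat (divisor_sigma r n)) * q ^ n) sums lambert r q"
  using lambert_has_sum(2)[OF assms, of r]
  by (subst sums_Suc_iff[of "\<lambda>n. (if n = 0 then 0 else of_nat (divisor_sigma r n)) * q ^ n", symmetric, simplified]) simp

lemma lambert_holomorphic: "lambert r holomorphic_on ball 0 1"
  by (rule power_series_holomorphic[of 0 1 "\<lambda>n. if n = 0 then 0 else of_nat (divisor_sigma r n)"])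
    (use lambert_sums in \<open>simp add: dist_norm\<close>)

lemma deriv_lambert_0: "deriv (lambert r) 0 = 1"
proof -
  define F where "F = Abs_fps (\<lambda>n. if n = 0 then 0 else of_nat (divisor_sigma r n) :: complex)"
  have "lambert r has_fps_expansion F"
    by (rule has_fps_expansionI, rule eventually_nhds_in_open[of "ball 0 1", THEN eventually_mono])
      (use lambert_sums in \<open>simp_all add: F_def\<close>)
  then have "deriv (lambert r) has_fps_expansion fps_deriv F" by (rule has_fps_expansion_deriv)
  then have "deriv (lambert r) 0 = fps_nth (fps_deriv F) 0" by (rule has_fps_expansion_imp_0_eq_fps_nth_0)
  then show ?thesis by (simp add: F_def divisor_sigma_def)
qed

text \<open>The Eisenstein series as a function of the nome; it is holomorphic on the whole disc, so
  that \<open>q = 0\<close> represents the cusp.\<close>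

definition eis_disc :: "nat \<Rightarrow> complex \<Rightarrow> complex" where
  "eis_disc k q = 1 - of_rat (2 * of_nat k / bernoulli k) * lambert (k - 1) q"

lemma eisenstein_eq: "eisenstein k z = eis_disc k (exp (tpi * z))"
proof -
  have e: "exp (tpi * of_nat (Suc n) * z) = exp (tpi * z) ^ Suc n" for n
    by (simp only: exp_of_nat_mult[symmetric]) (simp only: mult_ac)
  show ?thesis unfolding eisenstein_def eis_disc_def lambert_def e ..
qed

lemma eis_disc_0 [simp]: "eis_disc k 0 = 1" by (simp add: eis_disc_def)

lemma eis_disc_holomorphic: "eis_disc k holomorphic_on ball 0 1"
  unfolding eis_disc_def[abs_def] by (intro holomorphic_intros lambert_holomorphic)

lemma deriv_eis_disc_0: "deriv (eis_disc k) 0 = - of_rat (2 * of_nat k / bernoulli k)"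
proof -
  have "lambert (k-1) field_differentiable at 0"
    using lambert_holomorphic holomorphic_on_imp_differentiable_at[of _ "ball 0 1" 0] by auto
  then have "(lambert (k-1) has_field_derivative 1) (at 0)"
    using DERIV_deriv_iff_field_differentiable deriv_lambert_0 by metis
  then have "(eis_disc k has_field_derivative (0 - of_rat (2 * of_nat k / bernoulli k) * 1)) (at 0)"
    unfolding eis_disc_def[abs_def] by (intro DERIV_diff DERIV_const DERIV_cmult)
  then show ?thesis by (simp add: DERIV_imp_deriv)
qed

lemma bernoulli_values: "bernoulli 4 = -1/30" "bernoulli 6 = 1/42"
proof -
  have b1: "bernoulli 1 = -1/2" using bernoulli_rec[of 2] by (simp add: eval_nat_numeral lessThan_Suc bernoulli_0)
  have b2: "bernoulli 2 = 1/6" using bernoulli_rec[of 3] b1 by (simp add: eval_nat_numeral lessThan_Suc bernoulli_0)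
  have b3: "bernoulli 3 = 0" by (simp add: bernoulli_odd)
  show b4: "bernoulli 4 = -1/30" using bernoulli_rec[of 5] b1 b2 b3 by (simp add: eval_nat_numeral lessThan_Suc bernoulli_0)
  have b5: "bernoulli 5 = 0" by (simp add: bernoulli_odd)
  show "bernoulli 6 = 1/42" using bernoulli_rec[of 7] b1 b2 b3 b4 b5 by (simp add: eval_nat_numeral lessThan_Suc bernoulli_0)
qed

text \<open>The factor \<open>4\<^sup>m\<close> makes the coefficients 2-integral as polynomials in \<open>E\<^sub>4\<close> and \<open>2 E\<^sub>6\<close>.\<close>
definition wp_norm :: "complex \<Rightarrow> nat \<Rightarrow> complex" where
  "wp_norm q m = 4 ^ m * wp_coeff (2 * m) q / tpi ^ (2 * m)"

lemma wp_norm_eq: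
  assumes "m \<ge> 1"
  shows "wp_norm q m = 4 ^ m * ((1 - 2 * of_nat m) * of_rat (bernoulli (2*m)) / fact (2*m) + 2 * lambert (2*m-1) q / fact (2*m-2))"
proof -
  have t: "tpi ^ n \<noteq> 0" for n by simp
  have "rest_coeff (2*m-2) q = tpi^(2*m) * (2 * lambert (2*m-1) q / fact (2*m-2))"
  proof -
    obtain i where i: "m = Suc i" using assms by (cases m) auto
    define T where "T = tpi"
    show ?thesis unfolding rest_coeff_def T_def[symmetric] by (simp add: i power_add power2_eq_square)
  qed
  moreover have "(2 * m < 2) = False" using assms by simp
  ultimately have "wp_coeff (2*m) q = tpi^(2*m) * ((1 - 2 * of_nat m) * of_rat (bernoulli (2*m)) / fact (2*m) + 2 * lambert (2*m-1) q / fact (2*m-2))"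
    unfolding wp_coeff_def by (simp only: if_False distrib_left of_nat_mult of_nat_numeral)
  then show ?thesis unfolding wp_norm_def using t[of "2*m"] by (simp del: power_mult_distrib)
qed

text \<open>By \<open>(2m)! = 2m (2m - 1) (2m - 2)!\<close>, taking out the constant term leaves
  \<open>-4m / B_2m\<close> in front of the Lambert series. For \<open>2m = 12n\<close> the
  hypothesis on the Bernoulli number is verified in \<open>eisenstein_factor\<close>.\<close>

lemma wp_norm_eisenstein:
  assumes "m \<ge> 1" "bernoulli (2*m) \<noteq> 0"
  shows "wp_norm q m = wp_norm 0 m * eis_disc (2*m) q"
proof -
  define B :: complex where "B = of_rat (bernoulli (2*m))"
  have B: "B \<noteq> 0" using assms(2) by (simp add: B_def)
  have "of_rat (2 * of_nat (2*m) / bernoulli (2*m)) = 4 * of_nat m / B"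
    by (simp add: B_def of_rat_divide of_rat_mult)
  note r = this
  obtain i where i: "m = Suc i" using assms(1) by (cases m) auto
  define N :: complex where "N = of_nat m"
  define f :: complex where "f = fact (2*m-2)"
  define L where "L = lambert (2*m-1) q"
  have F: "fact (2*m) = (2 * N) * ((2 * N - 1) * f)"
    unfolding i N_def f_def by (simp add: algebra_simps)
  have "fact (2*m) \<noteq> (0::complex)" by simp
  then have nz: "N \<noteq> 0" "2 * N - 1 \<noteq> 0" "f \<noteq> 0" unfolding F by auto
  define X where "X = (1 - 2 * N) * B / fact (2*m)"
  have e: "2 * L / f = - X * (4 * N / B * L)"
    unfolding X_def F using nz B by (simp add: field_simps)
  show ?thesis
    unfolding wp_norm_eq[OF assms(1)] eis_disc_def B_def[symmetric] r N_def[symmetric] L_def[symmetric] f_def[symmetric] X_def[symmetric] e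
    by (simp add: algebra_simps)
qed

lemma wp_norm_2: "wp_norm q 2 = eis_disc 4 q / 15" and wp_norm_3: "wp_norm q 3 = - 2 * eis_disc 6 q / 189"
proof -
  have "wp_norm 0 2 = 1/15" "wp_norm 0 3 = -2/189"
    by (simp_all add: wp_norm_eq bernoulli_values fact_numeral of_rat_divide of_rat_minus)
  then show "wp_norm q 2 = eis_disc 4 q / 15" "wp_norm q 3 = - 2 * eis_disc 6 q / 189"
    using wp_norm_eisenstein[of 2 q] wp_norm_eisenstein[of 3 q] bernoulli_values by simp_all
qed

lemma wp_norm_holomorphic: "m \<ge> 1 \<Longrightarrow> (\<lambda>q. wp_norm q m) holomorphic_on ball 0 1"
  unfolding wp_norm_eq by (intro holomorphic_intros lambert_holomorphic) auto

lemma wp_coeff_even_rec: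
  assumes \<tau>: "Im \<tau> > 0" and m: "m \<ge> 4"
  defines "c \<equiv> \<lambda>i. wp_coeff (2 * i) (nome \<tau>)"
  shows "of_int ((2 * int m + 1) * (int m - 3)) * c m = 3 * (\<Sum>i=2..m-2. c i * c (m - i))"
proof -
  define q where "q = nome \<tau>"
  define \<psi> where "\<psi> = wp_fps q - fps_const (wp_coeff 2 q) * fps_X ^ 2"
  have \<psi>0: "fps_nth \<psi> 0 = 1" "fps_nth \<psi> 2 = 0" by (simp_all add: \<psi>_def wp_fps_def)
  have \<psi>o: "fps_nth \<psi> i = 0" if "odd i" for i using that by (auto simp: \<psi>_def wp_fps_def wp_coeff_odd)
  have \<psi>e: "fps_nth \<psi> (2*i) = c i" if "i \<noteq> 1" for i using that by (simp add: \<psi>_def wp_fps_def c_def q_def)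
  have "fps_nth (\<psi> * \<psi>) (2*m) = (\<Sum>i\<in>{0..2*m}. fps_nth \<psi> i * fps_nth \<psi> (2*m-i))" by (rule fps_mult_nth)
  also have "\<dots> = (\<Sum>i\<in>(\<lambda>i. 2*i) ` {0..m}. fps_nth \<psi> i * fps_nth \<psi> (2*m-i))"
  proof (rule sum.mono_neutral_right)
    show "\<forall>i\<in>{0..2*m} - (\<lambda>i. 2*i) ` {0..m}. fps_nth \<psi> i * fps_nth \<psi> (2*m-i) = 0"
    proof
      fix i assume i: "i \<in> {0..2*m} - (\<lambda>i. 2*i) ` {0..m}"
      have "odd i"
      proof
        assume "even i" then obtain j where "i = 2 * j" by blast
        then show False using i by auto
      qed
      then show "fps_nth \<psi> i * fps_nth \<psi> (2*m-i) = 0" by (simp add: \<psi>o)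
    qed
  qed auto
  also have "\<dots> = (\<Sum>i\<in>{0..m}. fps_nth \<psi> (2*i) * fps_nth \<psi> (2*(m-i)))"
    by (subst sum.reindex) (auto simp: inj_on_def diff_mult_distrib2)
  \<comment> \<open>The end terms give \<open>2 c m\<close>, and their neighbours vanish since the
    coefficient of degree 2 was removed. Moving \<open>12 c m\<close> to the left uses
    \<open>(2m - 2) (2m - 3) - 12 = 2 (2m + 1) (m - 3)\<close>.\<close>
  also have "{0..m} = {0,1,m-1,m} \<union> {2..m-2}" using m by auto
  also have "(\<Sum>i\<in>{0,1,m-1,m} \<union> {2..m-2}. fps_nth \<psi> (2*i) * fps_nth \<psi> (2*(m-i))) = 
     (\<Sum>i\<in>{0,1,m-1,m}. fps_nth \<psi> (2*i) * fps_nth \<psi> (2*(m-i))) + (\<Sum>i=2..m-2. c i * c (m-i))"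
  proof (subst sum.union_disjoint)
    show "{0, 1, m - 1, m} \<inter> {2..m - 2} = {}" using m by auto
    have "(\<Sum>i=2..m-2. fps_nth \<psi> (2*i) * fps_nth \<psi> (2*(m-i))) = (\<Sum>i=2..m-2. c i * c (m-i))"
      using m by (intro sum.cong arg_cong2[of _ _ _ _ "(*)"] \<psi>e) auto
    then show "(\<Sum>i\<in>{0, 1, m - 1, m}. fps_nth \<psi> (2*i) * fps_nth \<psi> (2*(m-i))) + (\<Sum>i=2..m-2. fps_nth \<psi> (2*i) * fps_nth \<psi> (2*(m-i))) =
      (\<Sum>i\<in>{0,1,m-1,m}. fps_nth \<psi> (2*i) * fps_nth \<psi> (2*(m-i))) + (\<Sum>i=2..m-2. c i * c (m-i))" by simp
  qed auto
  also have "(\<Sum>i\<in>{0,1,m-1,m}. fps_nth \<psi> (2*i) * fps_nth \<psi> (2*(m-i))) = 2 * c m"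
  proof -
    have "m - 1 \<noteq> m" "m - 1 \<noteq> 1" "m - 1 \<noteq> 0" "m \<noteq> 1" "m \<noteq> 0" "m - (m - 1) = 1" using m by auto
    then show ?thesis using \<psi>0 \<psi>e[of m] by simp
  qed
  finally have "(of_nat (2*m) - 2) * (of_nat (2*m) - 3) * c m = 6 * (2 * c m + (\<Sum>i=2..m-2. c i * c (m-i)))"
    using wp_coeff_rec[OF \<tau>, of "2*m"] m unfolding \<psi>_def q_def c_def by simp
  moreover have "(of_int ((2 * int m + 1) * (int m - 3)) :: complex) = (2 * of_nat m + 1) * (of_nat m - 3)" by simp
  ultimately have "2 * (of_int ((2 * int m + 1) * (int m - 3)) * c m) = 2 * (3 * (\<Sum>i=2..m-2. c i * c (m - i)))"
    by (simp only:) (simp add: algebra_simps)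
  then show ?thesis by (simp only: mult_cancel_left) simp
qed

text \<open>The scaling factor is an \<open>m\<close>-th power, so the recurrence of
  \<open>wp_coeff\<close> carries over. No \<open>\<tau>\<close> has nome 0; there the recurrence
  follows by continuity, and it is needed for the values at the cusp.\<close>

lemma wp_rec_wp_norm:
  assumes "norm q < 1" shows "wp_rec (wp_norm q)"
proof -
  have nz: "wp_rec (wp_norm q)" if q: "norm q < 1" "q \<noteq> 0" for q
  proof -
    obtain \<tau> where \<tau>: "Im \<tau> > 0" "q = nome \<tau>" using upper_half_exp_ex[OF q] .
    show ?thesis unfolding wp_rec_def
    proof (intro allI impI)
      fix m :: nat assume m: "m \<ge> 4"
      have p: "4 ^ i * 4 ^ (m - i) = (4 :: complex) ^ m" "tpi ^ (2*i) * tpi ^ (2*(m-i)) = tpi ^ (2*m)" if "i \<in> {2..m-2}" for i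
      proof -
        have "i + (m - i) = m" "2 * i + 2 * (m - i) = 2 * m" using that m by auto
        then show "4 ^ i * 4 ^ (m - i) = (4 :: complex) ^ m" "tpi ^ (2*i) * tpi ^ (2*(m-i)) = tpi ^ (2*m)"
          by (metis power_add)+
      qed
      have "(\<Sum>i=2..m-2. wp_norm q i * wp_norm q (m - i)) = (\<Sum>i=2..m-2. 4 ^ m / tpi ^ (2*m) * (wp_coeff (2*i) q * wp_coeff (2*(m-i)) q))"
      proof (rule sum.cong)
        fix i assume "i \<in> {2..m-2}"
        then show "wp_norm q i * wp_norm q (m - i) = 4 ^ m / tpi ^ (2*m) * (wp_coeff (2*i) q * wp_coeff (2*(m-i)) q)"
        proof -
          have gen: "a * x / s * (b * y / t) = a * b / (s * t) * (x * y)" for a b x y s t :: complex by simp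
          show ?thesis unfolding wp_norm_def gen p[OF \<open>i \<in> {2..m-2}\<close>] ..
        qed
      qed simp
      also have "\<dots> = 4 ^ m / tpi ^ (2*m) * (\<Sum>i=2..m-2. wp_coeff (2*i) q * wp_coeff (2*(m-i)) q)"
        by (simp only: sum_distrib_left)
      finally show "of_int ((2 * int m + 1) * (int m - 3)) * wp_norm q m = 3 * (\<Sum>i=2..m-2. wp_norm q i * wp_norm q (m - i))"
        using wp_coeff_even_rec[OF \<tau>(1) m] unfolding \<tau>(2)[symmetric]
        by (simp only: wp_norm_def) (simp only: times_divide_eq_right times_divide_eq_left mult.assoc mult.left_commute[of _ "4^m"])
    qed
  qed
  show ?thesis
  proof (cases "q = 0")
    case False then show ?thesis using nz assms by blast
  next
    case True
    show ?thesis unfolding wp_rec_def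
    proof (intro allI impI)
      fix m :: nat assume m: "m \<ge> 4"
      define D where "D = (\<lambda>q. of_int ((2 * int m + 1) * (int m - 3)) * wp_norm q m - 3 * (\<Sum>i=2..m-2. wp_norm q i * wp_norm q (m - i)))"
      have "D holomorphic_on ball 0 1" unfolding D_def using m by (intro holomorphic_intros wp_norm_holomorphic) auto
      then have "isCont D 0" using holomorphic_on_imp_continuous_on continuous_on_eq_continuous_at[of "ball 0 1"] by fastforce
      then have "(D \<longlongrightarrow> D 0) (at 0)" by (simp add: isCont_def)
      moreover have "eventually (\<lambda>q. q \<in> ball 0 1 - {0}) (at (0::complex))" by (intro eventually_at_in_open) auto
      then have "eventually (\<lambda>q. D q = 0) (at 0)"
      proof eventually_elim
        case (elim q)
        then show ?case using nz[of q] m unfolding D_def wp_rec_def by simp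
      qed
      then have "(D \<longlongrightarrow> 0) (at 0)" by (rule tendsto_eventually)
      ultimately have "D 0 = 0" using tendsto_unique[OF at_neq_bot] by blast
      then show "of_int ((2 * int m + 1) * (int m - 3)) * wp_norm q m = 3 * (\<Sum>i=2..m-2. wp_norm q i * wp_norm q (m - i))"
        using True by (simp add: D_def)
    qed
  qed
qed

lemma wp_rec_unique:
  fixes g h :: "nat \<Rightarrow> 'a :: {idom, ring_char_0}"
  assumes "wp_rec g" "wp_rec h" "g 2 = h 2" "g 3 = h 3" "m \<ge> 2"
  shows "g m = h m"
  using assms(5)
proof (induction m rule: less_induct)
  case (less m)
  consider "m = 2" | "m = 3" | "m \<ge> 4" using less.prems by linarith
  then show ?case
  proof cases
    case 3
    have "of_int ((2 * int m + 1) * (int m - 3)) * g m = 3 * (\<Sum>i=2..m-2. g i * g (m - i))"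
      using assms(1) 3 unfolding wp_rec_def by blast
    also have "(\<Sum>i=2..m-2. g i * g (m - i)) = (\<Sum>i=2..m-2. h i * h (m - i))"
      using 3 by (intro sum.cong arg_cong2[of _ _ _ _ "(*)"] less.IH) auto
    also have "3 * \<dots> = of_int ((2 * int m + 1) * (int m - 3)) * h m"
      using assms(2) 3 unfolding wp_rec_def by simp
    finally have "of_int ((2 * int m + 1) * (int m - 3)) * (g m - h m) = 0" by (simp only: right_diff_distrib diff_self)
    moreover have "of_int ((2 * int m + 1) * (int m - 3)) \<noteq> (0 :: 'a)" unfolding of_int_eq_0_iff using 3 by simp
    ultimately show ?thesis by (simp only: mult_eq_0_iff) simp
  qed (use assms in auto)
qed

lemma wp_rec_scale:
  fixes h :: "nat \<Rightarrow> 'a :: comm_ring_1"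
  assumes "wp_rec h" shows "wp_rec (\<lambda>m. s ^ m * h m)"
  unfolding wp_rec_def
proof (intro allI impI)
  fix m :: nat assume m: "m \<ge> 4"
  have "(\<Sum>i=2..m-2. s ^ i * h i * (s ^ (m - i) * h (m - i))) = (\<Sum>i=2..m-2. s ^ m * (h i * h (m - i)))"
  proof (rule sum.cong)
    fix i assume "i \<in> {2..m-2}"
    then have "i + (m - i) = m" using m by auto
    then have "s ^ i * s ^ (m - i) = s ^ m" by (metis power_add)
    then show "s ^ i * h i * (s ^ (m - i) * h (m - i)) = s ^ m * (h i * h (m - i))" by (metis mult.assoc mult.left_commute)
  qed simp
  also have "\<dots> = s ^ m * (\<Sum>i=2..m-2. h i * h (m - i))" by (simp add: sum_distrib_left)
  finally have e: "(\<Sum>i=2..m-2. s ^ i * h i * (s ^ (m - i) * h (m - i))) = s ^ m * (\<Sum>i=2..m-2. h i * h (m - i))" .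
  show "of_int ((2 * int m + 1) * (int m - 3)) * (s ^ m * h m) = 3 * (\<Sum>i=2..m-2. s ^ i * h i * (s ^ (m - i) * h (m - i)))"
  proof -
    have "of_int ((2 * int m + 1) * (int m - 3)) * (s ^ m * h m) = s ^ m * (of_int ((2 * int m + 1) * (int m - 3)) * h m)"
      by (simp only: mult_ac)
    also have "\<dots> = s ^ m * (3 * (\<Sum>i=2..m-2. h i * h (m - i)))"
      using assms m unfolding wp_rec_def by simp
    finally show ?thesis unfolding e by (simp only: mult.left_commute)
  qed
qed

section \<open>Lattices up to homothety\<close>

abbreviation cpoly :: "rat poly \<Rightarrow> complex poly" where "cpoly \<equiv> map_poly of_rat"

lemma coeff_cpoly [simp]: "coeff (cpoly p) i = of_rat (coeff p i)"
  by (simp add: coeff_map_poly)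

lemma cpoly_add: "cpoly (p + q) = cpoly p + cpoly q"
  by (rule poly_eqI) (simp add: of_rat_add)

lemma cpoly_mult: "cpoly (p * q) = cpoly p * cpoly q"
  by (rule poly_eqI) (simp add: coeff_mult of_rat_sum of_rat_mult)

lemma cpoly_smult: "cpoly (smult c p) = smult (of_rat c) (cpoly p)"
  by (rule poly_eqI) (simp add: of_rat_mult)

lemma cpoly_sum: "cpoly (sum f S) = (\<Sum>x\<in>S. cpoly (f x))"
  by (induction S rule: infinite_finite_induct) (auto simp: cpoly_add)

lemma cpoly_pCons: "cpoly (pCons c p) = pCons (of_rat c) (cpoly p)"
  by (rule poly_eqI) (simp add: coeff_pCons split: nat.splits)

lemma cpoly_1: "cpoly 1 = 1"
  by (simp add: one_pCons cpoly_pCons)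

lemma cpoly_power: "cpoly (p ^ n) = cpoly p ^ n"
  by (induction n) (auto simp: cpoly_mult cpoly_1)

lemma cpoly_monom: "cpoly (monom c n) = monom (of_rat c) n"
  by (rule poly_eqI) simp

lemma cpoly_0_iff [simp]: "cpoly p = 0 \<longleftrightarrow> p = 0"
  by (auto simp: poly_eq_iff)

lemma degree_cpoly [simp]: "degree (cpoly p) = degree p"
  by (rule degree_map_poly) auto

lemma wp_rec_poly:
  "wp_rec (\<lambda>m. poly (cpoly (wp_poly m)) t)"
  unfolding wp_rec_def
proof (intro allI impI)
  fix m :: nat assume m: "m \<ge> 4"
  define k where "k = (2 * int m + 1) * (int m - 3)"
  have c: "cpoly (of_int k * p) = of_int k * cpoly p" for p
    by (simp add: of_int_poly cpoly_smult)
  have c3: "cpoly (3 * p) = 3 * cpoly p" for p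
    by (simp add: numeral_poly cpoly_smult)
  have "cpoly (of_int k * wp_poly m) = cpoly (3 * (\<Sum>i=2..m-2. wp_poly i * wp_poly (m - i)))"
    using wp_rec_wp_poly m unfolding wp_rec_def k_def by simp
  then have "of_int k * cpoly (wp_poly m) = 3 * cpoly (\<Sum>i=2..m-2. wp_poly i * wp_poly (m - i))"
    by (simp only: c c3)
  then have "poly (of_int k * cpoly (wp_poly m)) t = poly (3 * (\<Sum>i=2..m-2. cpoly (wp_poly i) * cpoly (wp_poly (m - i)))) t"
    by (simp only: cpoly_sum cpoly_mult)
  then show "of_int ((2 * int m + 1) * (int m - 3)) * poly (cpoly (wp_poly m)) t = 3 * (\<Sum>i=2..m-2. poly (cpoly (wp_poly i)) t * poly (cpoly (wp_poly (m - i))) t)"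
    unfolding k_def[symmetric] by (simp add: poly_sum of_int_poly numeral_poly)
qed

text \<open>Dividing by powers of \<open>s\<close> normalises \<open>E_4\<close> to 1, as in
  \<open>wp_poly\<close>; both sides then satisfy the same recurrence with the same initial values.
  The square root enters because \<open>F\<close> has to be divided by
  \<open>E_4^(3/2)\<close>.\<close>

lemma wp_norm_poly:
  assumes q: "norm q < 1" and s: "s ^ 2 = eis_disc 4 q" "s \<noteq> 0" and m: "m \<ge> 2"
  shows "wp_norm q m = s ^ m * poly (cpoly (wp_poly m)) (2 * eis_disc 6 q / s ^ 3)"
proof -
  have "(1 / s) ^ m * wp_norm q m = poly (cpoly (wp_poly m)) (2 * eis_disc 6 q / s ^ 3)"
  proof (rule wp_rec_unique[OF wp_rec_scale[OF wp_rec_wp_norm[OF q]] wp_rec_poly _ _ m])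
    show "(1 / s) ^ 2 * wp_norm q 2 = poly (cpoly (wp_poly 2)) (2 * eis_disc 6 q / s ^ 3)"
      using s by (simp add: wp_norm_2 wp_poly_2 cpoly_pCons power_divide s(1)[symmetric] of_rat_divide)
    show "(1 / s) ^ 3 * wp_norm q 3 = poly (cpoly (wp_poly 3)) (2 * eis_disc 6 q / s ^ 3)"
      using s by (simp add: wp_norm_3 wp_poly_3 cpoly_pCons power_divide of_rat_divide of_rat_minus)
  qed
  then show ?thesis using s(2) by (simp add: field_simps)
qed

text \<open>In \<open>6 n = 2 i + 3 j\<close> the exponent \<open>j\<close> of \<open>F\<close> is
  even and at most \<open>2 n\<close>, so only \<open>F^2\<close> occurs and the square root
  \<open>s\<close> disappears.\<close>

lemma poly_wp_poly_6:
  "poly (cpoly (wp_poly (6 * n))) t = (\<Sum>j\<le>n. of_rat (coeff (wp_poly (6 * n)) (2 * j)) * (t^2) ^ j)"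
proof -
  define p where "p = wp_poly (6 * n)"
  have sup: "\<exists>j\<le>n. i = 2 * j" if nz: "coeff p i \<noteq> 0" for i
  proof -
    obtain k where k: "6 * n = 2 * k + 3 * i" using wp_poly_support[OF nz[unfolded p_def]] by blast
    then have "even i" by presburger
    then obtain j where "i = 2 * j" by blast
    then show ?thesis using k by auto
  qed
  have "poly (cpoly p) t = (\<Sum>i\<le>degree p. of_rat (coeff p i) * t ^ i)" by (simp add: poly_altdef)
  also have "\<dots> = (\<Sum>i\<in>{i. i \<le> degree p \<and> coeff p i \<noteq> 0}. of_rat (coeff p i) * t ^ i)"
    by (rule sum.mono_neutral_right) auto
  also have "\<dots> = (\<Sum>i\<in>(\<lambda>j. 2 * j) ` {..n}. of_rat (coeff p i) * t ^ i)"
    by (rule sum.mono_neutral_left) (use sup le_degree in fastforce)+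
  also have "\<dots> = (\<Sum>j\<le>n. of_rat (coeff p (2 * j)) * (t^2) ^ j)"
    by (subst sum.reindex) (auto simp: inj_on_def power_mult)
  finally show ?thesis unfolding p_def .
qed

definition delta_disc :: "complex \<Rightarrow> complex" where
  "delta_disc q = (eis_disc 4 q ^ 3 - eis_disc 6 q ^ 2) / 1728"

text \<open>With \<open>y = E_4^3 / D\<close> one has \<open>s^6 = D y\<close> and
  \<open>F^2 / s^6 = (4 y - 27) / y\<close>; the factor \<open>y^n\<close> clears the
  denominators.\<close>

lemma wp_norm_qpoly:
  assumes q: "norm q < 1" and a: "eis_disc 4 q \<noteq> 0" "delta_disc q \<noteq> 0" and n: "n \<ge> 1"
  shows "wp_norm q (6 * n) = (256 * delta_disc q) ^ n * poly (cpoly (wp_qpoly n)) (eis_disc 4 q ^ 3 / (256 * delta_disc q))"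
proof -
  define a where "a = eis_disc 4 q"
  define b where "b = eis_disc 6 q"
  define D where "D = 256 * delta_disc q"
  define s where "s = csqrt a"
  define y where "y = a ^ 3 / D"
  have s: "s ^ 2 = eis_disc 4 q" "s \<noteq> 0" using a by (simp_all add: s_def a_def)
  have D: "D \<noteq> 0" "27 * D = 4 * a ^ 3 - 4 * b ^ 2" using a(2) by (simp_all add: D_def delta_disc_def a_def b_def)
  have a0: "a \<noteq> 0" using a by (simp add: a_def)
  have y0: "y \<noteq> 0" using a0 D by (simp add: y_def)
  have s6: "s ^ (6 * k) = (D * y) ^ k" for k
  proof -
    have "s ^ (6 * k) = ((s ^ 2) ^ 3) ^ k" by (simp flip: power_mult)
    then show ?thesis using D s by (simp add: y_def a_def)
  qed
  have "(2 * b / s ^ 3) ^ 2 = 4 * b ^ 2 / (s ^ (6 * 1))" by (simp add: power_divide power_mult_distrib flip: power_mult)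
  also have "\<dots> = 4 * b ^ 2 / (D * y)" unfolding s6 by simp
  also have "4 * b ^ 2 = 4 * (D * y) - 27 * D" using D by (simp add: y_def)
  also have "(4 * (D * y) - 27 * D) / (D * y) = (4 * y - 27) / y" using D(1) y0 by (simp add: field_simps)
  finally have t2: "(2 * b / s ^ 3) ^ 2 = (4 * y - 27) / y" .
  define r where "r = (\<lambda>j. of_rat (coeff (wp_poly (6 * n)) (2 * j)) :: complex)"
  have "wp_norm q (6 * n) = s ^ (6 * n) * poly (cpoly (wp_poly (6 * n))) (2 * b / s ^ 3)"
    unfolding b_def using n by (intro wp_norm_poly q s) auto
  also have "\<dots> = (D * y) ^ n * (\<Sum>j\<le>n. r j * ((4 * y - 27) / y) ^ j)"
    unfolding poly_wp_poly_6 t2 s6 r_def ..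
  also have "\<dots> = D ^ n * (\<Sum>j\<le>n. y ^ n * (r j * ((4 * y - 27) / y) ^ j))"
    by (simp add: power_mult_distrib sum_distrib_left mult.assoc)
  also have "(\<Sum>j\<le>n. y ^ n * (r j * ((4 * y - 27) / y) ^ j)) = (\<Sum>j\<le>n. r j * (y ^ (n - j) * (4 * y - 27) ^ j))"
  proof (rule sum.cong)
    fix j assume "j \<in> {..n}"
    then have "y ^ n = y ^ (n - j) * y ^ j" by (simp flip: power_add)
    then show "y ^ n * (r j * ((4 * y - 27) / y) ^ j) = r j * (y ^ (n - j) * (4 * y - 27) ^ j)"
      using y0 by (simp add: power_divide)
  qed simp
  also have "\<dots> = poly (cpoly (wp_qpoly n)) y"
    unfolding wp_qpoly_def cpoly_sum cpoly_smult cpoly_mult cpoly_power cpoly_monom cpoly_pCons poly_sum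
    by (simp add: r_def poly_monom algebra_simps of_rat_minus)
  finally show ?thesis unfolding y_def a_def D_def .
qed

lemma wp_norm_0_qpoly:
  assumes "n \<ge> 1" shows "wp_norm 0 (6 * n) = of_rat (coeff (wp_qpoly n) n)"
proof -
  have "wp_norm 0 (6 * n) = 1 ^ (6 * n) * poly (cpoly (wp_poly (6 * n))) (2 * eis_disc 6 0 / 1 ^ 3)"
    using assms by (intro wp_norm_poly) auto
  also have "\<dots> = of_rat (coeff (wp_qpoly n) n)"
    unfolding poly_wp_poly_6 coeff_wp_qpoly_top by (simp add: of_rat_sum of_rat_mult of_rat_power)
  finally show ?thesis .
qed

section \<open>Moebius transformations, homothety and the fundamental domain\<close>

lemma lat_moebius:
  fixes a b c d :: int
  assumes det: "a * d - b * c = 1" and \<tau>: "Im \<tau> > 0"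
  defines "J \<equiv> of_int c * \<tau> + of_int d"
  defines "\<tau>' \<equiv> (of_int a * \<tau> + of_int b) / J"
  shows "J \<noteq> 0" "Im \<tau>' = Im \<tau> / norm J ^ 2" "Im \<tau>' > 0" "lat \<tau>' = (\<lambda>w. (1 / J) * w) ` lat \<tau>"
proof -
  show J0: "J \<noteq> 0"
  proof
    assume "J = 0"
    then have "Im J = 0" by simp
    then have "c = 0" using \<tau> by (simp add: J_def)
    then have "d = 0" using \<open>J = 0\<close> by (simp add: J_def)
    then show False using det \<open>c = 0\<close> by simp
  qed
  have "Im \<tau>' = Im ((of_int a * \<tau> + of_int b) * cnj J) / norm J ^ 2"
    unfolding \<tau>'_def by (simp add: Im_divide cmod_power2)
  also have "Im ((of_int a * \<tau> + of_int b) * cnj J) = of_int (a * d - b * c) * Im \<tau>"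
    by (simp add: J_def algebra_simps)
  finally show I: "Im \<tau>' = Im \<tau> / norm J ^ 2" by (simp add: det)
  then show "Im \<tau>' > 0" using \<tau> J0 by simp
  show "lat \<tau>' = (\<lambda>w. (1 / J) * w) ` lat \<tau>"
  proof (intro equalityI subsetI)
    fix w assume "w \<in> lat \<tau>'"
    then obtain m n where w: "w = of_int m + of_int n * \<tau>'" unfolding lat_def by blast
    have "w = (1 / J) * (of_int (m * d + n * b) + of_int (m * c + n * a) * \<tau>)"
      using J0 unfolding w \<tau>'_def by (simp add: field_simps) (simp add: J_def algebra_simps)
    then show "w \<in> (\<lambda>w. (1 / J) * w) ` lat \<tau>" using latI by blast
  next
    fix w assume "w \<in> (\<lambda>w. (1 / J) * w) ` lat \<tau>"
    then obtain x y where w: "w = (1 / J) * (of_int x + of_int y * \<tau>)" unfolding lat_def by blast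
    \<comment> \<open>The coordinates with respect to the new basis come from the inverse matrix,
      which is integral because the determinant is 1.\<close>
    have x: "x = (a * x - b * y) * d + (d * y - c * x) * b" 
    proof -
      have "(a * x - b * y) * d + (d * y - c * x) * b = (a * d - b * c) * x" by (simp add: algebra_simps)
      then show ?thesis by (simp add: det)
    qed
    have y: "y = (a * x - b * y) * c + (d * y - c * x) * a" 
    proof -
      have "(a * x - b * y) * c + (d * y - c * x) * a = (a * d - b * c) * y" by (simp add: algebra_simps)
      then show ?thesis by (simp add: det)
    qed
    define m n where "m = a * x - b * y" "n = d * y - c * x"
    have "w = of_int m + of_int n * \<tau>'"
      unfolding w \<tau>'_def using J0 
      by (subst x, subst y, fold m_n_def) (simp add: field_simps, simp add: J_def algebra_simps)
    then show "w \<in> lat \<tau>'" using latI by blast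
  qed
qed

text \<open>Stands in for equivalence under the modular group. The factor is kept as an argument
  because a form of weight \<open>k\<close> changes by its \<open>k\<close>-th power.\<close>

definition homothetic :: "complex \<Rightarrow> complex \<Rightarrow> complex \<Rightarrow> bool" where
  "homothetic \<mu> \<tau> \<tau>' \<longleftrightarrow> \<mu> \<noteq> 0 \<and> lat \<tau>' = (\<lambda>w. \<mu> * w) ` lat \<tau>"

lemma homothetic_trans: "homothetic \<mu> \<tau> \<tau>' \<Longrightarrow> homothetic \<nu> \<tau>' \<tau>'' \<Longrightarrow> homothetic (\<nu> * \<mu>) \<tau> \<tau>''"
  by (auto simp: homothetic_def image_image mult.assoc)

lemma homothetic_sym: "homothetic \<mu> \<tau> \<tau>' \<Longrightarrow> homothetic (1 / \<mu>) \<tau>' \<tau>"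
  by (auto simp: homothetic_def image_image)

lemma homothetic_moebius:
  assumes "a * d - b * c = 1" "Im \<tau> > 0"
  shows "homothetic (1 / (of_int c * \<tau> + of_int d)) \<tau> ((of_int a * \<tau> + of_int b) / (of_int c * \<tau> + of_int d))"
  using lat_moebius[OF assms] by (simp add: homothetic_def)

text \<open>The matrix holds the coordinates of \<open>1 / \<mu>\<close> and
  \<open>\<tau>' / \<mu>\<close> in the basis \<open>\<tau>\<close>, 1. Its determinant is positive
  because both imaginary parts are, the same holds for the inverse homothety, and comparing
  imaginary parts shows that the two determinants multiply to 1.\<close>

lemma homothetic_imp_moebius:
  assumes h: "homothetic \<mu> \<tau> \<tau>'" and \<tau>: "Im \<tau> > 0" "Im \<tau>' > 0"
  obtains a b c d :: int where "a * d - b * c = 1" "\<mu> = 1 / (of_int c * \<tau> + of_int d)"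
    "\<tau>' = (of_int a * \<tau> + of_int b) / (of_int c * \<tau> + of_int d)" "Im \<tau>' = norm \<mu> ^ 2 * Im \<tau>"
proof -
  have key: "\<exists>a b c d. \<mu> * (of_int c * \<tau> + of_int d) = 1 \<and> \<mu> * (of_int a * \<tau> + of_int b) = \<tau>' 
      \<and> Im \<tau>' = norm \<mu> ^ 2 * (of_int (a * d - b * c) * Im \<tau>) \<and> a * d - b * c > 0"
    if h: "homothetic \<mu> \<tau> \<tau>'" and \<tau>: "Im \<tau> > 0" "Im \<tau>' > 0" for \<mu> \<tau> \<tau>'
  proof -
    have "1 \<in> (\<lambda>w. \<mu> * w) ` lat \<tau>" "\<tau>' \<in> (\<lambda>w. \<mu> * w) ` lat \<tau>" using h unfolding homothetic_def by (metis lat_1 lat_self)+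
    then obtain w1 w2 where w: "w1 \<in> lat \<tau>" "w2 \<in> lat \<tau>" "\<mu> * w1 = 1" "\<mu> * w2 = \<tau>'" by force
    obtain c d where w1: "w1 = of_int d + of_int c * \<tau>" using w(1) unfolding lat_def by blast
    obtain a b where w2: "w2 = of_int b + of_int a * \<tau>" using w(2) unfolding lat_def by blast
    have e: "\<mu> * (of_int c * \<tau> + of_int d) = 1" "\<mu> * (of_int a * \<tau> + of_int b) = \<tau>'"
      using w(3,4) by (simp_all add: w1 w2 add.commute)
    define J where "J = of_int c * \<tau> + of_int d"
    have J1: "\<mu> * J = 1" using e(1) by (simp add: J_def)
    then have J: "J \<noteq> 0" "\<mu> = 1 / J" by (auto simp: eq_divide_eq)
    have "Im \<tau>' = Im ((of_int a * \<tau> + of_int b) / J)" using e(2) J(2) by simp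
    also have "\<dots> = Im ((of_int a * \<tau> + of_int b) * cnj J) / norm J ^ 2"
      by (simp add: Im_divide cmod_power2)
    also have "Im ((of_int a * \<tau> + of_int b) * cnj J) = of_int (a * d - b * c) * Im \<tau>"
      by (simp add: J_def algebra_simps)
    finally have I: "Im \<tau>' = norm \<mu> ^ 2 * (of_int (a * d - b * c) * Im \<tau>)" by (simp add: J norm_divide power_divide)
    then have "of_int (a * d - b * c) > (0::real)" using \<tau> by (simp add: zero_less_mult_iff)
    then have "a * d - b * c > 0" by (simp only: of_int_0_less_iff)
    then show ?thesis using e I by blast
  qed
  obtain a b c d where 1: "\<mu> * (of_int c * \<tau> + of_int d) = 1" "\<mu> * (of_int a * \<tau> + of_int b) = \<tau>'"
      "Im \<tau>' = norm \<mu> ^ 2 * (of_int (a * d - b * c) * Im \<tau>)" "a * d - b * c > 0" using key[OF h \<tau>] by blast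
  obtain D :: int where 2: "Im \<tau> = norm (1 / \<mu>) ^ 2 * (of_int D * Im \<tau>')" "D > 0" 
    using key[OF homothetic_sym[OF h] \<tau>(2,1)] by blast
  have mu: "norm \<mu> > 0" using h by (simp add: homothetic_def)
  define E where "E = a * d - b * c"
  define M where "M = norm \<mu> ^ 2"
  have M: "M \<noteq> 0" "Im \<tau> = (1 / M) * (of_int D * Im \<tau>')" using 2(1) mu by (simp_all add: M_def norm_divide power_divide)
  have "Im \<tau>' = M * (of_int E * Im \<tau>)" using 1(3) by (simp only: M_def E_def)
  also have "\<dots> = of_int (E * D) * Im \<tau>'" unfolding M(2) using M(1) by simp
  finally have "Im \<tau>' = of_int ((a * d - b * c) * D) * Im \<tau>'" unfolding E_def .
  then have "of_int ((a * d - b * c) * D) = (1::real)" using \<tau>(2) by simp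
  then have "(a * d - b * c) * D = 1" by (simp only: of_int_eq_1_iff)
  then have det: "a * d - b * c = 1" using 1(4) by (metis pos_zmult_eq_1_iff)
  have mJ: "\<mu> = 1 / (of_int c * \<tau> + of_int d)" using 1(1) by (metis mult_zero_right nonzero_eq_divide_eq zero_neq_one)
  show ?thesis
  proof (rule that[OF det mJ])
    show "\<tau>' = (of_int a * \<tau> + of_int b) / (of_int c * \<tau> + of_int d)" using 1(2) mJ by simp
    show "Im \<tau>' = norm \<mu> ^ 2 * Im \<tau>" using 1(3) det by simp
  qed
qed

text \<open>A shortest nonzero vector \<open>w\<close> is completed to a basis and scaled to 1;
  after that every nonzero lattice vector, in particular \<open>\<tau>1\<close>, has norm at least
  1. A translation adjusts the real part.\<close>

lemma exists_fund_domain: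
  assumes \<tau>: "Im \<tau> > 0"
  obtains \<tau>' \<mu> where "\<tau>' \<in> fund_domain" "homothetic \<mu> \<tau> \<tau>'"
proof -
  define S where "S = lat \<tau> - {0}"
  have "closed S"
    by (rule discrete_imp_closed[of "min 1 (Im \<tau>)"])
      (use \<tau> lat_small lat_diff in \<open>force simp: dist_norm S_def\<close>)+
  moreover have "1 \<in> S" by (simp add: S_def)
  then have "S \<noteq> {}" by blast
  ultimately obtain w where w: "w \<in> S" "\<And>y. y \<in> S \<Longrightarrow> norm w \<le> norm y"
    using distance_attains_inf[of S 0] by auto
  obtain c d where cd: "w = of_int c * \<tau> + of_int d" using w(1) unfolding S_def lat_def by (auto simp: add.commute)
  have cd0: "c \<noteq> 0 \<or> d \<noteq> 0" using w(1) cd by (auto simp: S_def)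
  \<comment> \<open>Dividing by a common factor would give a shorter lattice vector.\<close>
  have "gcd c d = 1"
  proof -
    define g where "g = gcd c d"
    have g0: "g > 0" using cd0 by (auto simp: g_def)
    obtain c' d' where c': "c = g * c'" "d = g * d'" by (metis g_def gcd_dvd1 gcd_dvd2 dvdE)
    define w' where "w' = of_int d' + of_int c' * \<tau>"
    have ww: "w = of_int g * w'" by (simp add: cd c' w'_def algebra_simps)
    then have "w' \<in> S" using w(1) latI unfolding S_def w'_def by auto
    then have "norm w \<le> norm w'" "w' \<noteq> 0" using w(2) by (auto simp: S_def)
    then have "of_int g \<le> (1::real)" using g0 by (simp add: ww norm_mult)
    then show ?thesis using g0 unfolding g_def by linarith
  qed
  then obtain u v where "u * c + v * d = 1" using bezout_int[of c d] by auto
  then have det: "v * d - (-u) * c = 1" by simp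
  define \<tau>0 where "\<tau>0 = (of_int v * \<tau> + of_int (-u)) / (of_int c * \<tau> + of_int d)"
  have h0: "homothetic (1 / w) \<tau> \<tau>0" unfolding \<tau>0_def cd using homothetic_moebius[OF det \<tau>] .
  have I0: "Im \<tau>0 > 0" unfolding \<tau>0_def using lat_moebius(3)[OF det \<tau>] .
  define k where "k = \<lfloor>Re \<tau>0 + 1/2\<rfloor>"
  define \<tau>1 where "\<tau>1 = \<tau>0 - of_int k"
  have h1: "homothetic 1 \<tau>0 \<tau>1" using homothetic_moebius[of 1 1 "-k" 0 \<tau>0] I0 by (simp add: \<tau>1_def)
  have I1: "Im \<tau>1 > 0" using I0 by (simp add: \<tau>1_def)
  have R1: "-1/2 \<le> Re \<tau>1" "Re \<tau>1 < 1/2" unfolding \<tau>1_def k_def by simp_all linarith+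
  have h2: "homothetic (1 / w) \<tau> \<tau>1" using homothetic_trans[OF h0 h1] by simp
  have N1: "norm \<tau>1 \<ge> 1"
  proof -
    have "\<tau>1 \<in> (\<lambda>x. 1 / w * x) ` lat \<tau>" using h2 unfolding homothetic_def by (metis lat_self)
    then obtain x where x: "x \<in> lat \<tau>" "\<tau>1 = x / w" by auto
    have "x \<noteq> 0" using x(2) I1 by auto
    then have "norm w \<le> norm x" using w(2) x(1) by (auto simp: S_def)
    moreover have "norm w > 0" using w(1) by (auto simp: S_def)
    ultimately show ?thesis using x(2) by (simp add: norm_divide)
  qed
  show ?thesis
  proof (cases "norm \<tau>1 = 1 \<and> Re \<tau>1 > 0")
    case False
    then have "\<tau>1 \<in> fund_domain" using I1 R1 N1 by (auto simp: fund_domain_def)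
    then show ?thesis using that h2 by blast
  next
    case True
    \<comment> \<open>On the unit circle inversion is the reflection in the imaginary axis, so it
      moves the right half of the arc to the left half, which belongs to the domain.\<close>
    define \<tau>2 where "\<tau>2 = - 1 / \<tau>1"
    have h3: "homothetic (1 / \<tau>1) \<tau>1 \<tau>2" using homothetic_moebius[of 0 0 "-1" 1 \<tau>1] I1 by (simp add: \<tau>2_def)
    have "\<tau>1 * cnj \<tau>1 = 1" using True complex_norm_square[of \<tau>1] by simp
    moreover have "\<tau>1 \<noteq> 0" using I1 by auto
    ultimately have "cnj \<tau>1 = 1 / \<tau>1" by (simp add: eq_divide_eq mult.commute)
    then have "\<tau>2 = - cnj \<tau>1" by (simp add: \<tau>2_def)
    then have "\<tau>2 \<in> fund_domain" using I1 R1 True by (auto simp: fund_domain_def)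
    then show ?thesis using that homothetic_trans[OF h2 h3] by blast
  qed
qed

text \<open>Since \<open>|Re \<tau>| \<le> 1/2\<close> and \<open>|\<tau>| \<ge> 1\<close>, the form
  \<open>|m + n \<tau>|^2\<close> is at least \<open>m^2 - |m n| + n^2\<close>, a positive integer.
  If \<open>|\<tau>| > 1\<close> the inequality is strict unless \<open>n = 0\<close>.\<close>

lemma fund_domain_norm_ge:
  assumes "\<tau> \<in> fund_domain" "w \<in> lat \<tau>" "w \<noteq> 0"
  shows "norm w \<ge> 1" and "norm \<tau> > 1 \<Longrightarrow> norm w = 1 \<Longrightarrow> Im w = 0"
proof -
  obtain m n where w: "w = of_int m + of_int n * \<tau>" using assms(2) unfolding lat_def by blast
  define x where "x = Re \<tau>" define y where "y = Im \<tau>"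
  have x: "\<bar>x\<bar> \<le> 1/2" and xy: "x^2 + y^2 \<ge> 1"
    using assms(1) power_mono[of 1 "cmod \<tau>" 2] unfolding fund_domain_def x_def y_def cmod_power2[symmetric] by auto
  have nw: "norm w ^ 2 = of_int (m * m) + 2 * of_int (m * n) * x + of_int (n * n) * (x^2 + y^2)"
    unfolding w cmod_power2 x_def y_def by (simp add: power2_eq_square algebra_simps)
  have mn: "2 * of_int (m * n) * x \<ge> - \<bar>of_int (m * n)\<bar>"
  proof -
    have "\<bar>2 * of_int (m * n) * x\<bar> = \<bar>of_int (m * n)\<bar> * (2 * \<bar>x\<bar>)" by (simp add: abs_mult)
    also have "\<dots> \<le> \<bar>of_int (m * n)\<bar> * 1" using x by (intro mult_left_mono) auto
    finally show ?thesis by linarith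
  qed
  have mn0: "m \<noteq> 0 \<or> n \<noteq> 0" using assms(3) w by auto
  have q1: "m * m - \<bar>m * n\<bar> + n * n \<ge> 1"
  proof -
    have "m * m - \<bar>m * n\<bar> + n * n = (\<bar>m\<bar> - \<bar>n\<bar>)^2 + \<bar>m\<bar> * \<bar>n\<bar>" by (simp add: power2_eq_square algebra_simps abs_mult)
    moreover have "(\<bar>m\<bar> - \<bar>n\<bar>)^2 + \<bar>m\<bar> * \<bar>n\<bar> > 0"
    proof (cases "\<bar>m\<bar> = \<bar>n\<bar>")
      case True
      then have "m \<noteq> 0" "n \<noteq> 0" using mn0 by auto
      then have "\<bar>m\<bar> * \<bar>n\<bar> > 0" by simp
      then show ?thesis using zero_le_power2[of "\<bar>m\<bar> - \<bar>n\<bar>"] by linarith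
    next
      case False
      then have "(\<bar>m\<bar> - \<bar>n\<bar>)^2 > 0" by simp
      moreover have "\<bar>m\<bar> * \<bar>n\<bar> \<ge> 0" by simp
      ultimately show ?thesis by linarith
    qed
    ultimately show ?thesis by linarith
  qed
  then have q1': "of_int (m * m) - \<bar>of_int (m * n)\<bar> + of_int (n * n) \<ge> (1::real)"
    by (metis of_int_1_le_iff of_int_abs of_int_add of_int_diff)
  have nn: "of_int (n * n) * (x^2 + y^2) \<ge> (of_int (n * n) :: real)"
    using mult_left_mono[OF xy, of "of_int (n * n)"] by simp
  have "norm w ^ 2 \<ge> 1" using nw mn q1' nn by linarith
  then show "norm w \<ge> 1" using power2_le_imp_le[of 1 "norm w"] by simp
  assume t: "norm \<tau> > 1" and w1: "norm w = 1"
  have "n = 0"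
  proof (rule ccontr)
    assume "n \<noteq> 0"
    then have n: "of_int (n * n) > (0::real)" by (simp only: of_int_0_less_iff zero_less_mult_iff) linarith
    have "x^2 + y^2 > 1" using t power_strict_mono[of 1 "cmod \<tau>" 2] unfolding x_def y_def cmod_power2[symmetric] by simp
    then have "of_int (n * n) * (x^2 + y^2) > (of_int (n * n) :: real)" using mult_strict_left_mono[OF _ n] by fastforce
    then have "norm w ^ 2 > 1" using nw mn q1' by linarith
    then show False using w1 by simp
  qed
  then show "Im w = 0" by (simp add: w)
qed

text \<open>Both \<open>\<mu>\<close> and \<open>1 / \<mu>\<close> are lattice vectors, hence of
  norm 1, and the imaginary parts agree. Off the unit circle the automorphy factor must be real,
  which leaves a translation; if both points are on the circle, equal heights and nonpositive real
  parts decide.\<close>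

lemma fund_domain_unique:
  assumes "\<tau> \<in> fund_domain" "\<tau>' \<in> fund_domain" "homothetic \<mu> \<tau> \<tau>'"
  shows "\<tau> = \<tau>'"
proof -
  have I: "Im \<tau> > 0" "Im \<tau>' > 0" using assms by (auto simp: fund_domain_def)
  have mu0: "\<mu> \<noteq> 0" using assms(3) by (simp add: homothetic_def)
  have "\<mu> \<in> lat \<tau>'" using assms(3) unfolding homothetic_def by (metis imageI lat_1 mult.right_neutral)
  then have 1: "norm \<mu> \<ge> 1" using fund_domain_norm_ge[OF assms(2)] mu0 by blast
  have "1 / \<mu> \<in> lat \<tau>" using homothetic_sym[OF assms(3)] unfolding homothetic_def by (metis imageI lat_1 mult.right_neutral)
  then have 2: "norm (1 / \<mu>) \<ge> 1" using fund_domain_norm_ge[OF assms(1)] mu0 by fastforce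
  have nm: "norm \<mu> = 1" using 1 2 mu0 by (simp add: norm_divide le_divide_eq_1)
  have "Im \<tau>' = norm \<mu> ^ 2 * Im \<tau>" using homothetic_imp_moebius[OF assms(3) I] by metis
  then have Ieq: "Im \<tau>' = Im \<tau>" by (simp add: nm)
  have main: "\<tau> = \<tau>'" if F: "\<tau> \<in> fund_domain" "\<tau>' \<in> fund_domain" and h: "homothetic \<mu> \<tau> \<tau>'" and nm: "norm \<mu> = 1" and t: "norm \<tau> > 1" for \<mu> \<tau> \<tau>'
  proof -
    have I: "Im \<tau> > 0" "Im \<tau>' > 0" using F by (auto simp: fund_domain_def)
    obtain a b c d :: int where m: "a * d - b * c = 1" "\<mu> = 1 / (of_int c * \<tau> + of_int d)"
      "\<tau>' = (of_int a * \<tau> + of_int b) / (of_int c * \<tau> + of_int d)" by (rule homothetic_imp_moebius[OF h I])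
    define J where "J = of_int c * \<tau> + of_int d"
    have J: "norm J = 1" using nm m(2) by (simp add: J_def[symmetric] norm_divide)
    have "J \<in> lat \<tau>" using latI[of d c \<tau>] by (simp add: J_def add.commute)
    moreover have "J \<noteq> 0" using J by auto
    ultimately have "Im J = 0" using fund_domain_norm_ge(2)[OF F(1) _ _ t J] by blast
    then have c0: "c = 0" using I by (simp add: J_def)
    then have "a * d = 1" using m(1) by simp
    then have "(a = 1 \<and> d = 1) \<or> (a = -1 \<and> d = -1)" by (simp add: zmult_eq_1_iff)
    then have "\<exists>k::int. \<tau>' = \<tau> + of_int k"
    proof
      assume "a = 1 \<and> d = 1" then show ?thesis using m(3) c0 by auto
    next
      assume "a = -1 \<and> d = -1" then have "\<tau>' = \<tau> + of_int (-b)" using m(3) c0 by simp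
      then show ?thesis by blast
    qed
    then obtain k where k: "\<tau>' = \<tau> + of_int k" by blast
    then have "\<bar>real_of_int k\<bar> < 1" using F by (auto simp: fund_domain_def)
    then show ?thesis using k by simp
  qed
  show ?thesis
  proof (cases "norm \<tau> > 1")
    case True then show ?thesis using main[OF assms nm] by blast
  next
    case False
    show ?thesis
    proof (cases "norm \<tau>' > 1")
      case True
      have "norm (1 / \<mu>) = 1" using nm by (simp add: norm_divide)
      then show ?thesis using main[OF assms(2,1) homothetic_sym[OF assms(3)] _ True] by simp
    next
      case False
      then have e: "norm \<tau> = 1" "norm \<tau>' = 1" "Re \<tau> \<le> 0" "Re \<tau>' \<le> 0"
        using assms \<open>\<not> norm \<tau> > 1\<close> by (auto simp: fund_domain_def)
      then have "Re \<tau> ^ 2 + Im \<tau> ^ 2 = Re \<tau>' ^ 2 + Im \<tau>' ^ 2" by (metis cmod_power2)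
      then have "(- Re \<tau>) ^ 2 = (- Re \<tau>') ^ 2" using Ieq by simp
      then have "- Re \<tau> = - Re \<tau>'" using e by (metis power2_eq_imp_eq neg_0_le_iff_le)
      then show ?thesis using Ieq by (simp add: complex_eq_iff)
    qed
  qed
qed

section \<open>The modular invariant\<close>

abbreviation upper_half :: "complex set" where "upper_half \<equiv> {z. Im z > 0}"

abbreviation cusp :: "complex filter" where "cusp \<equiv> filtercomap Im at_top"

lemma open_upper_half: "open upper_half" by (simp add: open_halfspace_Im_gt)

lemma connected_upper_half: "connected upper_half"
  by (intro convex_connected convex_halfspace_Im_gt)

lemma norm_nome_less: "Im \<tau> > 0 \<Longrightarrow> norm (nome \<tau>) < 1" by simp

lemma nome_holomorphic: "nome holomorphic_on A" by (intro holomorphic_intros)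

lemma eisenstein_holomorphic: "eisenstein k holomorphic_on upper_half"
proof -
  have "(eis_disc k \<circ> nome) holomorphic_on upper_half"
    by (rule holomorphic_on_compose_gen[OF nome_holomorphic eis_disc_holomorphic]) auto
  then show ?thesis by (simp add: o_def eisenstein_eq[abs_def])
qed

lemma modular_discriminant_eq: "modular_discriminant \<tau> = delta_disc (nome \<tau>)"
  by (simp add: modular_discriminant_def delta_disc_def eisenstein_eq)

lemma modular_discriminant_holomorphic: "modular_discriminant holomorphic_on upper_half"
  unfolding modular_discriminant_def[abs_def] by (intro holomorphic_intros eisenstein_holomorphic) auto

lemma wp_norm_homogeneous:
  assumes h: "homothetic \<mu> \<tau> \<tau>'" and \<tau>: "Im \<tau> > 0" "Im \<tau>' > 0" and m: "m \<ge> 2"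
  shows "wp_norm (nome \<tau>) m = \<mu> ^ (2 * m) * wp_norm (nome \<tau>') m"
  using wp_coeff_homogeneous[OF \<tau>, of \<mu> "2*m"] h m unfolding homothetic_def wp_norm_def by simp

lemma eisenstein_4_6_homogeneous:
  assumes h: "homothetic \<mu> \<tau> \<tau>'" and \<tau>: "Im \<tau> > 0" "Im \<tau>' > 0"
  shows "eisenstein 4 \<tau> = \<mu> ^ 4 * eisenstein 4 \<tau>'" "eisenstein 6 \<tau> = \<mu> ^ 6 * eisenstein 6 \<tau>'"
    "modular_discriminant \<tau> = \<mu> ^ 12 * modular_discriminant \<tau>'"
proof -
  show 4: "eisenstein 4 \<tau> = \<mu> ^ 4 * eisenstein 4 \<tau>'"
    using wp_norm_homogeneous[OF assms, of 2] by (simp add: wp_norm_2 eisenstein_eq)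
  show 6: "eisenstein 6 \<tau> = \<mu> ^ 6 * eisenstein 6 \<tau>'"
    using wp_norm_homogeneous[OF assms, of 3] by (simp add: wp_norm_3 eisenstein_eq)
  show "modular_discriminant \<tau> = \<mu> ^ 12 * modular_discriminant \<tau>'"
    unfolding modular_discriminant_def 4 6 by (simp add: power_mult_distrib algebra_simps flip: power_mult)
qed

lemma wp_coeff_of_norm:
  assumes "\<And>m. m \<ge> 2 \<Longrightarrow> wp_norm q m = \<mu> ^ (2 * m) * wp_norm q' m" and "k \<ge> 3"
  shows "wp_coeff k q = \<mu> ^ k * wp_coeff k q'"
proof (cases "even k")
  case True
  then obtain m where m: "k = 2 * m" by blast
  have "4 ^ m * wp_coeff (2 * m) q / tpi ^ (2 * m) = \<mu> ^ (2 * m) * (4 ^ m * wp_coeff (2 * m) q' / tpi ^ (2 * m))"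
    using assms(1)[of m] assms(2) m unfolding wp_norm_def by auto
  then show ?thesis unfolding m by (simp del: power_mult_distrib)
qed (simp add: wp_coeff_odd)

lemma wp_norm_determined:
  assumes q: "norm q < 1" "norm q' < 1"
    and e: "eis_disc 4 q = \<mu> ^ 4 * eis_disc 4 q'" "eis_disc 6 q = \<mu> ^ 6 * eis_disc 6 q'" and m: "m \<ge> 2"
  shows "wp_norm q m = \<mu> ^ (2 * m) * wp_norm q' m"
proof -
  have "wp_norm q m = (\<mu> ^ 2) ^ m * wp_norm q' m"
    by (rule wp_rec_unique[OF wp_rec_wp_norm[OF q(1)] wp_rec_scale[OF wp_rec_wp_norm[OF q(2)]] _ _ m])
      (simp_all add: wp_norm_2 wp_norm_3 e flip: power_mult)
  then show ?thesis by (simp add: power_mult)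
qed

text \<open>If \<open>E_4^3 = E_6^2\<close>, both values are powers \<open>\<nu>^4\<close> and
  \<open>\<nu>^6\<close> of one number, possibly 0, as for the degenerate lattice at
  \<open>q = 0\<close> scaled by \<open>\<nu>\<close>. The recurrence spreads the agreement to all
  coefficients, against \<open>not_degenerate\<close>.\<close>

lemma modular_discriminant_nonzero:
  assumes \<tau>: "Im \<tau> > 0" shows "modular_discriminant \<tau> \<noteq> 0"
proof
  assume "modular_discriminant \<tau> = 0"
  define a where "a = eis_disc 4 (nome \<tau>)"
  define b where "b = eis_disc 6 (nome \<tau>)"
  have ab: "a ^ 3 = b ^ 2" using \<open>modular_discriminant \<tau> = 0\<close> unfolding modular_discriminant_eq delta_disc_def a_def b_def by simp
  have "(csqrt a ^ 3) ^ 2 = (csqrt a ^ 2) ^ 3" by (simp only: power_mult[symmetric] mult.commute)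
  then have "b ^ 2 = (csqrt a ^ 3) ^ 2" using ab by simp
  then have "b = csqrt a ^ 3 \<or> b = - (csqrt a ^ 3)" using power2_eq_iff by blast
  then obtain s where s: "s ^ 2 = a" "s ^ 3 = b"
  proof
    assume "b = csqrt a ^ 3" then show ?thesis using that[of "csqrt a"] by simp
  next
    assume "b = - (csqrt a ^ 3)" then show ?thesis using that[of "- csqrt a"] by simp
  qed
  define \<nu> where "\<nu> = csqrt s"
  have nu: "\<nu> ^ 2 = s" by (simp add: \<nu>_def)
  have "\<nu> ^ 4 = (\<nu> ^ 2) ^ 2" "\<nu> ^ 6 = (\<nu> ^ 2) ^ 3" by (simp_all flip: power_mult)
  then have e: "a = \<nu> ^ 4 * eis_disc 4 0" "b = \<nu> ^ 6 * eis_disc 6 0" using nu s by simp_all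
  show False
  proof (rule not_degenerate[OF \<tau>])
    fix k :: nat assume "k \<ge> 3"
    then show "wp_coeff k (nome \<tau>) = \<nu> ^ k * wp_coeff k 0"
      using wp_norm_determined[of "nome \<tau>" 0] norm_nome_less[OF \<tau>] e unfolding a_def b_def
      by (intro wp_coeff_of_norm) auto
  qed
qed

lemma j_invariant_homothetic:
  assumes h: "homothetic \<mu> \<tau> \<tau>'" and \<tau>: "Im \<tau> > 0" "Im \<tau>' > 0"
  shows "j_invariant \<tau> = j_invariant \<tau>'"
proof -
  have "\<mu> \<noteq> 0" using h by (simp add: homothetic_def)
  then show ?thesis unfolding j_invariant_def eisenstein_4_6_homogeneous[OF assms]
    by (simp add: power_mult_distrib flip: power_mult)
qed

text \<open>The number \<open>\<nu>\<close> matches \<open>a\<close> up to a cube root of unity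
  \<open>w\<close> and \<open>b\<close> up to sign. Multiplying it by \<open>w\<close> repairs the
  first without touching the second, as \<open>w^4 = w\<close> and \<open>w^6 = 1\<close>;
  multiplying by \<open>\<i>\<close> flips only the sign.\<close>

lemma twelfth_root_adjust:
  fixes a b a' b' \<nu> :: complex
  assumes "a ^ 3 = \<nu> ^ 12 * a' ^ 3" "b ^ 2 = \<nu> ^ 12 * b' ^ 2" "\<nu> \<noteq> 0"
  obtains \<mu> where "\<mu> \<noteq> 0" "a = \<mu> ^ 4 * a'" "b = \<mu> ^ 6 * b'"
proof -
  obtain w where w: "w ^ 3 = 1" "a = w * (\<nu> ^ 4 * a')"
  proof (cases "a' = 0")
    case True then show ?thesis using assms that[of 1] by simp
  next
    case False
    have "(a / (\<nu> ^ 4 * a')) ^ 3 = 1" using assms False by (simp add: power_divide power_mult_distrib flip: power_mult)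
    then show ?thesis using that[of "a / (\<nu> ^ 4 * a')"] False assms(3) by simp
  qed
  have w0: "w \<noteq> 0" using w(1) by auto
  have "w ^ 4 = w ^ 3 * w" "w ^ 6 = (w ^ 3) ^ 2" by (simp_all add: power_numeral_reduce flip: power_mult)
  then have w46: "w ^ 4 = w" "w ^ 6 = 1" using w(1) by simp_all
  have "b ^ 2 = (\<nu> ^ 6 * b') ^ 2" using assms(2) by (simp add: power_mult_distrib flip: power_mult)
  then have "b = \<nu> ^ 6 * b' \<or> b = - (\<nu> ^ 6 * b')" by (simp add: power2_eq_iff)
  then show ?thesis
  proof
    assume "b = \<nu> ^ 6 * b'"
    then show ?thesis using that[of "w * \<nu>"] w w46 w0 assms(3) by (simp add: power_mult_distrib)
  next
    assume "b = - (\<nu> ^ 6 * b')"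
    moreover have "\<i> ^ 4 = 1" "\<i> ^ 6 = -1" by (simp_all add: power_numeral_reduce)
    ultimately show ?thesis using that[of "\<i> * (w * \<nu>)"] w w46 w0 assms(3) by (simp add: power_mult_distrib)
  qed
qed

lemma j_invariant_inj:
  assumes \<tau>: "Im \<tau> > 0" "Im \<tau>' > 0" and j: "j_invariant \<tau> = j_invariant \<tau>'"
  obtains \<mu> where "homothetic \<mu> \<tau> \<tau>'"
proof -
  define a b D where "a = eisenstein 4 \<tau>" "b = eisenstein 6 \<tau>" "D = modular_discriminant \<tau>"
  define a' b' D' where "a' = eisenstein 4 \<tau>'" "b' = eisenstein 6 \<tau>'" "D' = modular_discriminant \<tau>'"
  note defs = a_b_D_def a'_b'_D'_def
  have D0: "D \<noteq> 0" "D' \<noteq> 0" using modular_discriminant_nonzero \<tau> by (simp_all add: defs)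
  have rel: "b ^ 2 = a ^ 3 - 1728 * D" "b' ^ 2 = a' ^ 3 - 1728 * D'"
    by (simp_all add: defs modular_discriminant_def diff_divide_distrib)
  \<comment> \<open>A twelfth root of the quotient of the discriminants; equality of
    \<open>j\<close> then matches \<open>E_4^3\<close>, and \<open>E_6^2\<close> follows from the
    definition of the discriminant.\<close>
  define \<nu> where "\<nu> = exp (ln (D / D') / 12)"
  have "\<nu> ^ 12 = exp (ln (D / D'))" unfolding \<nu>_def by (simp flip: exp_of_nat_mult)
  then have nu: "\<nu> ^ 12 = D / D'" using D0 by simp
  have aD: "a ^ 3 / D = a' ^ 3 / D'" using j by (simp add: j_invariant_def defs)
  then have a3: "a ^ 3 = \<nu> ^ 12 * a' ^ 3" unfolding nu using D0 by (simp add: field_simps)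
  have "b ^ 2 = \<nu> ^ 12 * b' ^ 2" unfolding rel a3 nu using D0 by (simp add: field_simps)
  then obtain \<mu> where \<mu>: "\<mu> \<noteq> 0" "a = \<mu> ^ 4 * a'" "b = \<mu> ^ 6 * b'"
    using twelfth_root_adjust[OF a3] by (metis \<nu>_def exp_not_eq_zero)
  have "lat \<tau>' = (\<lambda>w. \<mu> * w) ` lat \<tau>"
  proof (rule lattice_rigid[OF \<tau> \<mu>(1)])
    fix k :: nat assume "k \<ge> 3"
    then show "wp_coeff k (nome \<tau>) = \<mu> ^ k * wp_coeff k (nome \<tau>')"
      using wp_norm_determined[of "nome \<tau>" "nome \<tau>'"] \<tau> norm_nome_less \<mu> unfolding defs eisenstein_eq
      by (intro wp_coeff_of_norm) auto
  qed
  then show ?thesis using that \<mu>(1) by (simp add: homothetic_def)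
qed

section \<open>Behaviour at the cusp and the maximum principle\<close>

lemma nome_cusp: "(nome \<longlongrightarrow> 0) cusp"
proof (rule tendsto_norm_zero_cancel)
  have "((\<lambda>y. exp (- 2 * pi * y)) \<longlongrightarrow> 0) at_top"
  proof (rule filterlim_compose[OF exp_at_bot])
    have "filterlim (\<lambda>y. 2 * pi * y) at_top at_top"
      by (rule filterlim_tendsto_pos_mult_at_top[OF tendsto_const _ filterlim_ident]) simp
    then show "filterlim (\<lambda>y. - 2 * pi * y) at_bot at_top" by (simp add: filterlim_uminus_at_top)
  qed
  then have "((\<lambda>\<tau>. exp (- 2 * pi * Im \<tau>)) \<longlongrightarrow> 0) cusp"
    by (rule filterlim_compose) (rule filterlim_filtercomap)
  then show "((\<lambda>\<tau>. norm (nome \<tau>)) \<longlongrightarrow> 0) cusp" by simp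
qed

lemma disc_tendsto_cusp:
  assumes "f holomorphic_on ball 0 1" shows "((\<lambda>\<tau>. f (nome \<tau>)) \<longlongrightarrow> f 0) cusp"
proof -
  have "isCont f 0" using assms holomorphic_on_imp_continuous_on continuous_on_eq_continuous_at[of "ball 0 1"] by fastforce
  then show ?thesis using isCont_tendsto_compose nome_cusp by blast
qed

lemma eisenstein_cusp: "(eisenstein k \<longlongrightarrow> 1) cusp"
  using disc_tendsto_cusp[OF eis_disc_holomorphic, of k] by (simp add: eisenstein_eq[abs_def])

lemma fund_domain_Im: "\<tau> \<in> fund_domain \<Longrightarrow> Im \<tau> > 1/2"
proof -
  assume t: "\<tau> \<in> fund_domain"
  then have "Re \<tau> ^ 2 \<le> (1/2)^2" using power_mono[of "\<bar>Re \<tau>\<bar>" "1/2" 2] by (auto simp: fund_domain_def)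
  moreover have "Re \<tau> ^ 2 + Im \<tau> ^ 2 \<ge> 1"
    using t power_mono[of 1 "cmod \<tau>" 2] unfolding fund_domain_def cmod_power2[symmetric] by auto
  ultimately have "Im \<tau> ^ 2 > (1/2) ^ 2" by (simp add: power2_eq_square)
  then show ?thesis using t power2_less_imp_less[of "1/2" "Im \<tau>"] by (auto simp: fund_domain_def)
qed

text \<open>Representatives in the fundamental domain that lie outside the box \<open>K\<close> are
  so near the cusp that \<open>f\<close> is smaller there than at \<open>\<tau>0\<close>. So
  \<open>norm f\<close> has a maximum on the half plane, \<open>f\<close> is constant, and its limit
  at the cusp contradicts \<open>f \<tau>0 \<noteq> 0\<close>.\<close>

lemma invariant_cusp_form_zero:
  assumes hol: "f holomorphic_on upper_half"
    and inv: "\<And>\<mu> \<tau> \<tau>'. homothetic \<mu> \<tau> \<tau>' \<Longrightarrow> Im \<tau> > 0 \<Longrightarrow> Im \<tau>' > 0 \<Longrightarrow> f \<tau>' = f \<tau>"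
    and lim: "(f \<longlongrightarrow> 0) cusp" and \<tau>0: "Im \<tau>0 > 0"
  shows "f \<tau>0 = 0"
proof (rule ccontr)
  assume nz: "f \<tau>0 \<noteq> 0"
  have "eventually (\<lambda>\<tau>. norm (f \<tau>) < norm (f \<tau>0)) cusp"
    using lim nz tendsto_norm_zero[OF lim] order_tendstoD(2)[of "\<lambda>\<tau>. norm (f \<tau>)" 0 cusp "norm (f \<tau>0)"] by simp
  then obtain N where N: "\<And>\<tau>. Im \<tau> > N \<Longrightarrow> norm (f \<tau>) < norm (f \<tau>0)"
    unfolding eventually_filtercomap_at_top_dense by blast
  define K where "K = cbox (Complex (-1/2) (1/2)) (Complex (1/2) N)"
  have KH: "K \<subseteq> upper_half" by (auto simp: K_def in_cbox_complex_iff)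
  have rep: "\<exists>\<tau>'. \<tau>' \<in> fund_domain \<and> f \<tau>' = f \<tau>" if I: "Im \<tau> > 0" for \<tau>
  proof -
    obtain \<tau>' \<mu> where t: "\<tau>' \<in> fund_domain" "homothetic \<mu> \<tau> \<tau>'" by (rule exists_fund_domain[OF I])
    then have "Im \<tau>' > 0" by (simp add: fund_domain_def)
    then show ?thesis using inv[OF t(2) I] t(1) by blast
  qed
  have inK: "\<tau> \<in> K" if "\<tau> \<in> fund_domain" "norm (f \<tau>) \<ge> norm (f \<tau>0)" for \<tau>
    using that N[of \<tau>] fund_domain_Im[OF that(1)] by (auto simp: K_def in_cbox_complex_iff fund_domain_def not_less[symmetric])
  obtain \<tau>1 where \<tau>1: "\<tau>1 \<in> fund_domain" "f \<tau>1 = f \<tau>0" using rep[OF \<tau>0] by blast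
  then have "K \<noteq> {}" using inK[of \<tau>1] by auto
  moreover have "continuous_on K (\<lambda>z. norm (f z))"
    using hol KH by (intro continuous_intros holomorphic_on_imp_continuous_on) (rule holomorphic_on_subset)
  moreover have "compact K" unfolding K_def by simp
  ultimately obtain z where z: "z \<in> K" "\<And>y. y \<in> K \<Longrightarrow> norm (f y) \<le> norm (f z)"
    using continuous_attains_sup[of K "\<lambda>z. norm (f z)"] by blast
  have max: "norm (f \<tau>) \<le> norm (f z)" if I: "Im \<tau> > 0" for \<tau>
  proof -
    obtain \<tau>' where t: "\<tau>' \<in> fund_domain" "f \<tau>' = f \<tau>" using rep[OF I] by blast
    have z0: "norm (f \<tau>0) \<le> norm (f z)" using z(2)[OF inK[OF \<tau>1(1)]] \<tau>1(2) by simp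
    show ?thesis
    proof (cases "norm (f \<tau>') \<ge> norm (f \<tau>0)")
      case True then show ?thesis using z(2)[OF inK[OF t(1)]] t(2) by simp
    next
      case False then show ?thesis using z0 t(2) by simp
    qed
  qed
  have "f constant_on upper_half"
    by (rule maximum_modulus_principle[OF hol open_upper_half connected_upper_half open_upper_half order_refl, of z])
      (use KH z(1) max in auto)
  then obtain c where c: "\<And>\<tau>. Im \<tau> > 0 \<Longrightarrow> f \<tau> = c" unfolding constant_on_def by blast
  have "f (Complex 0 (max 1 (N + 1))) = f \<tau>0" using c \<tau>0 by simp
  then show False using N[of "Complex 0 (max 1 (N + 1))"] by (simp add: less_max_iff_disj)
qed

text \<open>If \<open>c\<close> were omitted, \<open>1 / (j - c)\<close> would be holomorphic,
  invariant and zero at the cusp, hence identically zero. Writing it with the discriminant in the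
  numerator makes the limit at the cusp visible.\<close>

lemma j_invariant_surj:
  obtains \<tau> where "Im \<tau> > 0" "j_invariant \<tau> = c"
proof -
  have "\<exists>\<tau>. Im \<tau> > 0 \<and> eisenstein 4 \<tau> ^ 3 - c * modular_discriminant \<tau> = 0"
  proof (rule ccontr)
    assume "\<not> ?thesis"
    then have nz: "eisenstein 4 \<tau> ^ 3 - c * modular_discriminant \<tau> \<noteq> 0" if "Im \<tau> > 0" for \<tau> using that by blast
    define f where "f = (\<lambda>\<tau>. modular_discriminant \<tau> / (eisenstein 4 \<tau> ^ 3 - c * modular_discriminant \<tau>))"
    have "f \<i> = 0"
    proof (rule invariant_cusp_form_zero[of f])
      show "f holomorphic_on upper_half" unfolding f_def using nz
        by (intro holomorphic_intros modular_discriminant_holomorphic eisenstein_holomorphic) auto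
    next
      fix \<mu> \<tau> \<tau>' assume h: "homothetic \<mu> \<tau> \<tau>'" "Im \<tau> > 0" "Im \<tau>' > 0"
      have "\<mu> \<noteq> 0" using h by (simp add: homothetic_def)
      have "eisenstein 4 \<tau> ^ 3 - c * modular_discriminant \<tau> = \<mu> ^ 12 * (eisenstein 4 \<tau>' ^ 3 - c * modular_discriminant \<tau>')"
        unfolding eisenstein_4_6_homogeneous[OF h] by (simp add: power_mult_distrib algebra_simps flip: power_mult)
      then show "f \<tau>' = f \<tau>" unfolding f_def eisenstein_4_6_homogeneous(3)[OF h] using \<open>\<mu> \<noteq> 0\<close> by simp
    next
      have d: "(modular_discriminant \<longlongrightarrow> (1 ^ 3 - 1 ^ 2) / 1728) cusp"
        unfolding modular_discriminant_def[abs_def] by (intro tendsto_intros eisenstein_cusp) auto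
      then have "(f \<longlongrightarrow> (1 ^ 3 - 1 ^ 2) / 1728 / (1 ^ 3 - c * ((1 ^ 3 - 1 ^ 2) / 1728))) cusp"
        unfolding f_def by (intro tendsto_intros eisenstein_cusp) auto
      then show "(f \<longlongrightarrow> 0) cusp" by simp
    qed simp
    then show False using nz[of \<i>] modular_discriminant_nonzero[of \<i>] by (simp add: f_def)
  qed
  then obtain \<tau> where \<tau>: "Im \<tau> > 0" "eisenstein 4 \<tau> ^ 3 - c * modular_discriminant \<tau> = 0" by blast
  then have "j_invariant \<tau> = c" using modular_discriminant_nonzero[OF \<tau>(1)] by (simp add: j_invariant_def)
  then show ?thesis using that \<tau>(1) by blast
qed

section \<open>Zeros of the Eisenstein series\<close>

text \<open>The second summand measures how far the derivative is from being modular; it is designed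
  to cancel in \<open>eis_bracket\<close>. The weight is written \<open>Suc k\<close> so that
  differentiating its power needs no subtraction.\<close>

lemma deriv_moebius:
  fixes a b c d :: int
  assumes f: "f holomorphic_on upper_half" and det: "a * d - b * c = 1"
    and trans: "\<And>\<tau>. Im \<tau> > 0 \<Longrightarrow> f ((of_int a * \<tau> + of_int b) / (of_int c * \<tau> + of_int d)) = (of_int c * \<tau> + of_int d) ^ Suc k * f \<tau>"
    and \<tau>: "Im \<tau> > 0"
  defines "J \<equiv> of_int c * \<tau> + of_int d"
  shows "deriv f ((of_int a * \<tau> + of_int b) / J) = J ^ (k + 3) * deriv f \<tau> + of_nat (Suc k) * of_int c * J ^ (k + 2) * f \<tau>"
proof -
  define g where "g = (\<lambda>\<tau>. (of_int a * \<tau> + of_int b) / (of_int c * \<tau> + of_int d) :: complex)"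
  have J0: "J \<noteq> 0" unfolding J_def using lat_moebius(1)[OF det \<tau>] .
  have fd: "(f has_field_derivative deriv f z) (at z)" if "Im z > 0" for z
    using holomorphic_derivI[OF f open_upper_half] that by simp
  have "(g has_field_derivative (of_int a * J - (of_int a * \<tau> + of_int b) * of_int c) / (J * J)) (at \<tau>)"
    unfolding g_def J_def using J0 by (auto intro!: derivative_eq_intros simp: J_def)
  also have "of_int a * J - (of_int a * \<tau> + of_int b) * of_int c = of_int (a * d - b * c)"
    by (simp add: J_def algebra_simps)
  finally have g: "(g has_field_derivative 1 / (J * J)) (at \<tau>)" by (simp add: det)
  have "Im (g \<tau>) > 0" unfolding g_def using lat_moebius(3)[OF det \<tau>] .
  from DERIV_chain[OF fd[OF this] g] have 1: "((\<lambda>\<tau>. f (g \<tau>)) has_field_derivative deriv f (g \<tau>) * (1 / (J * J))) (at \<tau>)"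
    by (simp add: o_def)
  have "((\<lambda>\<tau>. (of_int c * \<tau> + of_int d) ^ Suc k * f \<tau>) has_field_derivative
     of_nat (Suc k) * J ^ k * of_int c * f \<tau> + J ^ Suc k * deriv f \<tau>) (at \<tau>)"
    unfolding J_def by (rule derivative_eq_intros fd[OF \<tau>] refl)+ (simp add: algebra_simps)
  then have "((\<lambda>\<tau>. f (g \<tau>)) has_field_derivative of_nat (Suc k) * J ^ k * of_int c * f \<tau> + J ^ Suc k * deriv f \<tau>) (at \<tau>)"
    by (rule has_field_derivative_transform_within_open[OF _ open_upper_half]) (use \<tau> trans in \<open>auto simp: g_def\<close>)
  from DERIV_unique[OF 1 this] have "deriv f (g \<tau>) = (of_nat (Suc k) * J ^ k * of_int c * f \<tau> + J ^ Suc k * deriv f \<tau>) * (J * J)"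
    using J0 by (simp add: field_simps)
  then show ?thesis unfolding g_def J_def[symmetric] by (simp add: algebra_simps power_add power3_eq_cube power2_eq_square)
qed

text \<open>Half of the first Rankin-Cohen bracket of \<open>E_4\<close> and \<open>E_6\<close>; the
  extra terms \<open>12 c E_4 E_6\<close> of the two derivatives cancel, leaving weight 12.\<close>

definition eis_bracket :: "complex \<Rightarrow> complex" where
  "eis_bracket \<tau> = 2 * eisenstein 4 \<tau> * deriv (eisenstein 6) \<tau> - 3 * deriv (eisenstein 4) \<tau> * eisenstein 6 \<tau>"

lemma eis_bracket_homogeneous:
  assumes h: "homothetic \<mu> \<tau> \<tau>'" and \<tau>: "Im \<tau> > 0" "Im \<tau>' > 0"
  shows "eis_bracket \<tau> = \<mu> ^ 12 * eis_bracket \<tau>'"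
proof -
  obtain a b c d :: int where det: "a * d - b * c = 1" and mu: "\<mu> = 1 / (of_int c * \<tau> + of_int d)"
    and t': "\<tau>' = (of_int a * \<tau> + of_int b) / (of_int c * \<tau> + of_int d)"
    by (rule homothetic_imp_moebius[OF h \<tau>])
  define J where "J = of_int c * \<tau> + of_int d"
  have J0: "J \<noteq> 0" unfolding J_def using lat_moebius(1)[OF det \<tau>(1)] .
  have tr: "eisenstein 4 ((of_int a * \<sigma> + of_int b) / (of_int c * \<sigma> + of_int d)) = (of_int c * \<sigma> + of_int d) ^ Suc 3 * eisenstein 4 \<sigma>"
    "eisenstein 6 ((of_int a * \<sigma> + of_int b) / (of_int c * \<sigma> + of_int d)) = (of_int c * \<sigma> + of_int d) ^ Suc 5 * eisenstein 6 \<sigma>"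
    if s: "Im \<sigma> > 0" for \<sigma>
  proof -
    note m = lat_moebius[OF det s]
    note e = eisenstein_4_6_homogeneous[OF homothetic_moebius[OF det s] s m(3)]
    show "eisenstein 4 ((of_int a * \<sigma> + of_int b) / (of_int c * \<sigma> + of_int d)) = (of_int c * \<sigma> + of_int d) ^ Suc 3 * eisenstein 4 \<sigma>"
      using m(1) by (simp add: e(1) power_divide)
    show "eisenstein 6 ((of_int a * \<sigma> + of_int b) / (of_int c * \<sigma> + of_int d)) = (of_int c * \<sigma> + of_int d) ^ Suc 5 * eisenstein 6 \<sigma>"
      using m(1) by (simp add: e(2) power_divide)
  qed
  have e4: "eisenstein 4 \<tau>' = J ^ 4 * eisenstein 4 \<tau>" and e6: "eisenstein 6 \<tau>' = J ^ 6 * eisenstein 6 \<tau>"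
    using tr[OF \<tau>(1)] by (simp_all add: t' J_def)
  have d4: "deriv (eisenstein 4) \<tau>' = J ^ 6 * deriv (eisenstein 4) \<tau> + 4 * of_int c * J ^ 5 * eisenstein 4 \<tau>"
    using deriv_moebius[OF eisenstein_holomorphic det tr(1) \<tau>(1)] unfolding t' J_def by simp
  have d6: "deriv (eisenstein 6) \<tau>' = J ^ 8 * deriv (eisenstein 6) \<tau> + 6 * of_int c * J ^ 7 * eisenstein 6 \<tau>"
    using deriv_moebius[OF eisenstein_holomorphic det tr(2) \<tau>(1)] unfolding t' J_def by simp
  have "eis_bracket \<tau>' = J ^ 12 * eis_bracket \<tau>"
    unfolding eis_bracket_def e4 e6 d4 d6 by (simp add: algebra_simps flip: power_add)
  then show ?thesis using J0 mu unfolding J_def[symmetric] by (simp add: power_divide)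
qed

lemma deriv_eisenstein:
  assumes "Im \<tau> > 0" shows "deriv (eisenstein k) \<tau> = deriv (eis_disc k) (nome \<tau>) * (tpi * nome \<tau>)"
proof -
  have 1: "(eis_disc k has_field_derivative deriv (eis_disc k) (nome \<tau>)) (at (nome \<tau>))"
    by (rule holomorphic_derivI[OF eis_disc_holomorphic open_ball]) (use norm_nome_less[OF assms] in simp)
  have 2: "(nome has_field_derivative tpi * nome \<tau>) (at \<tau>)"
    by (auto intro!: derivative_eq_intros)
  from DERIV_chain[OF 1 2] show ?thesis
    by (intro DERIV_imp_deriv) (simp add: o_def eisenstein_eq[abs_def])
qed

lemma eis_disc_deriv_values: "deriv (eis_disc 4) 0 = 240" "deriv (eis_disc 6) 0 = -504"
  by (simp_all add: deriv_eis_disc_0 bernoulli_values of_rat_divide of_rat_minus)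

lemma delta_disc_deriv: "(delta_disc has_field_derivative 1) (at 0)"
proof -
  have "(eis_disc k has_field_derivative deriv (eis_disc k) 0) (at 0)" for k
    by (rule holomorphic_derivI[OF eis_disc_holomorphic open_ball]) simp
  then have d: "(eis_disc 4 has_field_derivative 240) (at 0)" "(eis_disc 6 has_field_derivative -504) (at 0)"
    using eis_disc_deriv_values by metis+
  show ?thesis unfolding delta_disc_def[abs_def]
    by (rule derivative_eq_intros d refl | simp)+
qed

text \<open>The quotient by the discriminant is holomorphic of weight 0, hence constant. Its value
  at the cusp is \<open>2 * (-504) - 3 * 240 = -1728\<close> times \<open>tpi\<close>, which comes
  from differentiating the nome.\<close>

lemma eis_bracket_eq:
  assumes \<tau>: "Im \<tau> > 0" shows "eis_bracket \<tau> = - (1728 * tpi) * modular_discriminant \<tau>"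
proof -
  define C where "C = - (1728 * tpi)"
  define f where "f = (\<lambda>\<tau>. eis_bracket \<tau> / modular_discriminant \<tau> - C)"
  have "f \<tau> = 0"
  proof (rule invariant_cusp_form_zero[of f, OF _ _ _ \<tau>])
    show "f holomorphic_on upper_half" unfolding f_def eis_bracket_def
      using modular_discriminant_nonzero
      by (intro holomorphic_intros modular_discriminant_holomorphic eisenstein_holomorphic holomorphic_deriv open_upper_half) auto
  next
    fix \<mu> \<tau> \<tau>' assume h: "homothetic \<mu> \<tau> \<tau>'" "Im \<tau> > 0" "Im \<tau>' > 0"
    then have "\<mu> \<noteq> 0" by (simp add: homothetic_def)
    then show "f \<tau>' = f \<tau>" unfolding f_def eis_bracket_homogeneous[OF h] eisenstein_4_6_homogeneous(3)[OF h] by simp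
  next
    \<comment> \<open>Bracket and discriminant both vanish at the cusp, so each is divided by the
      nome before passing to the limit.\<close>
    have "((\<lambda>q. (delta_disc q - delta_disc 0) / (q - 0)) \<longlongrightarrow> 1) (at 0)"
      using delta_disc_deriv unfolding has_field_derivative_iff .
    then have q1: "((\<lambda>q. delta_disc q / q) \<longlongrightarrow> 1) (at 0)" by (simp add: delta_disc_def)
    have "filterlim nome (at 0) cusp" using nome_cusp by (simp add: filterlim_at)
    then have l1: "((\<lambda>\<tau>. delta_disc (nome \<tau>) / nome \<tau>) \<longlongrightarrow> 1) cusp" using q1 by (rule filterlim_compose[rotated])
    have dh: "deriv (eis_disc k) holomorphic_on ball 0 1" for k by (intro holomorphic_deriv eis_disc_holomorphic) auto
    have l2: "((\<lambda>\<tau>. tpi * (2 * eis_disc 4 (nome \<tau>) * deriv (eis_disc 6) (nome \<tau>) - 3 * deriv (eis_disc 4) (nome \<tau>) * eis_disc 6 (nome \<tau>)))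
       \<longlongrightarrow> tpi * (2 * eis_disc 4 0 * deriv (eis_disc 6) 0 - 3 * deriv (eis_disc 4) 0 * eis_disc 6 0)) cusp"
      by (intro tendsto_intros disc_tendsto_cusp eis_disc_holomorphic dh)
    have "((\<lambda>\<tau>. tpi * (2 * eis_disc 4 (nome \<tau>) * deriv (eis_disc 6) (nome \<tau>) - 3 * deriv (eis_disc 4) (nome \<tau>) * eis_disc 6 (nome \<tau>))
       / (delta_disc (nome \<tau>) / nome \<tau>) - C) \<longlongrightarrow> tpi * (2 * eis_disc 4 0 * deriv (eis_disc 6) 0 - 3 * deriv (eis_disc 4) 0 * eis_disc 6 0) / 1 - C) cusp"
      by (intro tendsto_intros l1 l2) simp
    also have "tpi * (2 * eis_disc 4 0 * deriv (eis_disc 6) 0 - 3 * deriv (eis_disc 4) 0 * eis_disc 6 0) / 1 - C = 0"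
      by (simp add: eis_disc_deriv_values C_def)
    finally have lim: "((\<lambda>\<tau>. tpi * (2 * eis_disc 4 (nome \<tau>) * deriv (eis_disc 6) (nome \<tau>) - 3 * deriv (eis_disc 4) (nome \<tau>) * eis_disc 6 (nome \<tau>))
       / (delta_disc (nome \<tau>) / nome \<tau>) - C) \<longlongrightarrow> 0) cusp" .
    have ev: "eventually (\<lambda>\<tau>. tpi * (2 * eis_disc 4 (nome \<tau>) * deriv (eis_disc 6) (nome \<tau>) - 3 * deriv (eis_disc 4) (nome \<tau>) * eis_disc 6 (nome \<tau>))
       / (delta_disc (nome \<tau>) / nome \<tau>) - C = f \<tau>) cusp"
    proof -
      have "eventually (\<lambda>\<tau>. Im \<tau> > 0) cusp" unfolding eventually_filtercomap_at_top_dense by blast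
      then show ?thesis
      proof eventually_elim
        case (elim \<tau>)
        show ?case unfolding f_def eis_bracket_def deriv_eisenstein[OF elim] modular_discriminant_eq unfolding eisenstein_eq
          by (simp add: algebra_simps)
      qed
    qed
    show "(f \<longlongrightarrow> 0) cusp" by (rule Lim_transform_eventually[OF lim ev])
  qed
  then have "eis_bracket \<tau> = C * modular_discriminant \<tau>"
    using modular_discriminant_nonzero[OF \<tau>] by (simp add: f_def divide_eq_eq)
  then show ?thesis by (simp only: C_def)
qed

text \<open>The quotient rule gives the derivative
  \<open>E_4^2 E_6 * eis_bracket / (1728 \<Delta>^2)\<close>. By \<open>eis_bracket_eq\<close> it
  vanishes only with \<open>E_4\<close> or \<open>E_6\<close>, that is for \<open>j = 0\<close> or
  \<open>j = 1728\<close>.\<close>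

lemma j_invariant_deriv:
  assumes \<tau>: "Im \<tau> > 0" and j: "j_invariant \<tau> \<noteq> 0" "j_invariant \<tau> \<noteq> 1728"
  obtains D where "D \<noteq> 0" "(j_invariant has_field_derivative D) (at \<tau>)"
proof -
  define a b a' b' M where "a = eisenstein 4 \<tau>" "b = eisenstein 6 \<tau>" "a' = deriv (eisenstein 4) \<tau>" "b' = deriv (eisenstein 6) \<tau>"
    "M = modular_discriminant \<tau>"
  note defs = a_b_a'_b'_M_def
  have M0: "M \<noteq> 0" using modular_discriminant_nonzero[OF \<tau>] by (simp add: defs)
  have M: "1728 * M = a ^ 3 - b ^ 2" by (simp add: defs modular_discriminant_def diff_divide_distrib)
  have a0: "a \<noteq> 0" using j(1) by (auto simp: j_invariant_def defs)
  have b0: "b \<noteq> 0"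
  proof
    assume "b = 0"
    then have "j_invariant \<tau> = 1728" using M M0 by (simp add: j_invariant_def defs[symmetric] divide_eq_eq)
    then show False using j(2) by simp
  qed
  have ed: "(eisenstein k has_field_derivative deriv (eisenstein k) \<tau>) (at \<tau>)" for k
    by (rule holomorphic_derivI[OF eisenstein_holomorphic open_upper_half]) (use \<tau> in simp)
  have Md: "(modular_discriminant has_field_derivative (3 * a^2 * a' - 2 * b * b') / 1728) (at \<tau>)"
    unfolding modular_discriminant_def[abs_def] defs
    by (rule derivative_eq_intros ed refl | simp)+
  have jd: "(j_invariant has_field_derivative (3 * a^2 * a' * M - a^3 * ((3 * a^2 * a' - 2 * b * b') / 1728)) / (M * M)) (at \<tau>)"
    unfolding j_invariant_def[abs_def] 
    by (rule derivative_eq_intros ed Md refl | use M0 in \<open>simp add: defs\<close>)+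
  have "3 * a^2 * a' * M - a^3 * ((3 * a^2 * a' - 2 * b * b') / 1728) = (3 * a^2 * a' * (1728 * M) - a^3 * (3 * a^2 * a' - 2 * b * b')) / 1728"
    by (simp add: field_simps)
  also have "3 * a^2 * a' * (1728 * M) - a^3 * (3 * a^2 * a' - 2 * b * b') = a^2 * b * (2 * a * b' - 3 * a' * b)"
    unfolding M by (simp add: algebra_simps power2_eq_square power3_eq_cube)
  also have "2 * a * b' - 3 * a' * b = - (1728 * tpi) * M"
    using eis_bracket_eq[OF \<tau>] by (simp add: eis_bracket_def defs)
  finally have "(3 * a^2 * a' * M - a^3 * ((3 * a^2 * a' - 2 * b * b') / 1728)) / (M * M) \<noteq> 0"
    using a0 b0 M0 by simp
  then show ?thesis using that jd by blast
qed

text \<open>The constant is \<open>256^n\<close> over the cusp value of \<open>wp_norm\<close>. The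
  condition \<open>E_4 \<noteq> 0\<close> stems from dehomogenising and holds at all zeros counted
  in \<open>phi_poly\<close>, where \<open>j \<noteq> 0\<close>.\<close>

lemma eisenstein_factor:
  fixes l :: nat
  defines "n \<equiv> 2 ^ l"
  obtains C where "C \<noteq> 0"
    "\<And>\<tau>. Im \<tau> > 0 \<Longrightarrow> eisenstein 4 \<tau> \<noteq> 0 \<Longrightarrow>
      eisenstein (12 * n) \<tau> = C * modular_discriminant \<tau> ^ n * poly (cpoly (wp_qpoly n)) (j_invariant \<tau> / 256)"
proof -
  have n1: "n \<ge> 1" by (simp add: n_def)
  define c where "c = wp_norm 0 (6 * n)"
  have c: "c = of_rat (coeff (wp_qpoly n) n)" unfolding c_def using wp_norm_0_qpoly[OF n1] .
  have "wp_qpoly n \<noteq> 0" using irreducible_wp_qpoly[of l] unfolding n_def irreducible_def by blast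
  then have "coeff (wp_qpoly n) n \<noteq> 0" by (metis degree_wp_qpoly leading_coeff_0_iff n_def)
  then have c0: "c \<noteq> 0" unfolding c by simp
  \<comment> \<open>A vanishing Bernoulli number would annihilate the constant term of
    \<open>wp_norm\<close>, which is the leading coefficient of \<open>wp_qpoly n\<close>.\<close>
  have "bernoulli (2 * (6 * n)) \<noteq> 0"
  proof
    assume "bernoulli (2 * (6 * n)) = 0"
    then have "c = 0" unfolding c_def using n1 by (subst wp_norm_eq) auto
    then show False using c0 by simp
  qed
  then have E: "wp_norm q (6 * n) = c * eis_disc (12 * n) q" for q
    using wp_norm_eisenstein[of "6 * n" q] n1 unfolding c_def by simp
  show ?thesis
  proof (rule that[of "256 ^ n / c"])
    show "256 ^ n / c \<noteq> 0" using c0 by simp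
    fix \<tau> assume \<tau>: "Im \<tau> > 0" "eisenstein 4 \<tau> \<noteq> 0"
    have "c * eis_disc (12 * n) (nome \<tau>) = (256 * delta_disc (nome \<tau>)) ^ n * poly (cpoly (wp_qpoly n)) (eis_disc 4 (nome \<tau>) ^ 3 / (256 * delta_disc (nome \<tau>)))"
      unfolding E[symmetric] using \<tau> modular_discriminant_nonzero[OF \<tau>(1)] norm_nome_less[OF \<tau>(1)] n1
      by (intro wp_norm_qpoly) (auto simp: eisenstein_eq modular_discriminant_eq)
    also have "eis_disc 4 (nome \<tau>) ^ 3 / (256 * delta_disc (nome \<tau>)) = j_invariant \<tau> / 256"
      by (simp add: j_invariant_def eisenstein_eq modular_discriminant_eq)
    finally show "eisenstein (12 * n) \<tau> = 256 ^ n / c * modular_discriminant \<tau> ^ n * poly (cpoly (wp_qpoly n)) (j_invariant \<tau> / 256)"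
      using c0 by (simp add: eisenstein_eq modular_discriminant_eq power_mult_distrib field_simps)
  qed
qed

section \<open>Separability, and the passage from \<open>j / 256\<close> to \<open>j\<close>\<close>

lemma irreducible_imp_cpoly_separable:
  assumes "irreducible (p :: rat poly)" and "poly (cpoly p) x = 0"
  shows "poly (cpoly (pderiv p)) x \<noteq> 0"
proof
  assume d: "poly (cpoly (pderiv p)) x = 0"
  have p0: "p \<noteq> 0" using assms(1) by auto
  have deg: "degree p > 0"
  proof (rule ccontr)
    assume "\<not> degree p > 0"
    then show False using assms(1) p0 is_unit_iff_degree[of p] by (auto simp: irreducible_def)
  qed
  have pd0: "pderiv p \<noteq> 0" using deg by (simp add: pderiv_eq_0_iff)
  \<comment> \<open>A nonzero rational polynomial of least degree vanishing at \<open>x\<close>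
    divides \<open>p\<close> by division with remainder, so irreducibility gives it the degree of
    \<open>p\<close>; the derivative of \<open>p\<close> would undercut this degree.\<close>
  define N where "N = (\<lambda>k. \<exists>q. q \<noteq> 0 \<and> degree q = k \<and> poly (cpoly q) x = 0)"
  have "N (degree p)" using p0 assms(2) by (auto simp: N_def)
  then have "N (LEAST k. N k)" by (rule LeastI)
  then obtain q where q: "q \<noteq> 0" "degree q = (LEAST k. N k)" "poly (cpoly q) x = 0" unfolding N_def by blast
  have min: "degree q \<le> degree r" if "r \<noteq> 0" "poly (cpoly r) x = 0" for r
    unfolding q(2) by (rule Least_le) (use that in \<open>auto simp: N_def\<close>)
  have "cpoly p = cpoly q * cpoly (p div q) + cpoly (p mod q)"
    by (metis cpoly_add cpoly_mult mult_div_mod_eq)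
  then have "poly (cpoly p) x = poly (cpoly q * cpoly (p div q) + cpoly (p mod q)) x" by simp
  then have "poly (cpoly (p mod q)) x = 0" using assms(2) q(3) by simp
  then have "p mod q = 0" using min[of "p mod q"] degree_mod_less[OF q(1), of p] by linarith
  then have "q dvd p" by (simp add: mod_eq_0_iff_dvd)
  then obtain r where r: "p = q * r" by (rule dvdE)
  have "degree q \<noteq> 0"
  proof
    assume "degree q = 0"
    then obtain c where "q = [:c:]" by (rule degree_eq_zeroE)
    then show False using q by (simp add: cpoly_pCons)
  qed
  then have "\<not> is_unit q" using is_unit_iff_degree[OF q(1)] by simp
  then have "is_unit r" using irreducibleD[OF assms(1) r] by blast
  moreover have r0: "r \<noteq> 0" using p0 r by auto
  ultimately have "degree r = 0" using is_unit_iff_degree[OF r0] by simp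
  then have "degree p = degree q" using r p0 by (simp add: degree_mult_eq)
  then show False using min[OF pd0 d] deg by (simp add: degree_pderiv)
qed

lemma cpoly_pderiv: "cpoly (pderiv p) = pderiv (cpoly p)"
  by (rule poly_eqI) (simp only: coeff_pderiv coeff_cpoly of_rat_mult of_rat_of_nat_eq)

text \<open>The substitution is undone by \<open>[:0, 1/c:]\<close>, so a factorisation of the image
  pulls back to one of \<open>Q\<close> with the same degrees.\<close>

lemma irreducible_smult_pcompose:
  assumes "irreducible (Q :: rat poly)" "c \<noteq> 0" "d \<noteq> 0"
  shows "irreducible (smult d (pcompose Q [:0, c:]))"
proof -
  have deg: "degree (pcompose R [:0, k:]) = degree R" if "k \<noteq> 0" for R :: "rat poly" and k
    using that by (simp add: degree_pcompose)
  have inv: "pcompose (pcompose R [:0, c:]) [:0, 1/c:] = R" for R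
    using assms(2) by (simp add: pcompose_assoc[symmetric] pcompose_pCons)
  have u: "is_unit R \<longleftrightarrow> R \<noteq> 0 \<and> degree R = 0" for R :: "rat poly" by (cases "R = 0") (auto simp: is_unit_iff_degree)
  have Q: "Q \<noteq> 0" "degree Q \<noteq> 0" using assms(1) u[of Q] by (auto simp: irreducible_def)
  show ?thesis
  proof (rule irreducibleI)
    show "smult d (pcompose Q [:0, c:]) \<noteq> 0"
    proof
      assume "smult d (pcompose Q [:0, c:]) = 0"
      then have "degree (pcompose Q [:0, c:]) = 0" using assms(3) by simp
      then show False using deg[OF assms(2)] Q by simp
    qed
    show "\<not> is_unit (smult d (pcompose Q [:0, c:]))" unfolding u using deg[OF assms(2)] Q assms(3) by simp
    fix f g assume fg: "smult d (pcompose Q [:0, c:]) = f * g"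
    have "pcompose (smult d (pcompose Q [:0, c:])) [:0, 1/c:] = pcompose f [:0, 1/c:] * pcompose g [:0, 1/c:]"
      unfolding fg by (rule pcompose_mult)
    then have "Q = smult (1/d) (pcompose f [:0, 1/c:]) * pcompose g [:0, 1/c:]"
      using assms(3) by (simp add: pcompose_smult inv) (metis divide_self_if inverse_eq_divide left_inverse mult_smult_left smult_1_left smult_smult)
    then have "is_unit (smult (1/d) (pcompose f [:0, 1/c:])) \<or> is_unit (pcompose g [:0, 1/c:])"
      using assms(1) by (metis irreducibleD)
    moreover have "f \<noteq> 0" "g \<noteq> 0" using fg \<open>smult d (pcompose Q [:0, c:]) \<noteq> 0\<close> by auto
    ultimately show "is_unit f \<or> is_unit g" unfolding u using deg[of "1/c"] assms by auto
  qed
qed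

theorem theorem1p1:
  fixes l :: nat
  shows "\<exists>p :: rat poly. map_poly of_rat p = phi_poly (12 * 2 ^ l) \<and> irreducible p"
proof -
  define n :: nat where "n = 2 ^ l"
  define Q where "Q = wp_qpoly n"
  define R where "R = pcompose Q [:0, 1/256:]"
  \<comment> \<open>The product defining \<open>phi_poly\<close> is monic, so the candidate has to
    be normalised.\<close>
  define p where "p = smult (1 / lead_coeff R) R"
  have irrQ: "irreducible Q" unfolding Q_def n_def by (rule irreducible_wp_qpoly)
  have "irreducible (smult 1 R)" unfolding R_def using irrQ by (intro irreducible_smult_pcompose) auto
  then have R0: "R \<noteq> 0" by auto
  then have irr: "irreducible p" unfolding p_def R_def using irrQ by (intro irreducible_smult_pcompose) auto
  have monic: "lead_coeff (cpoly p) = 1" using R0 by (simp add: p_def)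
  have pR: "poly (cpoly p) x = of_rat (1 / lead_coeff R) * poly (cpoly Q) (x / 256)" for x
  proof -
    have "cpoly R = pcompose (cpoly Q) [:0, 1/256:]"
      unfolding R_def by (induction Q) (simp_all add: pcompose_pCons cpoly_add cpoly_mult cpoly_pCons cpoly_smult of_rat_divide)
    then show ?thesis by (simp add: p_def cpoly_smult poly_pcompose)
  qed
  have rootQ: "poly (cpoly Q) (x / 256) = 0 \<longleftrightarrow> poly (cpoly p) x = 0" for x using R0 by (simp add: pR)
  have ev: "poly (cpoly Q) (of_rat r) = of_rat (poly Q r)" for r
    by (induction Q) (simp_all add: cpoly_pCons of_rat_add of_rat_mult)
  have not0: "poly (cpoly p) 0 \<noteq> 0"
    using ev[of 0] poly_wp_qpoly_0[of l] R0 by (simp add: pR Q_def n_def)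
  \<comment> \<open>\<open>27/4\<close> is \<open>1728/256\<close>. Since neither 0 nor 1728 is a
    root of \<open>p\<close>, excluding these values in \<open>phi_poly\<close> loses no
    root.\<close>
  have e27: "of_rat (27/4) = (27/4 :: complex)" by (simp add: of_rat_divide)
  have not1728: "poly (cpoly p) 1728 \<noteq> 0"
    using ev[of "27/4"] poly_wp_qpoly_27_4[of l] R0 unfolding e27 by (simp add: pR Q_def n_def)
  obtain C where C: "C \<noteq> 0" "\<And>\<tau>. Im \<tau> > 0 \<Longrightarrow> eisenstein 4 \<tau> \<noteq> 0 \<Longrightarrow>
      eisenstein (12 * n) \<tau> = C * modular_discriminant \<tau> ^ n * poly (cpoly Q) (j_invariant \<tau> / 256)"
    using eisenstein_factor[of l] unfolding n_def Q_def by blast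
  define K where "K = C / of_rat (1 / lead_coeff R)"
  have K: "K \<noteq> 0" "\<And>\<tau>. Im \<tau> > 0 \<Longrightarrow> eisenstein 4 \<tau> \<noteq> 0 \<Longrightarrow>
      eisenstein (12 * n) \<tau> = K * modular_discriminant \<tau> ^ n * poly (cpoly p) (j_invariant \<tau>)"
    using C R0 by (simp_all add: K_def pR)
  define Z where "Z = {z\<in>fund_domain. eisenstein (12 * n) z = 0 \<and> j_invariant z \<noteq> 0 \<and> j_invariant z \<noteq> 1728}"
  have e4: "eisenstein 4 z \<noteq> 0" if "j_invariant z \<noteq> 0" for z using that by (auto simp: j_invariant_def)
  have Zroot: "z \<in> Z \<longleftrightarrow> z \<in> fund_domain \<and> poly (cpoly p) (j_invariant z) = 0" for z
  proof
    assume z: "z \<in> Z"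
    then have "Im z > 0" by (simp add: Z_def fund_domain_def)
    then show "z \<in> fund_domain \<and> poly (cpoly p) (j_invariant z) = 0"
      using z K(2)[of z] K(1) e4[of z] modular_discriminant_nonzero[of z] by (auto simp: Z_def)
  next
    assume z: "z \<in> fund_domain \<and> poly (cpoly p) (j_invariant z) = 0"
    then have "j_invariant z \<noteq> 0" "j_invariant z \<noteq> 1728" using not0 not1728 by auto
    then show "z \<in> Z" using z K(2)[of z] e4[of z] by (auto simp: Z_def fund_domain_def)
  qed
  \<comment> \<open>Together with \<open>img\<close> this makes \<open>j_invariant\<close> a
    bijection from the zeros in the fundamental domain to the roots of \<open>p\<close>.\<close>
  have inj: "inj_on j_invariant Z"
  proof (rule inj_onI)
    fix z w assume zw: "z \<in> Z" "w \<in> Z" "j_invariant z = j_invariant w"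
    then have F: "z \<in> fund_domain" "w \<in> fund_domain" "Im z > 0" "Im w > 0" by (auto simp: Z_def fund_domain_def)
    obtain \<mu> where "homothetic \<mu> z w" using j_invariant_inj[OF F(3,4) zw(3)] .
    then show "z = w" by (rule fund_domain_unique[OF F(1,2)])
  qed
  have img: "j_invariant ` Z = {x. poly (cpoly p) x = 0}"
  proof (intro equalityI subsetI)
    fix x assume "x \<in> j_invariant ` Z" then show "x \<in> {x. poly (cpoly p) x = 0}" using Zroot by auto
  next
    fix x assume x: "x \<in> {x. poly (cpoly p) x = 0}"
    obtain \<tau> where \<tau>: "Im \<tau> > 0" "j_invariant \<tau> = x" by (rule j_invariant_surj)
    obtain z \<mu> where z: "z \<in> fund_domain" "homothetic \<mu> \<tau> z" by (rule exists_fund_domain[OF \<tau>(1)])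
    then have "Im z > 0" by (simp add: fund_domain_def)
    then have "j_invariant z = x" using j_invariant_homothetic[OF z(2) \<tau>(1)] \<tau>(2) by simp
    then show "x \<in> j_invariant ` Z" using x z(1) Zroot[of z] by auto
  qed
  have ord: "zorder (eisenstein (12 * n)) z = 1" if z: "z \<in> Z" for z
  proof -
    have z': "Im z > 0" "j_invariant z \<noteq> 0" "j_invariant z \<noteq> 1728" "eisenstein (12 * n) z = 0" 
      using z by (auto simp: Z_def fund_domain_def)
    have root: "poly (cpoly p) (j_invariant z) = 0" using z Zroot by blast
    obtain D where D: "D \<noteq> 0" "(j_invariant has_field_derivative D) (at z)"
      by (rule j_invariant_deriv[OF z'(1,2,3)])
    define M where "M = (\<lambda>\<tau>. K * modular_discriminant \<tau> ^ n)"
    have "M holomorphic_on upper_half" unfolding M_def by (intro holomorphic_intros modular_discriminant_holomorphic)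
    then have Md: "(M has_field_derivative deriv M z) (at z)"
      by (rule holomorphic_derivI[OF _ open_upper_half]) (use z' in simp)
    have Pd: "((\<lambda>\<tau>. poly (cpoly p) (j_invariant \<tau>)) has_field_derivative poly (pderiv (cpoly p)) (j_invariant z) * D) (at z)"
      using DERIV_chain2[OF poly_DERIV D(2)] .
    have d: "((\<lambda>\<tau>. M \<tau> * poly (cpoly p) (j_invariant \<tau>)) has_field_derivative M z * (poly (pderiv (cpoly p)) (j_invariant z) * D)) (at z)"
      using DERIV_mult[OF Md Pd] by (simp add: root mult.commute)
    \<comment> \<open>The factorisation is known only where \<open>E_4\<close> does not vanish, an
      open set containing \<open>z\<close>, which suffices for differentiating at
      \<open>z\<close>.\<close>
    define S where "S = upper_half \<inter> eisenstein 4 -` (- {0})"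
    have "open S" unfolding S_def
      by (rule continuous_open_preimage[OF holomorphic_on_imp_continuous_on[OF eisenstein_holomorphic] open_upper_half]) auto
    have zS: "z \<in> S" using z' e4 by (simp add: S_def)
    have "(eisenstein (12 * n) has_field_derivative M z * (poly (pderiv (cpoly p)) (j_invariant z) * D)) (at z)"
      by (rule has_field_derivative_transform_within_open[OF d \<open>open S\<close> zS]) (use K(2) in \<open>auto simp: S_def M_def\<close>)
    then have der: "deriv (eisenstein (12 * n)) z = M z * (poly (pderiv (cpoly p)) (j_invariant z) * D)"
      by (rule DERIV_imp_deriv)
    \<comment> \<open>At a root the product rule leaves one term. Its factors are nonzero because
      the discriminant has no zeros, \<open>p\<close> is separable, and \<open>j\<close> is
      unramified off 0 and 1728; so the zero is simple.\<close>
    have "deriv (eisenstein (12 * n)) z \<noteq> 0"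
      unfolding der using K(1) D(1) modular_discriminant_nonzero[OF z'(1)] irreducible_imp_cpoly_separable[OF irr root]
      by (simp add: M_def cpoly_pderiv)
    then show ?thesis
      by (intro zorder_zero_eqI[OF eisenstein_holomorphic open_upper_half]) (use z' in auto)
  qed
  have "phi_poly (12 * n) = (\<Prod>z\<in>Z. [:- j_invariant z, 1:] ^ nat (zorder (eisenstein (12 * n)) z))"
    unfolding phi_poly_def Z_def ..
  also have "\<dots> = (\<Prod>z\<in>Z. [:- j_invariant z, 1:])" using ord by (intro prod.cong) auto
  also have "\<dots> = (\<Prod>x\<in>j_invariant ` Z. [:- x, 1:])" by (simp add: prod.reindex[OF inj])
  also have "\<dots> = smult (lead_coeff (cpoly p)) (\<Prod>x | poly (cpoly p) x = 0. [:- x, 1:])" unfolding img monic by simp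
  also have "\<dots> = cpoly p"
  proof (rule complex_poly_decompose_rsquarefree)
    show "rsquarefree (cpoly p)"
      unfolding rsquarefree_roots using irreducible_imp_cpoly_separable[OF irr] by (auto simp: cpoly_pderiv)
  qed
  finally show ?thesis using irr unfolding n_def by metis
qed

end
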